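(* Let $d\ge1$, $d<s<\alpha$, $a,b>0$, $\rho(r)=r^{-s}$, $\phi(r)=ar^{-\alpha}-br^{-s}$. Let $F\in C^2((0,\infty))$ be convex and such that, with $g(r):=r^{1-\alpha/s}F'(r)$, $h(r):=F(r)-\frac s\alpha rF'(r)$ and $I:=\{F'<0\}$, $g$ is strictly increasing on $I$, $g(I)=(-\infty,0)$, and $h\circ g^{-1}$ is strictly decreasing on $(-\infty,0)$ (with $g^{-1}$ the inverse of $g|_I$). Let $\mathcal E[L]=F(\zeta_L(s))+a\zeta_L(\alpha)-b\zeta_L(s)$. Then for every $L\in\mathcal L_d(1)$ the map $\lambda\mapsto\mathcal E[\lambda L]$ has a unique minimizer $\lambda^{\mathcal E}_L$, and for $L_d\in\mathcal L_d(1)$ the following are equivalent: (i) $L_d$ is the unique minimizer on $\mathcal L_d(1)$ of $e^*(L)=\zeta_L(\alpha)^s/\zeta_L(s)^\alpha$; (ii) $\lambda^{\mathcal E}_{L_d}L_d$ is the unique minimizer of $\mathcal E$ on $\mathcal L_d$; (iii) $\lambda^{\phi}_{L_d}L_d$ is the unique minimizer of $E_\phi$ on $\mathcal L_d$, where $\lambda^\phi_L=\big(\alpha a\zeta_L(\alpha)/(sb\zeta_L(s))\big)^{1/(\alpha-s)}$ is the unique minimizer of $\lambda\mapsto E_\phi[\lambda L]$. In particular, if $d=2$ and $H(\alpha)<H(s)$, the unique minimizer of $\mathcal E$ on $\mathcal L_2$ is $\lambda^{\mathcal E}_{\mathsf A_2}\mathsf A_2$. Furthermore, if $L_d$ is the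 unique minimizer of $L\mapsto\zeta_L(s)$ on $\mathcal L_d(1)$ and also a minimizer of $e^*$ on $\mathcal L_d(1)$, then $L_d$ is the unique minimizer of $L\mapsto\lambda^{\mathcal E}_L$ on $\mathcal L_d(1)$.
   Context: $\mathcal L_d$ denotes the set of all lattices $L=\bigoplus_{i=1}^d\mathbb Z u_i$ with $\{u_i\}$ a basis of $\mathbb R^d$, and $\mathcal L_d(1)\subset\mathcal L_d$ the lattices with $|\det(u_1,\dots,u_d)|=1$. $\zeta_L(s)=\sum_{q\in L\setminus\{0\}}|q|^{-s}$ for $s>d$; $E_f[L]:=\sum_{q\in L\setminus\{0\}}f(|q|)$. $\mathsf A_2:=\sqrt{2/\sqrt3}\,[\mathbb Z(1,0)\oplus\mathbb Z(1/2,\sqrt3/2)]$. $H(t):=\frac12\pi^{-t/2}\Gamma(t/2)\,t$ with $\Gamma$ the Gamma function. Uniqueness is up to isometries. *)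

theory Defs
  imports "HOL-Analysis.Analysis"
begin

definition lattice :: "(real^'n) set \<Rightarrow> bool" where
  "lattice L \<longleftrightarrow> (\<exists>B::real^'n^'n. invertible B \<and>
     L = range (\<lambda>k::'n \<Rightarrow> int. B *v (\<chi> i. real_of_int (k i))))"

definition lattice1 :: "(real^'n) set \<Rightarrow> bool" where
  "lattice1 L \<longleftrightarrow> (\<exists>B::real^'n^'n. invertible B \<and> \<bar>det B\<bar> = 1 \<and>
     L = range (\<lambda>k::'n \<Rightarrow> int. B *v (\<chi> i. real_of_int (k i))))"

definition scale_lat :: "real \<Rightarrow> 'a::real_vector set \<Rightarrow> 'a set" where
  "scale_lat c L = (\<lambda>x. c *\<^sub>R x) ` L"

definition zeta :: "'a::real_normed_vector set \<Rightarrow> real \<Rightarrow> real" where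
  "zeta L s = infsum (\<lambda>q. norm q powr (- s)) (L - {0})"

definition Ef :: "(real \<Rightarrow> real) \<Rightarrow> 'a::real_normed_vector set \<Rightarrow> real" where
  "Ef f L = infsum (\<lambda>q. f (norm q)) (L - {0})"

definition congruent_lat :: "'a::real_inner set \<Rightarrow> 'a set \<Rightarrow> bool" where
  "congruent_lat L M \<longleftrightarrow> (\<exists>f. orthogonal_transformation f \<and> f ` L = M)"

definition is_min_lat :: "('a set \<Rightarrow> bool) \<Rightarrow> ('a set \<Rightarrow> real) \<Rightarrow> 'a set \<Rightarrow> bool" where
  "is_min_lat P f L \<longleftrightarrow> P L \<and> (\<forall>M. P M \<longrightarrow> f L \<le> f M)"

definition unique_min_lat :: "('a::real_inner set \<Rightarrow> bool) \<Rightarrow> ('a set \<Rightarrow> real) \<Rightarrow> 'a set \<Rightarrow> bool" where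
  "unique_min_lat P f L \<longleftrightarrow> P L \<and> (\<forall>M. P M \<longrightarrow> f L \<le> f M) \<and>
     (\<forall>M. P M \<and> f M \<le> f L \<longrightarrow> congruent_lat L M)"

definition unique_min_pos :: "(real \<Rightarrow> real) \<Rightarrow> real \<Rightarrow> bool" where
  "unique_min_pos f x \<longleftrightarrow> x > 0 \<and> (\<forall>y>0. f x \<le> f y) \<and> (\<forall>y>0. f y \<le> f x \<longrightarrow> y = x)"

definition calE :: "(real \<Rightarrow> real) \<Rightarrow> real \<Rightarrow> real \<Rightarrow> real \<Rightarrow> real \<Rightarrow> 'a::real_normed_vector set \<Rightarrow> real" where
  "calE F a b \<alpha> s L = F (zeta L s) + a * zeta L \<alpha> - b * zeta L s"

definition estar :: "real \<Rightarrow> real \<Rightarrow> 'a::real_normed_vector set \<Rightarrow> real" where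
  "estar \<alpha> s L = zeta L \<alpha> powr s / zeta L s powr \<alpha>"

definition lamE :: "(real \<Rightarrow> real) \<Rightarrow> real \<Rightarrow> real \<Rightarrow> real \<Rightarrow> real \<Rightarrow> 'a::real_normed_vector set \<Rightarrow> real" where
  "lamE F a b \<alpha> s L = (THE t. unique_min_pos (\<lambda>\<mu>. calE F a b \<alpha> s (scale_lat \<mu> L)) t)"

definition phi :: "real \<Rightarrow> real \<Rightarrow> real \<Rightarrow> real \<Rightarrow> real \<Rightarrow> real" where
  "phi a b \<alpha> s r = a * r powr (- \<alpha>) - b * r powr (- s)"

definition lamphi :: "real \<Rightarrow> real \<Rightarrow> real \<Rightarrow> real \<Rightarrow> 'a::real_normed_vector set \<Rightarrow> real" where
  "lamphi a b \<alpha> s L = (\<alpha> * a * zeta L \<alpha> / (s * b * zeta L s)) powr (1 / (\<alpha> - s))"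

definition Hfun :: "real \<Rightarrow> real" where
  "Hfun t = 1/2 * pi powr (- t / 2) * Gamma (t / 2) * t"

definition A2 :: "(real^2) set" where
  "A2 = (\<lambda>(m::int, n::int). sqrt (2 / sqrt 3) *\<^sub>R
          (of_int m *\<^sub>R vector [1, 0] + of_int n *\<^sub>R vector [1/2, sqrt 3 / 2])) ` UNIV"

end

theory Submission
  imports Defs "HOL-Probability.Probability"
begin

text \<open>
  Along the ray of a lattice \<open>L\<close> the energy is, in the variable \<open>r = zeta (\<mu> L) s\<close>, the strictly convex
  function \<open>F r + c r\<^sup>p - b r\<close> with \<open>p = \<alpha> / s\<close> and \<open>c = a (estar L)\<^sup>q\<close>, \<open>q = 1 / s\<close>. Its minimal value increases
  and its minimizer decreases with \<open>c\<close>, so minimizing the energy over all lattices amounts to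
  minimizing \<open>estar\<close>; the case \<open>F = 0\<close> is the potential \<open>phi\<close>.

  In the plane one therefore only has to treat the potential \<open>s r\<close> to the power \<open>- \<alpha>\<close> minus \<open>\<alpha> r\<close> to the
  power \<open>- s\<close>. The theta function of a lattice of covolume one is at least that of \<open>A2\<close>: past the first shell
  one averages over the rotation of order three, on the first shell a quadratic lower bound of the
  exponential suffices, and Poisson summation gives the remaining parameters. Integrating
  the difference against the Mellin kernel, symmetrized by the functional equation, shows that
  \<open>Gamma (t / 2)\<close> times \<open>pi\<close> to the power \<open>- t / 2\<close> times the excess of \<open>zeta L t\<close> over \<open>zeta A2 t\<close> increases with
  \<open>t\<close>; together with \<open>Hfun \<alpha> < Hfun s\<close> this settles covolume at most one. A lattice of larger covolume is
  first contracted, which lowers its energy.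
\<close>

section \<open>Energy profiles\<close>

text \<open>\<open>estar\<close> does not see the weights of the potential, so in the plane they may
  be chosen freely; the weights \<open>s\<close> and \<alpha> put the minimum of the potential at
  squared norm 1, which is what the contraction uses. The bound one on the covolume comes from
  rescaling: for covolume \<open>k\<close> the excesses of the two zeta functions over those of
  \<open>A2\<close> are multiplied by \<open>k\<close> to the powers -\<alpha>/2 and -s/2. For
  \<open>k\<close> at most 1 the first factor is the larger one, on the favourable side; above 1 the
  order reverses. The theta comparison is delicate near \<open>A2\<close>: the gain on the first
  shell and the possible loss on the farther shells are both linear in the deviation
  \<open>tau\<close> from the hexagonal form. In units of \<open>exp (- t) * t * tau\<close> the
  gain 22/360 has to beat the loss 6/100, and the constants 18/5, 371/100, 281 and 18/100 are tuned
  to that comparison. Poisson summation is only ever applied to Gaussians of one variable, once for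
  \<open>theta\<close> at \<open>y\<close> and once at \<open>1 / y\<close>.\<close>

locale energy_profile =
  fixes F F' :: "real \<Rightarrow> real" and p b :: real
  assumes p_gt_1: "1 < p" and b_pos: "0 < b"
    and deriv_F: "\<And>r. 0 < r \<Longrightarrow> (F has_real_derivative F' r) (at r)"
    and mono_F': "\<And>r r'. 0 < r \<Longrightarrow> r \<le> r' \<Longrightarrow> F' r \<le> F' r'"
    and critical: "\<And>c. 0 < c \<Longrightarrow> \<exists>r>0. F' r + c * p * r powr (p - 1) = b"
begin

definition G :: "real \<Rightarrow> real \<Rightarrow> real" where
  "G c r = F r + c * r powr p - b * r"

definition G' :: "real \<Rightarrow> real \<Rightarrow> real" where
  "G' c r = F' r + c * p * r powr (p - 1) - b"

definition rmin :: "real \<Rightarrow> real" where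
  "rmin c = (SOME r. 0 < r \<and> G' c r = 0)"

lemma rmin: assumes "0 < c" shows "0 < rmin c" and "G' c (rmin c) = 0"
proof -
  from critical[OF assms] have "\<exists>r. 0 < r \<and> G' c r = 0"
    by (auto simp: G'_def)
  from someI_ex[OF this] show "0 < rmin c" "G' c (rmin c) = 0"
    by (auto simp: rmin_def)
qed

lemma G'_strict_mono: assumes "0 < c" "0 < r" "r < r'" shows "G' c r < G' c r'"
proof -
  have "r powr (p - 1) < r' powr (p - 1)"
    using assms p_gt_1 by (intro powr_less_mono2) auto
  then have "c * p * r powr (p - 1) < c * p * r' powr (p - 1)"
    using assms p_gt_1 by (intro mult_strict_left_mono) auto
  then show ?thesis using mono_F'[of r r'] assms unfolding G'_def by linarith
qed

lemma deriv_G: assumes "0 < r" shows "(G c has_real_derivative G' c r) (at r)"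
  unfolding G_def[abs_def] G'_def using assms
  by (auto intro!: derivative_eq_intros deriv_F)

lemma G_less: assumes "0 < c" "0 < r" "r \<noteq> rmin c" shows "G c (rmin c) < G c r"
proof (cases "rmin c < r")
  case True
  obtain x where x: "rmin c < x" "x < r" "G c r - G c (rmin c) = (r - rmin c) * G' c x"
    using MVT2[OF True, of "G c" "G' c"] deriv_G rmin(1)[OF assms(1)] by force
  have "0 < G' c x"
    using G'_strict_mono[OF assms(1) rmin(1)[OF assms(1)] x(1)] rmin(2)[OF assms(1)] by simp
  with x True have "0 < G c r - G c (rmin c)" by simp
  then show ?thesis by simp
next
  case False
  with assms have less: "r < rmin c" by simp
  obtain x where x: "r < x" "x < rmin c" "G c (rmin c) - G c r = (rmin c - r) * G' c x"
    using MVT2[OF less, of "G c" "G' c"] deriv_G assms by force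
  have "G' c x < 0"
    using G'_strict_mono[OF assms(1) _ x(2)] rmin(2)[OF assms(1)] assms x by simp
  with x less have "G c (rmin c) - G c r < 0" by (simp add: mult_pos_neg)
  then show ?thesis by simp
qed

lemma rmin_eqI: assumes "0 < c" "0 < r" "G' c r = 0" shows "rmin c = r"
  using G'_strict_mono[of c r "rmin c"] G'_strict_mono[of c "rmin c" r] rmin[OF assms(1)] assms
  by (metis less_irrefl linorder_neqE)

text \<open>Raising \<open>c\<close> raises \<open>G'\<close> at every point, so its zero moves to
  the left.\<close>

lemma rmin_strict_antimono: assumes "0 < c" "c < c'" shows "rmin c' < rmin c"
proof (rule ccontr)
  assume "\<not> rmin c' < rmin c"
  then have le: "rmin c \<le> rmin c'" by simp
  have c': "0 < c'" using assms by simp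
  have "G' c (rmin c) < G' c' (rmin c)"
    using assms p_gt_1 rmin(1)[OF assms(1)] by (simp add: G'_def)
  also have "\<dots> \<le> G' c' (rmin c')"
    using G'_strict_mono[OF c' rmin(1)[OF assms(1)], of "rmin c'"] le by (cases "rmin c = rmin c'") auto
  finally show False using rmin(2)[OF assms(1)] rmin(2)[OF c'] by simp
qed

text \<open>Both profiles are compared at the single point \<open>rmin c'\<close>: there
  \<open>G c\<close> is at least its own minimum and strictly below \<open>G c'\<close>.\<close>

lemma G_min_strict_mono: assumes "0 < c" "c < c'" shows "G c (rmin c) < G c' (rmin c')"
proof -
  have c': "0 < c'" using assms by simp
  have "G c (rmin c) \<le> G c (rmin c')"
    using G_less[OF assms(1) rmin(1)[OF c']] by (cases "rmin c = rmin c'") auto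
  also have "\<dots> < G c' (rmin c')"
    using assms rmin(1)[OF c'] by (simp add: G_def)
  finally show ?thesis .
qed

end

lemma energy_profile_zero:
  assumes "1 < p" "0 < b"
  shows "energy_profile (\<lambda>_. 0) (\<lambda>_. 0) p b"
proof
  fix c :: real assume "0 < c"
  then show "\<exists>r>0. 0 + c * p * r powr (p - 1) = b"
    using assms by (intro exI[of _ "(b / (c * p)) powr (1 / (p - 1))"])
      (simp add: powr_powr)
qed (use assms in auto)

text \<open>The point is a stationary point for every \<open>c\<close>, found by the intermediate
  value theorem. Where the function in \<open>g_image\<close> takes the value
  \<open>- (c * p)\<close>, the derivative of \<open>F\<close> cancels the power term; for large
  \<open>r\<close> the power term exceeds any bound while the derivative of \<open>F\<close> does
  not decrease. The level \<open>b\<close> lies in between.\<close>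

lemma energy_profile_convex:
  fixes F :: "real \<Rightarrow> real"
  assumes p: "1 < p" and b: "0 < b"
    and F_diff: "\<And>r. 0 < r \<Longrightarrow> F differentiable (at r)"
    and F'_diff: "\<And>r. 0 < r \<Longrightarrow> deriv F differentiable (at r)"
    and F_convex: "convex_on {0<..} F"
    and g_image: "(\<lambda>r. r powr (1 - p) * deriv F r) ` {r. r > 0 \<and> deriv F r < 0} = {..<0}"
  shows "energy_profile F (deriv F) p b"
proof
  show "1 < p" "0 < b" by fact+
  show deriv: "(F has_real_derivative deriv F r) (at r)" if "0 < r" for r
    using F_diff[OF that] by (simp add: DERIV_deriv_iff_real_differentiable)
  show mono: "deriv F r \<le> deriv F r'" if "0 < r" "r \<le> r'" for r r'
  proof (cases "r = r'")
    case False
    have "deriv F r * (r' - r) \<le> F r' - F r"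
      by (rule convex_on_imp_above_tangent[OF F_convex])
        (use that deriv in \<open>auto intro: has_field_derivative_at_within simp: connected_iff_interval interior_open\<close>)
    moreover have "deriv F r' * (r - r') \<le> F r - F r'"
      by (rule convex_on_imp_above_tangent[OF F_convex])
        (use that deriv in \<open>auto intro: has_field_derivative_at_within simp: connected_iff_interval interior_open\<close>)
    ultimately have "deriv F r * (r' - r) \<le> deriv F r' * (r' - r)" by (simp add: algebra_simps)
    with that False show ?thesis by simp
  qed simp
  fix c :: real assume c: "0 < c"
  define G' where "G' r = deriv F r + c * p * r powr (p - 1)" for r
  have "- (c * p) \<in> (\<lambda>r. r powr (1 - p) * deriv F r) ` {r. r > 0 \<and> deriv F r < 0}"
    unfolding g_image using c p by simp
  then obtain r0 where r0: "0 < r0" "r0 powr (1 - p) * deriv F r0 = - (c * p)" by auto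
  have "deriv F r0 = r0 powr (p - 1) * (r0 powr (1 - p) * deriv F r0)"
    using r0(1) by (simp add: powr_add[symmetric] mult.assoc[symmetric])
  then have G'0: "G' r0 = 0" using r0(2) by (simp add: G'_def)
  \<comment> \<open>Large enough for the power term to reach \<open>b\<close> plus the absolute
    value of \<open>deriv F r0\<close>, which makes up for the negative derivative.\<close>
  define r1 where "r1 = max r0 (((b + \<bar>deriv F r0\<bar>) / (c * p)) powr (1 / (p - 1)))"
  have "(b + \<bar>deriv F r0\<bar>) / (c * p) = (((b + \<bar>deriv F r0\<bar>) / (c * p)) powr (1 / (p - 1))) powr (p - 1)"
    using p b c by (simp add: powr_powr)
  also have "\<dots> \<le> r1 powr (p - 1)"
    using p by (intro powr_mono2) (auto simp: r1_def)
  finally have "b + \<bar>deriv F r0\<bar> \<le> c * p * r1 powr (p - 1)"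
    using c p by (simp add: field_simps)
  moreover have "deriv F r0 \<le> deriv F r1" by (rule mono) (use r0 in \<open>auto simp: r1_def\<close>)
  ultimately have "b \<le> G' r1" by (simp add: G'_def)
  moreover have "isCont G' x" if "r0 \<le> x" "x \<le> r1" for x
    using that r0 F'_diff[of x] unfolding G'_def[abs_def]
    by (auto intro!: continuous_intros simp: differentiable_imp_continuous_within)
  ultimately obtain x where "r0 \<le> x" "G' x = b"
    using IVT[of G' r0 b r1] G'0 b max.cobounded1[of r0, folded r1_def]
    by (metis less_imp_le r1_def max.cobounded1)
  with r0 show "\<exists>r>0. deriv F r + c * p * r powr (p - 1) = b"
    by (auto simp: G'_def intro!: exI[of _ x])
qed

section \<open>Lattices and their zeta functions\<close>

lemma summable_on_int_even:
  fixes f :: "int \<Rightarrow> real"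
  assumes "summable (\<lambda>n. f (int n))" and "\<And>n. 0 \<le> f n" and even: "\<And>n. f (- n) = f n"
  shows "f summable_on UNIV"
proof -
  have nat: "(\<lambda>n. f (int n)) summable_on UNIV"
    using assms by (subst summable_on_UNIV_nonneg_real_iff) auto
  have "f summable_on (range int)"
    by (subst summable_on_reindex) (use nat in \<open>auto simp: o_def\<close>)
  moreover have "f summable_on (range (\<lambda>n. - int n))"
    by (subst summable_on_reindex) (use nat in \<open>auto simp: o_def inj_on_def even\<close>)
  ultimately have "f summable_on (range int \<union> range (\<lambda>n. - int n))"
    by (rule summable_on_union)
  moreover have "range int \<union> range (\<lambda>n. - int n) = UNIV"
  proof -
    have "k \<in> range int \<union> range (\<lambda>n. - int n)" for k by (cases k rule: int_cases2) auto
    then show ?thesis by blast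
  qed
  ultimately show ?thesis by simp
qed

lemma summable_on_int_powr:
  assumes "1 < t"
  shows "(\<lambda>k::int. (1 + \<bar>real_of_int k\<bar>) powr (- t)) summable_on UNIV"
proof (rule summable_on_int_even)
  have "summable (\<lambda>n. real (Suc n) powr (- t))"
    using assms by (subst summable_Suc_iff) (simp add: summable_real_powr_iff)
  then show "summable (\<lambda>n. (1 + \<bar>real_of_int (int n)\<bar>) powr (- t))"
    by (simp add: add.commute)
qed auto

text \<open>Every factor \<open>1 + \<bar>k i\<bar>\<close> is at most a constant times the norm of
  the lattice vector. The term is therefore dominated by a product over the \<open>n\<close>
  coordinates of one-dimensional terms with exponent \<open>s / n > 1\<close>.\<close>

lemma summable_on_lattice_norm_powr:
  fixes L :: "(real^'n) set"
  assumes "lattice L" and s: "real CARD('n) < s"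
  shows "(\<lambda>q. norm q powr (- s)) summable_on (L - {0})"
proof -
  from assms(1) obtain B :: "real^'n^'n" where inv: "invertible B"
    and L: "L = range (\<lambda>k::'n \<Rightarrow> int. B *v (\<chi> i. real_of_int (k i)))"
    by (auto simp: lattice_def)
  define V :: "('n \<Rightarrow> int) \<Rightarrow> real^'n" where "V k = (\<chi> i. real_of_int (k i))" for k
  let ?f = "\<lambda>k. B *v V k"
  define n where "n = real CARD('n)"
  have n: "0 < n" by (simp add: n_def)
  obtain B' where B': "B' ** B = mat 1" using inv by (auto simp: invertible_def)
  obtain K where K: "0 < K" "\<And>x. norm (B' *v x) \<le> norm x * K"
    using bounded_linear.pos_bounded[OF matrix_vector_mul_bounded_linear[of B']] by blast
  have low: "norm (V k) \<le> K * norm (B *v V k)" for k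
    using K(2)[of "B *v V k"] by (simp add: matrix_vector_mul_assoc B' mult.commute)
  have inj: "inj ?f"
  proof (rule injI)
    fix k k' assume "?f k = ?f k'"
    then have "B' *v (B *v V k) = B' *v (B *v V k')" by simp
    then have "V k = V k'" by (simp add: matrix_vector_mul_assoc B')
    then show "k = k'" by (simp add: V_def vec_eq_iff fun_eq_iff)
  qed
  have f0: "?f k = 0 \<longleftrightarrow> k = (\<lambda>_. 0)" for k
  proof -
    have "?f (\<lambda>_. 0) = 0" by (simp add: V_def matrix_vector_mult_def vec_eq_iff)
    then show ?thesis using inj by (metis injD)
  qed
  have set: "L - {0} = ?f ` (UNIV - {\<lambda>_. 0})"
    using f0 by (auto simp: L V_def)
  have "Infinite_Set_Sum.abs_summable_on (\<lambda>k. \<Prod>i\<in>(UNIV::'n set). (1 + \<bar>real_of_int (k i)\<bar>) powr (- (s / n))) (PiE UNIV (\<lambda>_. UNIV))"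
  proof (rule Infinite_Set_Sum.abs_summable_on_prod_PiE)
    have "1 < s / n" using s n by (simp add: n_def)
    from summable_on_int_powr[OF this]
    show "Infinite_Set_Sum.abs_summable_on (\<lambda>k::int. (1 + \<bar>real_of_int k\<bar>) powr - (s / n)) UNIV"
      by (subst (asm) summable_on_iff_abs_summable_on_real) (simp only: abs_summable_equivalent)
  qed auto
  then have prod_summable: "(\<lambda>k. \<Prod>i\<in>(UNIV::'n set). (1 + \<bar>real_of_int (k i)\<bar>) powr (- (s / n))) summable_on UNIV"
    by (subst summable_on_iff_abs_summable_on_real) (simp only: abs_summable_equivalent PiE_UNIV_domain Pi_UNIV)
  then have "(\<lambda>k. (2 * K) powr s * (\<Prod>i\<in>(UNIV::'n set). (1 + \<bar>real_of_int (k i)\<bar>) powr (- (s / n)))) summable_on UNIV"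
    by (rule summable_on_cmult_right)
  then have "(\<lambda>k. (2 * K) powr s * (\<Prod>i\<in>(UNIV::'n set). (1 + \<bar>real_of_int (k i)\<bar>) powr (- (s / n)))) summable_on (UNIV - {\<lambda>_. 0})"
    by (rule summable_on_subset_banach) auto
  then have "((\<lambda>q. norm q powr (- s)) \<circ> ?f) summable_on (UNIV - {\<lambda>_. 0})"
  proof (rule summable_on_comparison_test)
    fix k :: "'n \<Rightarrow> int" assume "k \<in> UNIV - {\<lambda>_. 0}"
    then obtain j where j: "k j \<noteq> 0" by auto
    define M where "M = 2 * K * norm (?f k)"
    have "1 \<le> \<bar>real_of_int (k j)\<bar>" using j by linarith
    also have "\<dots> \<le> norm (V k)" using component_le_norm_cart[of "V k" j] by (simp add: V_def)
    finally have one: "1 \<le> norm (V k)" .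
    have bound: "1 + \<bar>real_of_int (k i)\<bar> \<le> M" for i
      using component_le_norm_cart[of "V k" i] one low[of k] by (simp add: V_def M_def)
    \<comment> \<open>\<open>undefined\<close> is merely some coordinate; the bound holds for each
      of them.\<close>
    have M: "0 < M" using bound[of undefined] by linarith
    have "M powr (- s) = (\<Prod>i\<in>(UNIV::'n set). M powr (- (s / n)))"
    proof -
      have "(M powr (- (s / n))) ^ CARD('n) = M powr (- (s / n) * n)"
        using M powr_realpow[of "M powr (- (s / n))" "CARD('n)"] by (simp only: powr_powr n_def) simp
      then show ?thesis using n by simp
    qed
    also have "\<dots> \<le> (\<Prod>i\<in>(UNIV::'n set). (1 + \<bar>real_of_int (k i)\<bar>) powr (- (s / n)))"
      by (intro prod_mono) (use bound s n in \<open>auto intro!: powr_mono2' simp: n_def\<close>)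
    finally have "M powr (- s) \<le> (\<Prod>i\<in>(UNIV::'n set). (1 + \<bar>real_of_int (k i)\<bar>) powr (- (s / n)))" .
    moreover have "norm (?f k) powr (- s) = (2 * K) powr s * M powr (- s)"
      using K(1) by (simp add: M_def powr_mult powr_minus field_simps)
    ultimately show "((\<lambda>q. norm q powr (- s)) \<circ> ?f) k \<le> (2 * K) powr s * (\<Prod>i\<in>(UNIV::'n set). (1 + \<bar>real_of_int (k i)\<bar>) powr (- (s / n)))"
      by (simp add: mult_left_mono)
  qed auto
  then show ?thesis
    unfolding set by (subst summable_on_reindex) (use inj in \<open>auto intro: inj_on_subset\<close>)
qed

lemma lattice1_imp_lattice: "lattice1 L \<Longrightarrow> lattice L"
  by (auto simp: lattice_def lattice1_def)

lemma zeta_pos: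
  fixes L :: "(real^'n) set"
  assumes L: "lattice L" and s: "real CARD('n) < s"
  shows "0 < zeta L s"
proof -
  from L obtain B :: "real^'n^'n" where inv: "invertible B"
    and L': "L = range (\<lambda>k::'n \<Rightarrow> int. B *v (\<chi> i. real_of_int (k i)))"
    by (auto simp: lattice_def)
  let ?q = "B *v (\<chi> i. 1)"
  have "?q \<in> L" unfolding L' by (rule range_eqI[of _ _ "\<lambda>_. 1"]) simp
  moreover have "?q \<noteq> 0"
  proof
    assume "?q = 0"
    then have "(\<chi> i. 1) = (0 :: real^'n)"
      using inv by (metis invertible_def matrix_left_invertible_ker)
    then show False by (simp add: vec_eq_iff)
  qed
  ultimately have "?q \<in> L - {0}" by simp
  then show ?thesis unfolding zeta_def
    using nonneg_infsum_le_0D[OF _ summable_on_lattice_norm_powr[OF L s], of ?q]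
    by (force simp: not_le[symmetric])
qed

lemma infsum_scale_lat:
  fixes L :: "'a::real_normed_vector set"
  assumes "c \<noteq> 0"
  shows "infsum f (scale_lat c L - {0}) = infsum (\<lambda>q. f (c *\<^sub>R q)) (L - {0})"
proof -
  have "scale_lat c L - {0} = (\<lambda>x. c *\<^sub>R x) ` (L - {0})"
    using assms by (auto simp: scale_lat_def)
  moreover have "inj_on (\<lambda>x. c *\<^sub>R x) (L - {0})" using assms by (auto simp: inj_on_def)
  ultimately show ?thesis by (simp add: infsum_reindex o_def)
qed

lemma zeta_scale_lat:
  assumes "0 < c"
  shows "zeta (scale_lat c L) s = c powr (- s) * zeta L s"
  using assms unfolding zeta_def
  by (simp add: infsum_scale_lat powr_mult infsum_cmult_right')

lemma scale_lat_scale_lat: "scale_lat c (scale_lat d L) = scale_lat (c * d) L"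
  by (auto simp: scale_lat_def image_image)

section \<open>Covolume, scaling and congruence of lattices\<close>

lemma det_scaleR:
  fixes B :: "real^'n^'n"
  shows "det (c *\<^sub>R B) = c ^ CARD('n) * det B"
  by (simp add: det_def prod.distrib sum_distrib_left mult_ac)

lemma lattice_scale_lat:
  fixes L :: "(real^'n) set"
  assumes "lattice L" "c \<noteq> 0"
  shows "lattice (scale_lat c L)"
proof -
  from assms obtain B :: "real^'n^'n" where inv: "invertible B"
    and L: "L = range (\<lambda>k::'n \<Rightarrow> int. B *v (\<chi> i. real_of_int (k i)))"
    by (auto simp: lattice_def)
  have "invertible (c *\<^sub>R B)"
    using inv assms(2) by (simp add: invertible_det_nz det_scaleR)
  moreover have "scale_lat c L = range (\<lambda>k::'n \<Rightarrow> int. (c *\<^sub>R B) *v (\<chi> i. real_of_int (k i)))"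
    by (auto simp: scale_lat_def L image_image scaleR_matrix_vector_assoc)
  ultimately show ?thesis by (auto simp: lattice_def)
qed

lemma lattice_eq_scale_lat_lattice1:
  fixes L :: "(real^'n) set"
  assumes "lattice L"
  obtains M c where "lattice1 M" "0 < c" "L = scale_lat c M"
proof -
  from assms obtain B :: "real^'n^'n" where inv: "invertible B"
    and L: "L = range (\<lambda>k::'n \<Rightarrow> int. B *v (\<chi> i. real_of_int (k i)))"
    by (auto simp: lattice_def)
  define c where "c = \<bar>det B\<bar> powr (1 / real CARD('n))"
  have det: "det B \<noteq> 0" using inv by (simp add: invertible_det_nz)
  then have c: "0 < c" by (simp add: c_def)
  have cn: "c ^ CARD('n) = \<bar>det B\<bar>"
  proof -
    have "(\<bar>det B\<bar> powr (1 / real CARD('n))) ^ CARD('n) = \<bar>det B\<bar> powr (1 / real CARD('n) * real CARD('n))"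
      using det by (simp only: powr_powr[symmetric]) (simp add: powr_realpow)
    then show ?thesis using det by (simp add: c_def)
  qed
  let ?M = "scale_lat (1 / c) L"
  have "det ((1 / c) *\<^sub>R B) = (1 / c) ^ CARD('n) * det B" by (simp add: det_scaleR)
  then have abs: "\<bar>det ((1 / c) *\<^sub>R B)\<bar> = 1"
    using c det cn by (simp add: abs_mult power_divide)
  then have "invertible ((1 / c) *\<^sub>R B)" by (auto simp: invertible_det_nz)
  moreover have "?M = range (\<lambda>k::'n \<Rightarrow> int. ((1 / c) *\<^sub>R B) *v (\<chi> i. real_of_int (k i)))"
    by (auto simp: scale_lat_def L image_image scaleR_matrix_vector_assoc)
  ultimately have "lattice1 ?M" using abs by (auto simp: lattice1_def)
  moreover have "L = scale_lat c ?M" using c unfolding scale_lat_scale_lat by (simp add: scale_lat_def)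
  ultimately show ?thesis using c that by blast
qed

lemma det_integer_entries:
  fixes N :: "real^'n^'n"
  assumes "\<And>i j. N $ i $ j \<in> \<int>"
  shows "det N \<in> \<int>"
  unfolding det_def using assms by (intro Ints_sum Ints_mult Ints_prod) auto

text \<open>Writing the scaled basis in terms of the other one gives
  \<open>t *\<^sub>R B = B' ** N\<close> with an integer matrix \<open>N\<close>, so
  \<open>t ^ n\<close> is a nonzero integer up to sign. Applied to \<open>t\<close> and to its
  inverse, this shows that the scale of a lattice of covolume one is determined by the set itself
  and not by the chosen basis.\<close>

lemma lattice1_scale_ge_1:
  fixes L :: "(real^'n) set"
  assumes "lattice1 L" "lattice1 (scale_lat t L)" and t: "0 < t"
  shows "1 \<le> t"
proof -
  obtain B :: "real^'n^'n" where B: "invertible B" "\<bar>det B\<bar> = 1"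
    and L: "L = range (\<lambda>k::'n \<Rightarrow> int. B *v (\<chi> i. real_of_int (k i)))"
    using assms(1) by (auto simp: lattice1_def)
  obtain B' :: "real^'n^'n" where B': "invertible B'" "\<bar>det B'\<bar> = 1"
    and L': "scale_lat t L = range (\<lambda>k::'n \<Rightarrow> int. B' *v (\<chi> i. real_of_int (k i)))"
    using assms(2) by (auto simp: lattice1_def)
  have "\<exists>k::'n \<Rightarrow> int. t *\<^sub>R column j B = B' *v (\<chi> i. real_of_int (k i))" for j
  proof -
    have "column j B = B *v (\<chi> i. real_of_int (if i = j then 1 else 0))"
      by (simp add: vec_eq_iff column_def matrix_vector_mult_def if_distrib cong: if_cong)
    then have "column j B \<in> L" unfolding L by (intro range_eqI[of _ _ "\<lambda>i. if i = j then 1 else 0"])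
    then have "t *\<^sub>R column j B \<in> scale_lat t L" by (auto simp: scale_lat_def)
    then show ?thesis unfolding L' by blast
  qed
  then obtain k :: "'n \<Rightarrow> 'n \<Rightarrow> int" where k: "\<And>j. t *\<^sub>R column j B = B' *v (\<chi> i. real_of_int (k j i))"
    by metis
  define N :: "real^'n^'n" where "N = (\<chi> i j. real_of_int (k j i))"
  have "t *\<^sub>R B = B' ** N"
    using k by (auto simp: N_def vec_eq_iff column_def matrix_vector_mult_def matrix_matrix_mult_def)
  then have "det (t *\<^sub>R B) = det B' * det N" by (simp add: det_mul)
  then have "t ^ CARD('n) * det B = det B' * det N" by (simp add: det_scaleR)
  then have "\<bar>t ^ CARD('n) * det B\<bar> = \<bar>det B' * det N\<bar>" by simp
  then have eq: "t ^ CARD('n) = \<bar>det N\<bar>" using B B' t by (simp add: abs_mult)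
  have "det N \<in> \<int>" by (rule det_integer_entries) (simp add: N_def)
  moreover have "det N \<noteq> 0" using eq t by auto
  ultimately have "1 \<le> \<bar>det N\<bar>" by (rule Ints_nonzero_abs_ge1)
  with eq have "1 ^ CARD('n) \<le> t ^ CARD('n)" by simp
  then show ?thesis using t by (subst (asm) power_mono_iff) auto
qed

lemma congruent_lat_sym:
  fixes L M :: "'a::euclidean_space set"
  assumes "congruent_lat L M" shows "congruent_lat M L"
proof -
  from assms obtain f where f: "orthogonal_transformation f" "f ` L = M"
    by (auto simp: congruent_lat_def)
  have "bij f" using f(1) by (simp add: bij_def orthogonal_transformation_inj orthogonal_transformation_surj)
  then have "inv f ` M = L" using f(2) by (auto simp: image_image bij_is_inj)
  with orthogonal_transformation_inv[OF f(1)] show ?thesis by (auto simp: congruent_lat_def)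
qed

lemma congruent_lat_scale_lat:
  assumes "congruent_lat L M" shows "congruent_lat (scale_lat c L) (scale_lat c M)"
proof -
  from assms obtain f where f: "orthogonal_transformation f" "f ` L = M"
    by (auto simp: congruent_lat_def)
  have "f ` scale_lat c L = scale_lat c M"
    using f(2) orthogonal_transformation_linear[OF f(1)]
    by (auto simp: scale_lat_def image_image linear_scale)
  with f(1) show ?thesis by (auto simp: congruent_lat_def)
qed

lemma congruent_lat_zeta:
  fixes L :: "'a::euclidean_space set"
  assumes "congruent_lat L M" shows "zeta M s = zeta L s"
proof -
  from assms obtain f where f: "orthogonal_transformation f" "f ` L = M"
    by (auto simp: congruent_lat_def)
  have inj: "inj f" using f(1) by (rule orthogonal_transformation_inj)
  have f0: "f 0 = 0" using f(1) by (simp add: orthogonal_transformation_linear linear_0)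
  have "M - {0} = f ` (L - {0})"
    using f(2) inj f0 by (auto simp: inj_eq) (metis injD)
  then show ?thesis unfolding zeta_def
    using inj f(1) by (simp add: infsum_reindex inj_on_subset o_def orthogonal_transformation_norm)
qed

lemma congruent_lat_lattice1:
  fixes L :: "(real^'n) set"
  assumes "congruent_lat L M" "lattice1 L" shows "lattice1 M"
proof -
  from assms obtain f where f: "orthogonal_transformation f" "f ` L = M"
    by (auto simp: congruent_lat_def)
  obtain B :: "real^'n^'n" where B: "invertible B" "\<bar>det B\<bar> = 1"
    and L: "L = range (\<lambda>k::'n \<Rightarrow> int. B *v (\<chi> i. real_of_int (k i)))"
    using assms(2) by (auto simp: lattice1_def)
  have "orthogonal_matrix (matrix f)" and lin: "linear f"
    using f(1) orthogonal_transformation_matrix[of f] by auto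
  then have "\<bar>det (matrix f ** B)\<bar> = 1"
    using det_orthogonal_matrix[of "matrix f"] B by (auto simp: det_mul abs_mult)
  moreover from this have "invertible (matrix f ** B)" by (auto simp: invertible_det_nz)
  moreover have "M = range (\<lambda>k::'n \<Rightarrow> int. (matrix f ** B) *v (\<chi> i. real_of_int (k i)))"
    unfolding f(2)[symmetric] L using lin
    by (auto simp: image_image matrix_vector_mul_assoc[symmetric] matrix_works)
  ultimately show ?thesis by (auto simp: lattice1_def)
qed

section \<open>Minimization over lattices\<close>

lemma powr_less_iff_base:
  fixes x y t :: real
  assumes "0 < x" "0 < y" "0 < t"
  shows "x powr t < y powr t \<longleftrightarrow> x < y"
  using powr_less_mono2[of t x y] powr_mono2[of t y x] assms by (cases "x < y") auto

lemma powr_le_iff_base: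
  fixes x y t :: real
  assumes "0 < x" "0 < y" "0 < t"
  shows "x powr t \<le> y powr t \<longleftrightarrow> x \<le> y"
  using powr_less_iff_base[of y x t] assms by linarith

lemma unique_min_pos_eq: "unique_min_pos f x \<Longrightarrow> unique_min_pos f y \<Longrightarrow> x = y"
  by (auto simp: unique_min_pos_def)

text \<open>An energy whose restriction to the ray of \<open>L\<close> is, in the variable \<open>r = zeta (\<mu> L) s\<close>,
  the profile \<open>G c\<close> in which \<open>c\<close> depends on \<open>L\<close> only through \<open>estar\<close>.\<close>

locale lattice_energy = energy_profile F F' "\<alpha> / s" b for F F' :: "real \<Rightarrow> real" and \<alpha> s b a :: real +
  fixes E :: "(real^'n) set \<Rightarrow> real"
  assumes dim: "real CARD('n) < s" and a_pos: "0 < a"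
    and E_eq: "\<And>L. lattice L \<Longrightarrow> E L = F (zeta L s) + a * zeta L \<alpha> - b * zeta L s"
begin

lemma s_pos: "0 < s" using dim by (meson less_trans of_nat_0_less_iff zero_less_card_finite)

lemma s_less: "s < \<alpha>" using p_gt_1 s_pos by (simp add: field_simps)

text \<open>The ratio of \<open>zeta L \<alpha>\<close> to \<open>zeta L s\<close> raised to
  \<open>\<alpha> / s\<close> is invariant under scaling and equals \<open>estar\<close> raised to
  \<open>1 / s\<close>. Hence along a ray the \<alpha>-term of the energy is this fixed coefficient
  times a power of the variable \<open>r\<close>.\<close>

definition coef :: "(real^'n) set \<Rightarrow> real" where
  "coef L = a * estar \<alpha> s L powr (1 / s)"

text \<open>The solution \<mu> of
  \<open>\<mu> powr (- s) * zeta L s = rmin (coef L)\<close>.\<close>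

definition lam :: "(real^'n) set \<Rightarrow> real" where
  "lam L = (zeta L s / rmin (coef L)) powr (1 / s)"

lemma zeta_s_pos: "lattice L \<Longrightarrow> 0 < zeta (L :: (real^'n) set) s"
  and zeta_alpha_pos: "lattice L \<Longrightarrow> 0 < zeta (L :: (real^'n) set) \<alpha>"
  using zeta_pos[of L s] zeta_pos[of L \<alpha>] dim s_less by auto

lemma estar_pos: "lattice L \<Longrightarrow> 0 < estar \<alpha> s (L :: (real^'n) set)"
  using zeta_s_pos[of L] zeta_alpha_pos[of L] by (simp add: estar_def)

lemma coef_pos: "lattice L \<Longrightarrow> 0 < coef L"
  using estar_pos[of L] a_pos by (simp add: coef_def)

lemma coef_less_iff: "lattice L \<Longrightarrow> lattice M \<Longrightarrow> coef L < coef M \<longleftrightarrow> estar \<alpha> s L < estar \<alpha> s M"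
  using estar_pos[of L] estar_pos[of M] a_pos s_pos by (simp add: coef_def powr_less_iff_base)

lemma coef_le_iff: "lattice L \<Longrightarrow> lattice M \<Longrightarrow> coef L \<le> coef M \<longleftrightarrow> estar \<alpha> s L \<le> estar \<alpha> s M"
  using coef_less_iff[of M L] by linarith

lemma lam_pos: "lattice L \<Longrightarrow> 0 < lam L"
  using zeta_s_pos[of L] rmin(1)[OF coef_pos[of L]] by (simp add: lam_def)

lemma E_scale:
  assumes "lattice L" "0 < \<mu>"
  shows "E (scale_lat \<mu> L) = G (coef L) (\<mu> powr (- s) * zeta L s)"
proof -
  have zs: "0 < zeta L s" and za: "0 < zeta L \<alpha>" using zeta_s_pos zeta_alpha_pos assms by auto
  have "estar \<alpha> s L powr (1 / s) = zeta L \<alpha> / zeta L s powr (\<alpha> / s)"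
    using zs za s_pos by (simp add: estar_def powr_divide powr_powr)
  moreover have "(\<mu> powr (- s) * zeta L s) powr (\<alpha> / s) = \<mu> powr (- \<alpha>) * zeta L s powr (\<alpha> / s)"
    using zs s_pos by (simp add: powr_mult powr_powr)
  ultimately have "coef L * (\<mu> powr (- s) * zeta L s) powr (\<alpha> / s) = a * (\<mu> powr (- \<alpha>) * zeta L \<alpha>)"
    using zs by (simp add: coef_def)
  then show ?thesis
    using assms by (simp add: E_eq lattice_scale_lat zeta_scale_lat G_def)
qed

lemma lam_powr: "lattice L \<Longrightarrow> lam L powr (- s) * zeta L s = rmin (coef L)"
  using zeta_s_pos[of L] rmin(1)[OF coef_pos[of L]] s_pos
  by (simp add: lam_def powr_powr powr_minus)

lemma E_lam: "lattice L \<Longrightarrow> E (scale_lat (lam L) L) = G (coef L) (rmin (coef L))"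
  by (simp add: E_scale lam_pos lam_powr)

lemma lam_eqI:
  assumes "lattice L" "0 < \<mu>" "\<mu> powr (- s) * zeta L s = rmin (coef L)"
  shows "\<mu> = lam L"
proof -
  have "\<mu> powr (- s) = lam L powr (- s)"
    using assms zeta_s_pos[of L] lam_powr[of L] by (metis mult_right_cancel less_irrefl)
  then have "(\<mu> powr (- s)) powr (- 1 / s) = (lam L powr (- s)) powr (- 1 / s)" by simp
  then show ?thesis using assms lam_pos[of L] s_pos by (simp add: powr_powr)
qed

lemma E_lam_less:
  assumes "lattice L" "0 < \<mu>" "\<mu> \<noteq> lam L"
  shows "E (scale_lat (lam L) L) < E (scale_lat \<mu> L)"
  using assms lam_eqI[of L \<mu>] zeta_s_pos[of L] coef_pos[of L]
  by (simp add: E_lam) (simp add: E_scale, intro G_less, auto)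

lemma E_lam_le:
  assumes "lattice L" "0 < \<mu>"
  shows "E (scale_lat (lam L) L) \<le> E (scale_lat \<mu> L)"
  using E_lam_less[OF assms] by (cases "\<mu> = lam L") auto

lemma unique_min_pos_lam: "lattice L \<Longrightarrow> unique_min_pos (\<lambda>\<mu>. E (scale_lat \<mu> L)) (lam L)"
  using E_lam_le E_lam_less lam_pos by (fastforce simp: unique_min_pos_def)

lemma E_lam_mono_iff:
  assumes "lattice L" "lattice M"
  shows "E (scale_lat (lam L) L) \<le> E (scale_lat (lam M) M) \<longleftrightarrow> estar \<alpha> s L \<le> estar \<alpha> s M"
proof -
  have "coef L \<le> coef M \<longleftrightarrow> G (coef L) (rmin (coef L)) \<le> G (coef M) (rmin (coef M))"
    using G_min_strict_mono[of "coef L" "coef M"] G_min_strict_mono[of "coef M" "coef L"]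
      coef_pos[OF assms(1)] coef_pos[OF assms(2)] by (cases "coef L" "coef M" rule: linorder_cases) auto
  with assms show ?thesis by (simp add: E_lam coef_le_iff)
qed

lemma lam_congruent:
  assumes "congruent_lat L M" shows "lam M = lam L"
  using congruent_lat_zeta[OF assms] by (simp add: lam_def coef_def estar_def)

text \<open>Every lattice is a multiple of one of covolume one, and the minimal energies of the rays
  are ordered as the values of \<open>estar\<close>. What remains is to match the two notions of
  uniqueness: from left to right the scale must be the optimal one, from right to left a congruence
  of rescaled lattices must descend to the lattices themselves.\<close>

lemma unique_min_iff:
  assumes L: "lattice1 L"
  shows "unique_min_lat lattice1 (estar \<alpha> s) L \<longleftrightarrow> unique_min_lat lattice E (scale_lat (lam L) L)"
proof
  note latt = lattice1_imp_lattice[OF L]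
  assume u: "unique_min_lat lattice1 (estar \<alpha> s) L"
  show "unique_min_lat lattice E (scale_lat (lam L) L)"
    unfolding unique_min_lat_def
  proof (intro conjI allI impI)
    show "lattice (scale_lat (lam L) L)" using latt lam_pos[OF latt] by (simp add: lattice_scale_lat)
  next
    fix M :: "(real^'n) set" assume "lattice M"
    then obtain N c where N: "lattice1 N" "0 < c" "M = scale_lat c N" by (rule lattice_eq_scale_lat_lattice1)
    note lN = lattice1_imp_lattice[OF N(1)]
    have "estar \<alpha> s L \<le> estar \<alpha> s N" using u N by (auto simp: unique_min_lat_def)
    then have "E (scale_lat (lam L) L) \<le> E (scale_lat (lam N) N)" using E_lam_mono_iff[OF latt lN] by simp
    also have "\<dots> \<le> E M" unfolding N(3) by (rule E_lam_le[OF lN N(2)])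
    finally show "E (scale_lat (lam L) L) \<le> E M" .
  next
    fix M :: "(real^'n) set" assume M: "lattice M \<and> E M \<le> E (scale_lat (lam L) L)"
    then obtain N c where N: "lattice1 N" "0 < c" "M = scale_lat c N" using lattice_eq_scale_lat_lattice1 by blast
    note lN = lattice1_imp_lattice[OF N(1)]
    have le: "E (scale_lat (lam N) N) \<le> E M" unfolding N(3) by (rule E_lam_le[OF lN N(2)])
    with M have "estar \<alpha> s N \<le> estar \<alpha> s L" using E_lam_mono_iff[OF lN latt] by simp
    with u N have cong: "congruent_lat L N" by (auto simp: unique_min_lat_def)
    have "estar \<alpha> s L \<le> estar \<alpha> s N" using u N by (auto simp: unique_min_lat_def)
    then have "E M \<le> E (scale_lat (lam N) N)" using M E_lam_mono_iff[OF latt lN] by simp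
    then have "c = lam N" unfolding N(3) using E_lam_less[OF lN N(2)] by force
    then show "congruent_lat (scale_lat (lam L) L) M"
      unfolding N(3) using congruent_lat_scale_lat[OF cong] lam_congruent[OF cong] by simp
  qed
next
  note latt = lattice1_imp_lattice[OF L]
  assume u: "unique_min_lat lattice E (scale_lat (lam L) L)"
  show "unique_min_lat lattice1 (estar \<alpha> s) L"
    unfolding unique_min_lat_def
  proof (intro conjI allI impI)
    fix M :: "(real^'n) set" assume M: "lattice1 M"
    note lM = lattice1_imp_lattice[OF M]
    have "lattice (scale_lat (lam M) M)" using lM lam_pos[OF lM] by (simp add: lattice_scale_lat)
    with u have "E (scale_lat (lam L) L) \<le> E (scale_lat (lam M) M)" by (auto simp: unique_min_lat_def)
    then show "estar \<alpha> s L \<le> estar \<alpha> s M" using E_lam_mono_iff[OF latt lM] by simp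
  next
    fix M :: "(real^'n) set" assume M: "lattice1 M \<and> estar \<alpha> s M \<le> estar \<alpha> s L"
    then have lM: "lattice M" by (simp add: lattice1_imp_lattice)
    have pos: "0 < lam L" "0 < lam M" using latt lM lam_pos by auto
    have "lattice (scale_lat (lam M) M)" using lM pos by (simp add: lattice_scale_lat)
    moreover have "E (scale_lat (lam M) M) \<le> E (scale_lat (lam L) L)" using E_lam_mono_iff[OF lM latt] M by simp
    ultimately have "congruent_lat (scale_lat (lam L) L) (scale_lat (lam M) M)"
      using u by (auto simp: unique_min_lat_def)
    \<comment> \<open>The optimal scales of \<open>L\<close> and \<open>M\<close> might differ.
      Dividing them out leaves \<open>M\<close> congruent to a multiple of \<open>L\<close>, and as
      both have covolume one the factor must be 1.\<close>
    from congruent_lat_scale_lat[OF this, of "1 / lam M"]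
    have cong: "congruent_lat (scale_lat (lam L / lam M) L) M"
      using pos unfolding scale_lat_scale_lat by (simp add: scale_lat_def)
    have c1: "lattice1 (scale_lat (lam L / lam M) L)"
      using congruent_lat_lattice1[OF congruent_lat_sym[OF cong]] M by simp
    have "1 \<le> lam L / lam M" by (rule lattice1_scale_ge_1[OF L c1]) (use pos in simp)
    moreover have "lattice1 (scale_lat (lam M / lam L) (scale_lat (lam L / lam M) L))"
      using pos L unfolding scale_lat_scale_lat by (simp add: scale_lat_def)
    then have "1 \<le> lam M / lam L" by (rule lattice1_scale_ge_1[OF c1]) (use pos in simp)
    ultimately have "lam L / lam M = 1" using pos by (simp add: field_simps)
    with cong show "congruent_lat L M" by (simp add: scale_lat_def)
  qed (rule L)
qed

text \<open>In \<open>zeta L s / rmin (coef L)\<close> the numerator is smallest at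
  \<open>L\<close>, and the denominator is largest there because \<open>rmin\<close> decreases in
  \<open>estar\<close>. If another lattice does not exceed this quotient, its numerator cannot be
  larger, and the uniqueness for \<open>zeta\<close> applies.\<close>

lemma unique_min_lam:
  assumes u: "unique_min_lat lattice1 (\<lambda>L. zeta L s) L" and m: "is_min_lat lattice1 (estar \<alpha> s) L"
  shows "unique_min_lat lattice1 lam L"
proof -
  have L: "lattice1 L" and latt: "lattice L"
    using u by (auto simp: unique_min_lat_def lattice1_imp_lattice)
  have key: "lam L \<le> lam M \<and> (lam M \<le> lam L \<longrightarrow> zeta M s \<le> zeta L s)" if M: "lattice1 M" for M
  proof -
    have lM: "lattice M" using M by (rule lattice1_imp_lattice)
    have "estar \<alpha> s L \<le> estar \<alpha> s M" using m M by (simp add: is_min_lat_def)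
    then have "coef L \<le> coef M" using coef_le_iff latt lM by simp
    then have r: "rmin (coef M) \<le> rmin (coef L)"
      using rmin_strict_antimono[OF coef_pos[OF latt], of "coef M"] by (cases "coef L = coef M") auto
    have z: "zeta L s \<le> zeta M s" using u M by (simp add: unique_min_lat_def)
    have rp: "0 < rmin (coef M)" "0 < rmin (coef L)" using rmin(1) coef_pos latt lM by auto
    have zp: "0 < zeta M s" "0 < zeta L s" using zeta_s_pos latt lM by auto
    have "zeta L s / rmin (coef L) \<le> zeta M s / rmin (coef M)"
      using r z rp zp by (intro frac_le) auto
    moreover have "zeta M s \<le> zeta L s" if "zeta M s / rmin (coef M) \<le> zeta L s / rmin (coef L)"
    proof -
      have "zeta M s / rmin (coef L) \<le> zeta M s / rmin (coef M)"
        using r rp zp by (intro frac_le) auto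
      also note that
      finally show ?thesis using rp by (simp add: divide_le_cancel)
    qed
    ultimately show ?thesis
      using rp zp s_pos by (simp add: lam_def powr_le_iff_base)
  qed
  then show ?thesis using u L unfolding unique_min_lat_def by blast
qed

end

section \<open>The first shell of a planar lattice\<close>

text \<open>The Lagrange remainder of even order 6 is nonnegative whatever the sign of the
  argument.\<close>

lemma exp_taylor_ge:
  fixes v :: real
  assumes "0 \<le> v"
  shows "1 - v + v^2 / 2 - v^3 / 6 + v^4 / 24 - v^5 / 120 \<le> exp (- v)"
proof -
  obtain t where "exp (- v) = (\<Sum>m<6. (- v) ^ m / fact m) + exp t / fact 6 * (- v) ^ 6"
    using Maclaurin_exp_le[of "- v" 6] by auto
  moreover have "0 \<le> exp t / fact 6 * (- v) ^ 6" by simp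
  ultimately show ?thesis by (simp add: eval_nat_numeral fact_numeral)
qed

lemma exp_taylor_ge_nonneg:
  fixes v :: real
  assumes "0 \<le> v"
  shows "1 + v + v^2 / 2 + v^3 / 6 + v^4 / 24 \<le> exp v"
proof -
  obtain t where "exp v = (\<Sum>m<6. v ^ m / fact m) + exp t / fact 6 * v ^ 6"
    using Maclaurin_exp_le[of "v" 6] by auto
  moreover have "0 \<le> exp t / fact 6 * v ^ 6" by simp
  moreover have "0 \<le> v ^ 5" using assms by simp
  ultimately show ?thesis by (simp add: eval_nat_numeral fact_numeral)
qed

text \<open>The excesses \<open>x\<close> of the first shell of a form below add up to \<open>tau\<close> and their squares to
  \<open>tau + tau\<^sup>2 / 2\<close>, so a quadratic coefficient exceeding the linear one by 11/100 leaves
  the gain \<open>11/100 tau\<close>.\<close>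

lemma exp_ge_quadratic:
  fixes x :: real
  assumes "x \<le> 1/2"
  shows "1 - 18/5 * x + 371/100 * x^2 \<le> exp (- (18/5 * x))"
proof (cases "0 \<le> x")
  case True
  define v where "v = 18/5 * x"
  have v: "0 \<le> v" "v \<le> 9/5" using True assms by (simp_all add: v_def)
  \<comment> \<open>\<open>v^2 * q v\<close> is the Taylor bound minus the quadratic,
    \<open>25/324\<close> being the inverse square of 18/5. The worst point is
    \<open>v = 9/5\<close>, that is \<open>x = 1/2\<close>, where \<open>q\<close> is only about
    0.0001: 371/100 is nearly the largest coefficient that this Taylor bound allows.\<close>
  define q where "q u = 1/2 - 371/100 * (25/324) - u / 6 + u^2 / 24 - u^3 / 120" for u :: real
  have "q (9/5) \<le> q v"
  proof -
    have "q v - q (9/5) = (9/5 - v) * (1/6 - (9/5 + v) / 24 + ((9/5)^2 + 9/5 * v + v^2) / 120)"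
      by (simp add: q_def field_simps power2_eq_square power3_eq_cube)
    moreover have "0 \<le> (9/5 - v) * (1/6 - (9/5 + v) / 24 + ((9/5)^2 + 9/5 * v + v^2) / 120)"
      using v by (intro mult_nonneg_nonneg) (auto simp: power2_eq_square intro: add_nonneg_nonneg)
    ultimately show ?thesis by simp
  qed
  moreover have "0 \<le> q (9/5)" by (simp add: q_def power2_eq_square power3_eq_cube)
  ultimately have "0 \<le> v^2 * q v" by simp
  moreover have "v^2 * q v = (1 - v + v^2 / 2 - v^3 / 6 + v^4 / 24 - v^5 / 120) - (1 - 18/5 * x + 371/100 * x^2)"
    by (simp add: q_def v_def algebra_simps eval_nat_numeral)
  ultimately show ?thesis using exp_taylor_ge[OF v(1)] by (simp add: v_def)
next
  case False
  define v where "v = - (18/5 * x)"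
  have v: "0 \<le> v" using False by (simp add: v_def)
  \<comment> \<open>For negative \<open>x\<close> the exponential has the quadratic coefficient
    \<open>(18/5)^2 / 2 = 6.48\<close>, well above 371/100.\<close>
  have "371/100 * x^2 \<le> v^2 / 2" by (simp add: v_def power2_eq_square algebra_simps)
  moreover have "0 \<le> v^3" "0 \<le> v^4" using v by simp_all
  ultimately have "1 - 18/5 * x + 371/100 * x^2 \<le> 1 + v + v^2 / 2 + v^3 / 6 + v^4 / 24"
    unfolding v_def by linarith
  with exp_taylor_ge_nonneg[OF v] show ?thesis by (simp add: v_def)
qed

text \<open>The form \<open>P m\<^sup>2 + 2 C m n + Q n\<^sup>2\<close>, scaled so that the hexagonal one is
  \<open>P = Q = 1\<close>, \<open>C = 1/2\<close>; its value at \<open>(1, -1)\<close> is \<open>R\<close>.\<close>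

locale reduced_form =
  fixes P Q C :: real
  assumes C_nonneg: "0 \<le> C" and C_le: "2 * C \<le> P" and P_le: "P \<le> Q"
    and disc: "P * Q - C^2 = 3/4"
begin

definition R :: real where "R = P + Q - 2 * C"

text \<open>Measures the distance from the hexagonal form: it is nonnegative, and zero only there.
  It governs both sides of the theta comparison, because the average of the form over the rotation
  of order three is \<open>1 + tau / 3\<close> times \<open>hexnorm\<close>.\<close>

definition tau :: real where "tau = P + Q + R - 3"

definition S :: "real \<Rightarrow> real" where
  "S t = exp (- t * (P - 1)) + exp (- t * (Q - 1)) + exp (- t * (R - 1))"

lemma P_pos: "0 < P"
proof (rule ccontr)
  assume "\<not> 0 < P"
  then have "P = 0" "C = 0" using C_nonneg C_le by auto
  with disc show False by simp
qed

lemma Q_le_R: "Q \<le> R" using C_le by (simp add: R_def)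

text \<open>Hermite's bound in this normalization: a reduced form has discriminant at least
  \<open>3/4 * P^2\<close>.\<close>

lemma P_le_1: "P \<le> 1"
proof (rule ccontr)
  assume "\<not> P \<le> 1"
  then have "P * P \<le> P * Q" "1 < P * P" using P_le by (auto intro!: mult_left_mono simp: less_1_mult)
  moreover have "C * C \<le> (P / 2) * (P / 2)" using C_nonneg C_le by (intro mult_mono) auto
  ultimately have "3/4 * 1 < P * Q - C * C" by (simp add: field_simps)
  with disc show False by (simp add: power2_eq_square)
qed

lemma PQ_eq: "P * Q = 3/4 + C^2" using disc by simp

lemma C_sq_le: "C^2 \<le> P^2 / 4"
proof -
  have "C^2 \<le> (P / 2)^2" using C_nonneg C_le by (intro power_mono) auto
  then show ?thesis by (simp add: power_divide)
qed

lemma Q_le: "P * Q \<le> 3/4 + P^2 / 4"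
  using PQ_eq C_sq_le by simp

lemma R_le: "P * R \<le> 3/4 + P^2"
proof -
  have "P * R = P^2 + (3/4 + C^2) - 2 * C * P"
    using PQ_eq by (simp add: R_def algebra_simps power2_eq_square)
  moreover have "C * C \<le> C * (2 * P)" using C_nonneg C_le by (intro mult_left_mono) auto
  ultimately show ?thesis by (simp add: power2_eq_square)
qed

text \<open>The discriminant condition in symmetric guise: with \<open>C = (P + Q - R) / 2\<close>
  it becomes a quadratic relation between the three excesses.\<close>

lemma sum_sq: "(P - 1)^2 + (Q - 1)^2 + (R - 1)^2 = tau + tau^2 / 2"
proof -
  have "(P - 1)^2 + (Q - 1)^2 + (R - 1)^2 - tau - tau^2 / 2 = 3/2 - 2 * (P * Q - C^2)"
    by (simp add: tau_def R_def power2_eq_square field_simps)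
  then show ?thesis using disc by simp
qed

text \<open>\<open>sum_sq\<close> leaves only \<open>tau\<close> nonnegative or \<open>tau\<close>
  at most -2. In the second case \<open>P + Q + R\<close> is at most 1, so \<open>P\<close> is at
  most 1/3, while \<open>P * (P + Q + R)\<close> is at least \<open>2 * P * Q\<close> and hence at
  least 3/2.\<close>

lemma tau_nonneg: "0 \<le> tau"
proof (rule ccontr)
  assume "\<not> 0 \<le> tau"
  moreover have "0 \<le> tau + tau^2 / 2" using sum_sq by (metis add_nonneg_nonneg zero_le_power2)
  then have "0 \<le> tau * (1 + tau / 2)" by (simp add: power2_eq_square algebra_simps)
  ultimately have "tau \<le> - 2" by (simp add: zero_le_mult_iff)
  then have "P + Q + R \<le> 1" by (simp add: tau_def)
  then have "3 * P \<le> 1" "P * (P + Q + R) \<le> P * 1" using P_le Q_le_R P_pos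
    by (auto intro!: mult_left_mono)
  moreover have "P * Q \<le> P * R" using Q_le_R P_pos by simp
  moreover have "3/4 \<le> P * Q" using PQ_eq by simp
  moreover have "0 \<le> P * P" using P_pos by simp
  ultimately show False by (simp add: algebra_simps)
qed

text \<open>By \<open>sum_sq\<close> the difference of the two sides is \<open>(P - Q)^2\<close>.
  The inequality forces \<open>tau\<close> to be large once \<open>R\<close> is far from 1.\<close>

lemma tau_ge: "3 * (R - 1)^2 \<le> 2 * R * tau"
proof -
  have "(P - 1 - (Q - 1))^2 = 2 * R * tau - 3 * (R - 1)^2"
    using sum_sq by (simp add: tau_def power2_eq_square field_simps)
  then show ?thesis using zero_le_power2[of "P - 1 - (Q - 1)"] by linarith
qed

text \<open>One very short vector nearly outweighs three. For \<open>P\<close> at most 3/5 it alone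
  contributes \<open>exp (36/25)\<close>, more than 31/10; between 3/5 and 7/10 it contributes at
  least 29/10 and the second vector, with \<open>Q\<close> at most 7/5, adds 1/5.\<close>

lemma S_small_P: "31/10 \<le> S (18/5)" if "P < 7/10"
proof (cases "P \<le> 3/5")
  case True
  have "1 + 36/25 + (36/25)^2 / 2 \<le> exp (36/25 :: real)"
    using exp_taylor_ge_nonneg[of "36/25"] by (simp add: eval_nat_numeral)
  also have "\<dots> \<le> exp (- (18/5) * (P - 1))" using True by (simp add: field_simps)
  finally have "31/10 \<le> exp (- (18/5) * (P - 1))" by (simp add: power2_eq_square)
  then show ?thesis using exp_ge_zero[of "- (18/5) * (Q - 1)"] exp_ge_zero[of "- (18/5) * (R - 1)"]
    unfolding S_def by linarith
next
  case False
  have "1 + 27/25 + (27/25)^2 / 2 + (27/25)^3 / 6 + (27/25)^4/24 \<le> exp (27/25 :: real)"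
    by (rule exp_taylor_ge_nonneg) simp
  also have "\<dots> \<le> exp (- (18/5) * (P - 1))" using that by (simp add: field_simps)
  finally have 1: "29/10 \<le> exp (- (18/5) * (P - 1))" by (simp add: eval_nat_numeral)
  have "P * Q \<le> P * (7/5)"
  proof -
    \<comment> \<open>The roots are those of \<open>3/4 + P^2 / 4 = 7/5 * P\<close>, so 7/5 is
      exactly what \<open>Q_le\<close> gives at \<open>P = 3/5\<close>.\<close>
    have "(P - 3/5) * (P - 5) \<le> 0" using False that by (intro mult_nonneg_nonpos) auto
    then have "P^2 \<le> 28/5 * P - 3" by (simp add: power2_eq_square field_simps)
    then have "3/4 + P^2 / 4 \<le> P * (7/5)" by simp
    with Q_le show ?thesis by linarith
  qed
  then have "Q \<le> 7/5" using P_pos by simp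
  then have "exp (- (36/25)) \<le> exp (- (18/5) * (Q - 1))" by (intro exp_mono) simp
  moreover have "1/5 \<le> exp (- (36/25 :: real))"
    using exp_taylor_ge[of "36/25"] by (simp add: eval_nat_numeral)
  ultimately show ?thesis using 1 exp_ge_zero[of "- (18/5) * (R - 1)"] unfolding S_def by linarith
qed

text \<open>Adding the three quadratic bounds and inserting \<open>sum_sq\<close> gives
  \<open>3 + 11/100 * tau + 371/200 * tau^2\<close>. If \<open>R\<close> exceeds 3/2 the quadratic
  bound is out of range for the third term; that term is then estimated by the constant 1/21, and
  the square of \<open>tau\<close>, large by \<open>tau_ge\<close>, pays for the difference.\<close>

lemma S_large_P: "3 + 11/100 * tau \<le> S (18/5)" if "7/10 \<le> P"
proof -
  let ?q = "\<lambda>x::real. 1 - 18/5 * x + 371/100 * x^2"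
  have x: "?q (P - 1) \<le> exp (- (18/5) * (P - 1))"
    using exp_ge_quadratic[of "P - 1"] P_le_1 by simp
  have "P * Q \<le> P * (3/2)"
  proof -
    have "(P - 7/10) * (P - 5) \<le> 0" using P_le_1 that by (intro mult_nonneg_nonpos) auto
    then have "P^2 \<le> 57/10 * P - 7/2" by (simp add: power2_eq_square field_simps)
    then have "3/4 + P^2 / 4 \<le> P * (3/2)" using that by simp
    with Q_le show ?thesis by linarith
  qed
  then have "Q \<le> 3/2" using P_pos by simp
  then have y: "?q (Q - 1) \<le> exp (- (18/5) * (Q - 1))"
    using exp_ge_quadratic[of "Q - 1"] by simp
  have sum: "?q (P - 1) + ?q (Q - 1) + ?q (R - 1) = 3 + 11/100 * tau + 371/200 * tau^2"
  proof -
    have "(1 - 18/5 * x + 371/100 * A) + (1 - 18/5 * y + 371/100 * B) + (1 - 18/5 * z + 371/100 * D)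
        = 3 + 11/100 * t + 371/200 * T" if "A + B + D = t + T / 2" "x + y + z = t"
      for x y z A B D t T :: real
      using that by linarith
    from this[OF sum_sq, of "P - 1" "Q - 1" "R - 1"] show ?thesis by (simp add: tau_def)
  qed
  show ?thesis
  proof (cases "R - 1 \<le> 1/2")
    case True
    have "?q (R - 1) \<le> exp (- (18/5) * (R - 1))"
      using exp_ge_quadratic[of "R - 1"] True by simp
    moreover have "a + b + c \<ge> 3 + 11/100 * tau"
      if "A \<le> a" "B \<le> b" "D \<le> c" "A + B + D = 3 + 11/100 * tau + 371/200 * tau^2" for A B D a b c
      using that zero_le_power2[of tau] by linarith
    ultimately show ?thesis using x y sum unfolding S_def by blast
  next
    case False
    define z where "z = R - 1"
    have "P * R \<le> P * (9/5)"
    proof -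
      have "(P - 7/10) * (P - 11/10) \<le> 0" using P_le_1 that by (intro mult_nonneg_nonpos) auto
      then have "P^2 \<le> 9/5 * P - 77/100" by (simp add: power2_eq_square field_simps)
      then have "3/4 + P^2 \<le> P * (9/5)" by simp
      with R_le show ?thesis by linarith
    qed
    then have z: "1/2 < z" "z \<le> 4/5" using False P_pos by (auto simp: z_def)
    \<comment> \<open>The exponent is \<open>18/5\<close> times the largest possible
      \<open>z\<close>, which is 4/5.\<close>
    have "1/21 \<le> exp (- (72/25) :: real)"
    proof -
      have "exp (72/25 :: real) \<le> exp 3" by simp
      also have "\<dots> = exp 1 ^ 3" by (simp add: exp_of_nat_mult[symmetric])
      also have "\<dots> \<le> (272/100 :: real)^3" 
        using e_less_272 by (intro power_mono) auto
      also have "\<dots> \<le> 21" by (simp add: eval_nat_numeral)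
      finally show ?thesis by (simp add: exp_minus field_simps)
    qed
    also have "\<dots> \<le> exp (- (18/5) * z)" using z by (intro exp_mono) simp
    finally have ez: "1/21 \<le> exp (- (18/5) * z)" .
    have "3 * z^2 \<le> 2 * (1 + z) * tau" using tau_ge by (simp add: z_def)
    then have "3 * z^2 / (2 * (1 + z)) \<le> tau" using z by (simp add: field_simps)
    then have "(3 * z^2 / (2 * (1 + z)))^2 \<le> tau^2" using z by (intro power_mono) auto
    moreover have "?q z - 1/21 \<le> 371/200 * (3 * z^2 / (2 * (1 + z)))^2"
    proof -
      have "(?q z - 1/21) * (4 * (1 + z)^2) \<le> 371/200 * (9 * z^4)"
      proof -
        \<comment> \<open>A certificate on the interval from 1/2 to 4/5. The factor 382/25 is the
          cubic coefficient in \<open>e\<close> below, so the product replaces the cubic term by a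
          quadratic that nearly cancels the quadratic term of \<open>e\<close>; the rest is linear
          in \<open>z\<close>, \<open>z^2\<close> and \<open>z^4\<close>.\<close>
        have "(z - 1/2) * (z - 4/5) * (382/25 * z + 9704/1000) \<le> 0"
          using z by (intro mult_nonpos_nonneg mult_nonneg_nonpos) auto
        then have "19100 * z^3 \<le> 12700 * z^2 + 8129 * z - 4852" by (simp add: eval_nat_numeral field_simps)
        moreover have "z * z \<le> 1 * z" using z by (intro mult_right_mono) auto
        then have "z^2 \<le> z" by (simp only: power2_eq_square mult_1_left)
        moreover have "(1/2)^4 \<le> z^4" using z by (intro power_mono) auto
        moreover have "(1/2)^4 = (1/16 :: real)" by (simp add: eval_nat_numeral)
        moreover have e: "(?q z - 1/21) * (4 * (1 + z)^2) = 80/21 + (160/21 - 72/5) * z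
            + (80/21 - 144/5 + 371/25) * z^2 + (742/25 - 72/5) * z^3 + 371/25 * z^4"
          by (simp add: eval_nat_numeral field_simps)
        ultimately show ?thesis using z unfolding e by simp
      qed
      then have "?q z - 1/21 \<le> 371/200 * (9 * z^4) / (4 * (1 + z)^2)"
        using z by (subst pos_le_divide_eq) auto
      also have "\<dots> = 371/200 * (3 * z^2 / (2 * (1 + z)))^2"
        by (simp only: power_divide power_mult_distrib power_mult[symmetric]) simp
      finally show ?thesis .
    qed
    ultimately have "?q z - 1/21 \<le> 371/200 * tau^2" by simp
    moreover have "a + b + c \<ge> 3 + 11/100 * tau"
      if "A \<le> a" "B \<le> b" "1/21 \<le> c" "A + B + D = 3 + 11/100 * tau + 371/200 * tau^2"
        "D - 1/21 \<le> 371/200 * tau^2" for A B D a b c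
      using that by linarith
    ultimately show ?thesis using x y sum ez unfolding S_def z_def by blast
  qed
qed

text \<open>Bernoulli's inequality reduces all \<open>t\<close> that occur to \<open>18/5\<close>, a lower bound of \<open>pi * hex\<close>.\<close>

lemma S_bernoulli:
  assumes "18/5 \<le> t"
  shows "t / (18/5) * (S (18/5) - 3) \<le> S t - 3"
proof -
  have 1: "t / (18/5) * (exp (- (18/5) * x) - 1) \<le> exp (- t * x) - 1" for x :: real
  proof -
    define c where "c = t / (18/5)"
    have c: "1 \<le> c" using assms by (simp add: c_def)
    define w where "w = - (18/5) * x"
    have "exp ((1 - 1 / c) *\<^sub>R 0 + (1 / c) *\<^sub>R (c * w)) \<le> (1 - 1 / c) * exp 0 + 1 / c * exp (c * w)"
      using c by (intro convex_onD[OF exp_convex]) auto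
    then have "c * exp w \<le> c * ((1 - 1 / c) + 1 / c * exp (c * w))" using c by simp
    also have "\<dots> = c - 1 + exp (c * w)" using c by (simp add: algebra_simps)
    finally have "1 + c * (exp w - 1) \<le> exp (c * w)" by (simp add: algebra_simps)
    also have "c * w = - t * x" by (simp add: c_def w_def)
    finally show ?thesis by (simp add: c_def w_def)
  qed
  from 1[of "P - 1"] 1[of "Q - 1"] 1[of "R - 1"] show ?thesis
    by (simp add: S_def algebra_simps)
qed

end

section \<open>Poisson summation for Gaussians\<close>

lemma M_test_sum_integral:
  fixes h :: "'i \<Rightarrow> real \<Rightarrow> real"
  assumes cont: "\<And>n. continuous_on {a..b} (h n)"
    and bound: "\<And>n x. x \<in> {a..b} \<Longrightarrow> \<bar>h n x\<bar> \<le> M n" and M: "M summable_on UNIV"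
  shows "continuous_on {a..b} (\<lambda>x. \<Sum>\<^sub>\<infinity>n. h n x)"
    and "((\<lambda>n. integral {a..b} (h n)) has_sum integral {a..b} (\<lambda>x. \<Sum>\<^sub>\<infinity>n. h n x)) UNIV"
proof -
  have u: "uniform_limit {a..b} (\<lambda>X x. \<Sum>n\<in>X. h n x) (\<lambda>x. \<Sum>\<^sub>\<infinity>n. h n x) (finite_subsets_at_top UNIV)"
    by (rule Weierstrass_m_test_general[OF _ M]) (use bound in auto)
  have c: "continuous_on {a..b} (\<lambda>x. \<Sum>n\<in>X. h n x)" for X
    by (intro continuous_on_sum cont)
  show "continuous_on {a..b} (\<lambda>x. \<Sum>\<^sub>\<infinity>n. h n x)"
    by (rule uniform_limit_theorem[OF _ u]) (use c in auto)
  obtain I J where I: "\<And>X. ((\<lambda>x. \<Sum>n\<in>X. h n x) has_integral I X) {a..b}"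
    and J: "((\<lambda>x. \<Sum>\<^sub>\<infinity>n. h n x) has_integral J) {a..b}"
    and lim: "(I \<longlongrightarrow> J) (finite_subsets_at_top UNIV)"
    by (rule uniform_limit_integral[OF u c]) auto
  have "\<forall>\<^sub>F X in finite_subsets_at_top UNIV. I X = (\<Sum>n\<in>X. integral {a..b} (h n))"
  proof (rule eventually_finite_subsets_at_top_weakI)
    fix X :: "'i set" assume "finite X"
    then have "((\<lambda>x. \<Sum>n\<in>X. h n x) has_integral (\<Sum>n\<in>X. integral {a..b} (h n))) {a..b}"
      by (intro has_integral_sum) (auto intro!: integrable_integral integrable_continuous_interval cont)
    with I show "I X = (\<Sum>n\<in>X. integral {a..b} (h n))" by (rule has_integral_unique)
  qed
  from Lim_transform_eventually[OF lim this] J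
  show "((\<lambda>n. integral {a..b} (h n)) has_sum integral {a..b} (\<lambda>x. \<Sum>\<^sub>\<infinity>n. h n x)) UNIV"
    by (simp add: has_sum_def integral_unique)
qed

lemma summable_on_exp_abs_int:
  fixes c :: real
  assumes "0 < c"
  shows "(\<lambda>n::int. exp (- c * \<bar>real_of_int n\<bar>)) summable_on UNIV"
proof (rule summable_on_int_even)
  have "summable (\<lambda>n. exp (- c) ^ n)" using assms by (intro summable_geometric) auto
  then show "summable (\<lambda>n. exp (- c * \<bar>real_of_int (int n)\<bar>))"
    by (simp add: exp_of_nat_mult[symmetric] mult.commute)
qed auto

lemma abs_le_square_int: "\<bar>real_of_int n\<bar> \<le> (real_of_int n)^2"
proof -
  have "\<bar>n\<bar> * 1 \<le> \<bar>n\<bar> * \<bar>n\<bar>"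
  proof (cases "n = 0")
    case False
    then have "1 \<le> \<bar>n\<bar>" by simp
    then show ?thesis by (rule mult_left_mono) simp
  qed simp
  then have "\<bar>n\<bar> \<le> n^2" by (simp add: power2_eq_square)
  then have "real_of_int \<bar>n\<bar> \<le> real_of_int (n^2)" by (simp only: of_int_le_iff)
  then show ?thesis by simp
qed

text \<open>The square of \<open>n / 2 + x\<close> gives
  \<open>n^2 / 2 - x^2 \<le> (n + x)^2\<close>, and \<open>\<bar>n\<bar> \<le> n^2\<close> for
  integers. The result is a geometric majorant, uniform for bounded \<open>x\<close>.\<close>

lemma gauss_int_bound:
  fixes c x :: real
  assumes c: "0 < c"
  shows "exp (- c * (real_of_int n + x)^2) \<le> exp (c * x^2) * exp (- (c / 2) * \<bar>real_of_int n\<bar>)"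
proof -
  have "0 \<le> (real_of_int n / 2 + x)^2 * 2" by simp
  then have "(real_of_int n)^2 / 2 - x^2 \<le> (real_of_int n + x)^2"
    by (simp add: power2_eq_square field_simps)
  with abs_le_square_int[of n] have "\<bar>real_of_int n\<bar> / 2 - x^2 \<le> (real_of_int n + x)^2" by linarith
  then have "c * (\<bar>real_of_int n\<bar> / 2 - x^2) \<le> c * (real_of_int n + x)^2"
    using c by (intro mult_left_mono) auto
  then have "- c * (real_of_int n + x)^2 \<le> c * x^2 + - (c / 2) * \<bar>real_of_int n\<bar>"
    by (simp add: algebra_simps)
  then show ?thesis unfolding exp_add[symmetric] by simp
qed

lemma summable_on_gauss_int:
  fixes c x :: real
  assumes "0 < c"
  shows "(\<lambda>n::int. exp (- c * (real_of_int n + x)^2)) summable_on UNIV"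
proof (rule summable_on_comparison_test)
  show "(\<lambda>n::int. exp (c * x^2) * exp (- (c / 2) * \<bar>real_of_int n\<bar>)) summable_on UNIV"
    using assms by (intro summable_on_cmult_right summable_on_exp_abs_int) auto
qed (use gauss_int_bound[OF assms] in auto)

lemma integral_cos_int:
  "integral {0..1} (\<lambda>x. cos (2 * pi * real_of_int j * x)) = (if j = 0 then 1 else 0)"
proof (cases "j = 0")
  case False
  let ?F = "\<lambda>x. sin (2 * pi * real_of_int j * x) / (2 * pi * real_of_int j)"
  have "((\<lambda>x. cos (2 * pi * real_of_int j * x)) has_integral ?F 1 - ?F 0) {0..1}"
    using False by (intro fundamental_theorem_of_calculus)
      (auto intro!: derivative_eq_intros simp: has_real_derivative_iff_has_vector_derivative[symmetric])
  moreover have "sin (2 * pi * real_of_int j) = 0"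
    using sin_zero_iff_int2[of "2 * pi * real_of_int j"] by (metis mult.commute mult.left_commute of_int_mult of_int_numeral)
  ultimately show ?thesis using False by (simp add: integral_unique)
qed auto

text \<open>Products of a cosine with powers of \<open>cos (2 \<pi> x)\<close> are again combinations of cosines, so
  vanishing cosine coefficients make \<open>u\<close> orthogonal to every polynomial in \<open>cos (2 \<pi> x)\<close>.\<close>

lemma even_periodic_zero_if_cos_coeffs_zero:
  fixes u :: "real \<Rightarrow> real"
  assumes cont: "continuous_on {0..1} u"
    and sym: "\<And>x. u (1 - x) = u x"
    and coeff: "\<And>k::int. integral {0..1} (\<lambda>x. u x * cos (2 * pi * real_of_int k * x)) = 0"
    and x: "x \<in> {0..1}"
  shows "u x = 0"
proof -
  have pow: "integral {0..1} (\<lambda>x. u x * (cos (2 * pi * x) ^ m * cos (2 * pi * real_of_int k * x))) = 0" for m k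
  proof (induction m arbitrary: k)
    case 0 then show ?case using coeff by simp
  next
    case (Suc m)
    have int: "(\<lambda>x. u x * (cos (2 * pi * x) ^ m * cos (2 * pi * real_of_int k * x))) integrable_on {0..1}" for k
      by (intro integrable_continuous_interval continuous_intros cont)
    have "u x * (cos (2 * pi * x) ^ Suc m * cos (2 * pi * real_of_int k * x)) =
        1/2 * (u x * (cos (2 * pi * x) ^ m * cos (2 * pi * real_of_int (k + 1) * x)))
        + 1/2 * (u x * (cos (2 * pi * x) ^ m * cos (2 * pi * real_of_int (k - 1) * x)))" for x
    proof -
      have "cos (2 * pi * x) * cos (2 * pi * real_of_int k * x) =
          1/2 * cos (2 * pi * real_of_int (k + 1) * x) + 1/2 * cos (2 * pi * real_of_int (k - 1) * x)"
      proof -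
        have "2 * pi * real_of_int (k + 1) * x = 2 * pi * real_of_int k * x + 2 * pi * x"
          "2 * pi * real_of_int (k - 1) * x = 2 * pi * real_of_int k * x - 2 * pi * x"
          by (simp_all add: algebra_simps)
        then show ?thesis by (simp only: cos_add cos_diff) (simp add: field_simps)
      qed
      then have "u x * cos (2 * pi * x) ^ m * (cos (2 * pi * x) * cos (2 * pi * real_of_int k * x)) =
        u x * cos (2 * pi * x) ^ m * (1/2 * cos (2 * pi * real_of_int (k + 1) * x) + 1/2 * cos (2 * pi * real_of_int (k - 1) * x))"
        by (rule arg_cong)
      then show ?thesis by (simp only: power_Suc) (simp only: distrib_left mult_ac)
    qed
    then have "integral {0..1} (\<lambda>x. u x * (cos (2 * pi * x) ^ Suc m * cos (2 * pi * real_of_int k * x))) =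
        integral {0..1} (\<lambda>x. 1/2 * (u x * (cos (2 * pi * x) ^ m * cos (2 * pi * real_of_int (k + 1) * x)))
        + 1/2 * (u x * (cos (2 * pi * x) ^ m * cos (2 * pi * real_of_int (k - 1) * x))))" by presburger
    also have "\<dots> = integral {0..1} (\<lambda>x. 1/2 * (u x * (cos (2 * pi * x) ^ m * cos (2 * pi * real_of_int (k + 1) * x))))
        + integral {0..1} (\<lambda>x. 1/2 * (u x * (cos (2 * pi * x) ^ m * cos (2 * pi * real_of_int (k - 1) * x))))"
      by (intro integral_add integrable_continuous_interval continuous_intros cont)
    also have "\<dots> = 0" by (simp only: integral_mult_right Suc.IH)
    finally show ?case .
  qed
  have poly: "integral {0..1} (\<lambda>x. u x * g (cos (2 * pi * x))) = 0" if g: "real_polynomial_function g" for g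
  proof -
    obtain a n where "g = (\<lambda>x. \<Sum>i\<le>n. a i * x ^ i)"
      using g unfolding real_polynomial_function_iff_sum by blast
    then have "(\<lambda>x. u x * g (cos (2 * pi * x))) = (\<lambda>x. \<Sum>i\<le>n. a i * (u x * cos (2 * pi * x) ^ i))"
      by (simp add: sum_distrib_left mult_ac)
    moreover have "integral {0..1} (\<lambda>x. u x * cos (2 * pi * x) ^ i) = 0" for i
      using pow[of i 0] by simp
    moreover have "(\<lambda>x. a i * (u x * cos (2 * pi * x) ^ i)) integrable_on {0..1}" for i
      by (intro integrable_continuous_interval continuous_intros cont)
    ultimately show ?thesis by (simp add: integral_sum)
  qed
  \<comment> \<open>The symmetry under \<open>x \<mapsto> 1 - x\<close> makes \<open>u\<close> a
    function of \<open>cos (2 * pi * x)\<close> on the whole interval, although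
    \<open>arccos\<close> only recovers the first half.\<close>
  define v where "v c = u (arccos c / (2 * pi))" for c
  have v_cont: "continuous_on {-1..1} v"
  proof -
    have "arccos y \<le> 2 * pi" if "- 1 \<le> y" "y \<le> 1" for y
      using arccos_ubound[of y] that pi_ge_zero by linarith
    then show ?thesis unfolding v_def
      by (intro continuous_on_compose2[OF cont])
        (auto intro!: continuous_intros simp: arccos_lbound divide_simps)
  qed
  have uv: "u x = v (cos (2 * pi * x))" if "x \<in> {0..1}" for x
  proof (cases "x \<le> 1/2")
    case True
    then have "arccos (cos (2 * pi * x)) = 2 * pi * x" using that by (intro arccos_cos) auto
    then show ?thesis by (simp add: v_def)
  next
    case False
    have "cos (2 * pi * x) = cos (2 * pi * (1 - x))"
      by (simp add: right_diff_distrib cos_diff)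
    moreover have "arccos (cos (2 * pi * (1 - x))) = 2 * pi * (1 - x)"
      using that False by (intro arccos_cos) (auto simp: algebra_simps)
    ultimately show ?thesis using sym[of x] by (simp add: v_def)
  qed
  obtain B where B: "\<And>x. x \<in> {0..1} \<Longrightarrow> \<bar>u x\<bar> \<le> B"
  proof -
    have "bounded (u ` {0..1})" by (intro compact_imp_bounded compact_continuous_image cont) simp
    then show ?thesis using that by (force simp: bounded_iff)
  qed
  have B0: "0 \<le> B" using B[of 0] by simp
  have sq_int: "(\<lambda>x. u x * u x) integrable_on {0..1}"
    by (intro integrable_continuous_interval continuous_intros cont)
  have small: "integral {0..1} (\<lambda>x. u x * u x) \<le> e * B" if e: "0 < e" for e
  proof -
    obtain g where g: "real_polynomial_function g" "\<And>c. c \<in> {-1..1} \<Longrightarrow> \<bar>v c - g c\<bar> < e"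
      using Stone_Weierstrass_real_polynomial_function[OF _ v_cont e] by auto
    have gc: "continuous_on S g" for S
      using g(1) continuous_on_polymonial_function real_polynomial_function_eq by blast
    have gi: "(\<lambda>x. u x * g (cos (2 * pi * x))) integrable_on {0..1}"
      by (intro integrable_continuous_interval continuous_intros cont continuous_on_compose2[OF gc[of UNIV]]) auto
    \<comment> \<open>\<open>u\<close> is orthogonal to the approximating polynomial, so subtracting
      it under the integral is free.\<close>
    have "integral {0..1} (\<lambda>x. u x * u x) = integral {0..1} (\<lambda>x. u x * u x - u x * g (cos (2 * pi * x)))"
      using poly[OF g(1)] by (simp add: integral_diff[OF sq_int gi])
    also have "\<dots> \<le> integral {0..1} (\<lambda>_::real. e * B)"
    proof (rule integral_le)
      fix x :: real assume x: "x \<in> {0..1}"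
      have "\<bar>u x - g (cos (2 * pi * x))\<bar> \<le> e"
        using g(2)[of "cos (2 * pi * x)"] uv[OF x] by simp
      then have "\<bar>u x\<bar> * \<bar>u x - g (cos (2 * pi * x))\<bar> \<le> B * e"
        using B[OF x] B0 by (intro mult_mono) auto
      moreover have "u x * u x - u x * g (cos (2 * pi * x)) \<le> \<bar>u x * (u x - g (cos (2 * pi * x)))\<bar>"
        by (simp add: right_diff_distrib)
      ultimately show "u x * u x - u x * g (cos (2 * pi * x)) \<le> e * B" by (simp add: abs_mult mult.commute)
    qed (use integrable_diff[OF sq_int gi] in auto)
    finally show ?thesis by simp
  qed
  have "integral {0..1} (\<lambda>x. u x * u x) \<le> 0 + d" if "0 < d" for d
  proof -
    have "integral {0..1} (\<lambda>x. u x * u x) \<le> d / (B + 1) * B"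
      using that B0 by (intro small) simp
    also have "\<dots> \<le> d" using that B0 by (simp add: field_simps)
    finally show ?thesis by simp
  qed
  then have "integral {0..1} (\<lambda>x. u x * u x) \<le> 0" by (rule field_le_epsilon)
  moreover have "0 \<le> integral {0..1} (\<lambda>x. u x * u x)" by (intro integral_nonneg sq_int) auto
  ultimately have "integral {0..1} (\<lambda>x. u x * u x) = 0" by simp
  then have "\<forall>x\<in>{0..1}. u x * u x = 0"
    by (subst (asm) integral_eq_0_iff) (auto intro!: continuous_intros cont)
  with x show ?thesis by simp
qed

section \<open>Gaussian integrals and the Poisson formula\<close>

lemma integrable_gauss: assumes "0 < t" shows "integrable lborel (\<lambda>x. exp (- (pi * t) * x^2))"
proof -
  define \<sigma> where "\<sigma> = sqrt (1 / (2 * pi * t))"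
  have \<sigma>: "0 < \<sigma>" "\<sigma>^2 = 1 / (2 * pi * t)" using assms by (simp_all add: \<sigma>_def)
  have "integrable lborel (\<lambda>x. (1 / sqrt t) * normal_density 0 \<sigma> x)"
    using \<sigma> by (intro integrable_mult_right integrable_normal_density)
  moreover have "(1 / sqrt t) * normal_density 0 \<sigma> x = exp (- (pi * t) * x^2)" for x
    using assms by (simp add: normal_density_def \<sigma>(2) real_sqrt_divide field_simps)
  ultimately show ?thesis by simp
qed

text \<open>This is the real part of the characteristic function of the standard normal
  distribution, after the substitution by \<open>c = sqrt (2 * pi * t)\<close>.\<close>

lemma integral_gauss_cos:
  assumes t: "0 < t"
  shows "(\<integral>x. exp (- (pi * t) * x^2) * cos (2 * pi * k * x) \<partial>lborel) = exp (- (pi / t) * k^2) / sqrt t"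
proof -
  define c where "c = sqrt (2 * pi * t)"
  have c: "0 < c" "c^2 = 2 * pi * t" using t by (simp_all add: c_def)
  define \<tau> where "\<tau> = 2 * pi * k / c"
  have "Re (char std_normal_distribution \<tau>) = (\<integral>x. Re (iexp (\<tau> * x)) \<partial>std_normal_distribution)"
    unfolding char_def
    by (rule integral_Re[symmetric])
      (rule prob_space.integrable_iexp[OF prob_space_normal_density], auto)
  also have "\<dots> = (\<integral>x. cos (\<tau> * x) \<partial>std_normal_distribution)" by (simp add: Re_exp)
  also have "\<dots> = (\<integral>x. std_normal_density x * cos (\<tau> * x) \<partial>lborel)"
    by (subst integral_density) (auto simp: normal_density_nonneg)
  also have "\<dots> = \<bar>c\<bar> *\<^sub>R (\<integral>x. std_normal_density (0 + c * x) * cos (\<tau> * (0 + c * x)) \<partial>lborel)"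
    using c by (intro lborel_integral_real_affine) auto
  also have "\<dots> = c * (\<integral>x. (1 / sqrt (2 * pi)) * (exp (- (pi * t) * x^2) * cos (2 * pi * k * x)) \<partial>lborel)"
  proof -
    have "std_normal_density (0 + c * x) * cos (\<tau> * (0 + c * x)) = (1 / sqrt (2 * pi)) * (exp (- (pi * t) * x^2) * cos (2 * pi * k * x))" for x
      using c by (simp add: std_normal_density_def power_mult_distrib \<tau>_def mult.assoc)
    then show ?thesis using c by simp
  qed
  also have "\<dots> = sqrt t * (\<integral>x. exp (- (pi * t) * x^2) * cos (2 * pi * k * x) \<partial>lborel)"
    by (simp add: c_def real_sqrt_mult)
  finally have "Re (char std_normal_distribution \<tau>) = sqrt t * (\<integral>x. exp (- (pi * t) * x^2) * cos (2 * pi * k * x) \<partial>lborel)" .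
  moreover have "Re (char std_normal_distribution \<tau>) = exp (- (pi / t) * k^2)"
  proof -
    have "\<tau>^2 / 2 = (pi / t) * k^2" using t by (simp add: \<tau>_def power_divide c(2) power_mult_distrib) (simp add: power2_eq_square)
    then show ?thesis by (simp add: char_std_normal_distribution)
  qed
  ultimately show ?thesis using t by (simp add: field_simps)
qed

text \<open>Unfolds a Fourier coefficient of a periodization into an integral over the line: partial
  sums are integrals over \<open>{- N..N}\<close>, which converge by domination.\<close>

lemma has_sum_unit_intervals:
  fixes w :: "real \<Rightarrow> real"
  assumes cont: "continuous_on UNIV w" and int: "integrable lborel w"
    and J: "((\<lambda>n::int. integral {0..1} (\<lambda>x. w (real_of_int n + x))) has_sum J) UNIV"
  shows "J = (\<integral>x. w x \<partial>lborel)"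
proof -
  have wc: "continuous_on S w" for S using cont by (rule continuous_on_subset) simp
  have wi: "w integrable_on {a..b}" for a b by (intro integrable_continuous_interval wc)
  have shift: "integral {0..1} (\<lambda>x. w (real_of_int n + x)) = integral {real_of_int n..real_of_int n + 1} w" for n
  proof -
    have "(w has_integral integral {real_of_int n..real_of_int n + 1} w) (cbox (real_of_int n) (real_of_int n + 1))"
      using wi by (simp add: integrable_integral)
    from has_integral_affinity[OF this, of 1 "real_of_int n"]
    show ?thesis by (simp add: add.commute integral_unique)
  qed
  \<comment> \<open>The integers from -N to N - 1 are the left end points of the unit intervals that
    tile \<open>{- N..N}\<close>, hence the half-open range.\<close>
  have sum: "(\<Sum>n\<in>{- int N..<int N}. integral {0..1} (\<lambda>x. w (real_of_int n + x))) = integral {- real N..real N} w" for N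
  proof (induction N)
    case (Suc N)
    have "{- int (Suc N)..<int (Suc N)} = insert (- int (Suc N)) (insert (int N) {- int N..<int N})" by auto
    then have "(\<Sum>n\<in>{- int (Suc N)..<int (Suc N)}. integral {0..1} (\<lambda>x. w (real_of_int n + x)))
        = integral {- real (Suc N)..- real (Suc N) + 1} w + (integral {real N..real N + 1} w + integral {- real N..real N} w)"
      using Suc.IH by (simp add: shift)
    also have "\<dots> = integral {- real (Suc N)..- real N} w + (integral {- real N..real N} w + integral {real N..real (Suc N)} w)"
      by (simp add: add.commute)
    also have "\<dots> = integral {- real (Suc N)..real (Suc N)} w"
      using Henstock_Kurzweil_Integration.integral_combine[of "- real N" "real N" "real (Suc N)" w] wi
        Henstock_Kurzweil_Integration.integral_combine[of "- real (Suc N)" "- real N" "real (Suc N)" w] by simp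
    finally show ?case .
  qed simp
  have "filterlim (\<lambda>N. {- int N..<int N}) (finite_subsets_at_top UNIV) sequentially"
    unfolding filterlim_iff eventually_finite_subsets_at_top
  proof safe
    fix P and X :: "int set"
    assume X: "finite X" and P: "\<forall>Y. finite Y \<and> X \<subseteq> Y \<and> Y \<subseteq> UNIV \<longrightarrow> P Y"
    obtain M where M: "\<And>x. x \<in> X \<Longrightarrow> \<bar>x\<bar> \<le> M"
      using X by (metis finite_imageI Max_ge image_eqI)
    show "\<forall>\<^sub>F N in sequentially. P {- int N..<int N}"
      using eventually_ge_at_top[of "nat (M + 1)"]
    proof eventually_elim
      case (elim N)
      have "X \<subseteq> {- int N..<int N}" using M elim by fastforce
      with P show ?case by simp
    qed
  qed
  then have "(\<lambda>N. \<Sum>n\<in>{- int N..<int N}. integral {0..1} (\<lambda>x. w (real_of_int n + x))) \<longlonglongrightarrow> J"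
    using J unfolding has_sum_def by (rule filterlim_compose[rotated])
  then have 1: "(\<lambda>N. integral {- real N..real N} w) \<longlonglongrightarrow> J" unfolding sum .
  have "(\<lambda>N. \<integral>x. indicator {- real N..real N} x * w x \<partial>lborel) \<longlonglongrightarrow> (\<integral>x. w x \<partial>lborel)"
  proof (rule integral_dominated_convergence[where w = "\<lambda>x. \<bar>w x\<bar>"])
    show "AE x in lborel. (\<lambda>N. indicator {- real N..real N} x * w x) \<longlonglongrightarrow> w x"
    proof (intro AE_I2 tendsto_eventually)
      fix x :: real
      show "\<forall>\<^sub>F N in sequentially. indicator {- real N..real N} x * w x = w x"
        using eventually_ge_at_top[of "nat \<lceil>\<bar>x\<bar>\<rceil>"]
      proof eventually_elim
        case (elim N)
        then have "\<bar>x\<bar> \<le> real N" by linarith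
        then show ?case by (auto simp: indicator_def)
      qed
    qed
    show "w \<in> borel_measurable lborel" using int by simp
    then show "(\<lambda>x. indicator {- real N..real N} x * w x) \<in> borel_measurable lborel" for N by simp
    show "integrable lborel (\<lambda>x. \<bar>w x\<bar>)" using int by simp
    show "AE x in lborel. norm (indicator {- real N..real N} x * w x) \<le> \<bar>w x\<bar>" for N
      by (auto simp: indicator_def)
  qed
  moreover have "(\<integral>x. indicator {- real N..real N} x * w x \<partial>lborel) = integral {- real N..real N} w" for N
  proof -
    have "set_integrable lborel {- real N..real N} w"
      using int by (simp add: set_integrable_def integrable_real_mult_indicator mult.commute)
    from set_borel_integral_eq_integral(2)[OF this] show ?thesis
      by (simp add: set_lebesgue_integral_def)
  qed
  ultimately have "(\<lambda>N. integral {- real N..real N} w) \<longlonglongrightarrow> (\<integral>x. w x \<partial>lborel)" by simp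
  with 1 show ?thesis by (rule LIMSEQ_unique)
qed

lemma cos_int_shift: "cos (2 * pi * real_of_int k * (x + real_of_int m)) = cos (2 * pi * real_of_int k * x)"
proof -
  have "2 * pi * real_of_int k * (x + real_of_int m) = 2 * pi * real_of_int k * x + 2 * pi * real_of_int (k * m)"
    by (simp add: algebra_simps)
  then show ?thesis by (simp only: cos_add cos_int_2pin sin_int_2pin)
qed

text \<open>Both sides are continuous on the unit interval and symmetric under
  \<open>x \<mapsto> 1 - x\<close>, and their cosine coefficients agree: on the left by unfolding to
  the line, on the right by orthogonality of the cosines.\<close>

lemma poisson_gauss_unit:
  assumes t: "0 < t" and x: "x \<in> {0..1}"
  shows "(\<Sum>\<^sub>\<infinity>n::int. exp (- (pi * t) * (real_of_int n + x)^2))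
    = (\<Sum>\<^sub>\<infinity>k::int. exp (- (pi / t) * (real_of_int k)^2) * cos (2 * pi * real_of_int k * x) / sqrt t)"
proof -
  define c where "c = pi * t"
  have c: "0 < c" using t by (simp add: c_def)
  define a where "a k = exp (- (pi / t) * (real_of_int k)^2) / sqrt t" for k :: int
  have a_even: "a (- k) = a k" for k by (simp add: a_def)
  define f where "f x = (\<Sum>\<^sub>\<infinity>n::int. exp (- c * (real_of_int n + x)^2))" for x
  define g where "g x = (\<Sum>\<^sub>\<infinity>k::int. a k * cos (2 * pi * real_of_int k * x))" for x
  have Mf: "(\<lambda>n::int. exp c * exp (- (c / 2) * \<bar>real_of_int n\<bar>)) summable_on UNIV"
    using c by (intro summable_on_cmult_right summable_on_exp_abs_int) auto
  have bf: "exp (- c * (real_of_int n + x)^2) \<le> exp c * exp (- (c / 2) * \<bar>real_of_int n\<bar>)"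
    if "x \<in> {0..1}" for n x
  proof -
    have "x^2 \<le> 1" using that by (simp add: power_le_one)
    then have "c * x^2 \<le> c" using c by simp
    then show ?thesis using gauss_int_bound[OF c, of n x]
      by (meson exp_le_cancel_iff mult_right_mono exp_ge_zero order_trans)
  qed
  have Mg: "a summable_on UNIV"
    using summable_on_gauss_int[of "pi / t" 0] t
    unfolding a_def[abs_def] divide_inverse by (intro summable_on_cmult_left) simp
  have a0: "0 \<le> a k" for k using t by (simp add: a_def)
  have f_cont: "continuous_on {0..1} f"
    unfolding f_def by (rule M_test_sum_integral(1)[OF _ _ Mf]) (use bf in \<open>auto intro!: continuous_intros\<close>)
  have g_cont: "continuous_on {0..1} g"
    unfolding g_def
    by (rule M_test_sum_integral(1)[OF _ _ Mg])
      (use a0 in \<open>auto intro!: continuous_intros mult_left_le simp: abs_mult\<close>)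
  have f_sym: "f (1 - x) = f x" for x
    unfolding f_def
    by (rule infsum_reindex_bij_witness[of UNIV "\<lambda>n. - n - 1" "\<lambda>n. - n - 1"])
      (auto simp: power2_eq_square algebra_simps)
  have g_sym: "g (1 - x) = g x" for x
  proof -
    have "cos (2 * pi * real_of_int k * (1 - x)) = cos (2 * pi * real_of_int k * x)" for k
      using cos_int_shift[of k "- x" 1] by simp
    then show ?thesis by (simp add: g_def)
  qed
  have f_coeff: "integral {0..1} (\<lambda>x. f x * cos (2 * pi * real_of_int k * x)) = a k" for k
  proof -
    define w where "w y = exp (- c * y^2) * cos (2 * pi * real_of_int k * y)" for y
    have "((\<lambda>n. integral {0..1} (\<lambda>x. w (real_of_int n + x))) has_sum
        integral {0..1} (\<lambda>x. \<Sum>\<^sub>\<infinity>n::int. w (real_of_int n + x))) UNIV"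
    proof (rule M_test_sum_integral(2)[OF _ _ Mf])
      fix n x assume x: "x \<in> {0..1::real}"
      have "\<bar>w (real_of_int n + x)\<bar> \<le> exp (- c * (real_of_int n + x)^2) * 1"
        unfolding w_def abs_mult by (intro mult_mono) auto
      then show "\<bar>w (real_of_int n + x)\<bar> \<le> exp c * exp (- (c / 2) * \<bar>real_of_int n\<bar>)"
        using bf[OF x, of n] by linarith
    qed (auto simp: w_def intro!: continuous_intros)
    moreover have "(\<Sum>\<^sub>\<infinity>n::int. w (real_of_int n + x)) = f x * cos (2 * pi * real_of_int k * x)" for x
      unfolding f_def w_def
      by (simp only: add.commute[of "real_of_int _" x] cos_int_shift infsum_cmult_left')
    ultimately have "((\<lambda>n. integral {0..1} (\<lambda>x. w (real_of_int n + x))) has_sum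
        integral {0..1} (\<lambda>x. f x * cos (2 * pi * real_of_int k * x))) UNIV" by simp
    moreover have "integrable lborel w"
    proof (rule Bochner_Integration.integrable_bound)
      show "integrable lborel (\<lambda>x. exp (- (pi * t) * x^2))" by (rule integrable_gauss[OF t])
      show "AE x in lborel. norm (w x) \<le> norm (exp (- (pi * t) * x^2))"
        by (auto simp: w_def c_def abs_mult intro!: mult_left_le)
    qed (simp add: w_def[abs_def])
    moreover have "continuous_on UNIV w" unfolding w_def by (intro continuous_intros)
    ultimately have "integral {0..1} (\<lambda>x. f x * cos (2 * pi * real_of_int k * x)) = (\<integral>x. w x \<partial>lborel)"
      by (intro has_sum_unit_intervals)
    then show ?thesis unfolding w_def c_def integral_gauss_cos[OF t] a_def .
  qed
  have g_coeff: "integral {0..1} (\<lambda>x. g x * cos (2 * pi * real_of_int k * x)) = a k" for k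
  proof -
    have "((\<lambda>n. integral {0..1} (\<lambda>x. a n * cos (2 * pi * real_of_int n * x) * cos (2 * pi * real_of_int k * x))) has_sum
        integral {0..1} (\<lambda>x. \<Sum>\<^sub>\<infinity>n::int. a n * cos (2 * pi * real_of_int n * x) * cos (2 * pi * real_of_int k * x))) UNIV"
    proof (rule M_test_sum_integral(2)[OF _ _ Mg])
      fix n x
      have "\<bar>cos (2 * pi * real_of_int n * x)\<bar> * \<bar>cos (2 * pi * real_of_int k * x)\<bar> \<le> 1 * 1"
        by (intro mult_mono) auto
      then have "a n * (\<bar>cos (2 * pi * real_of_int n * x)\<bar> * \<bar>cos (2 * pi * real_of_int k * x)\<bar>) \<le> a n * 1"
        using a0[of n] by (intro mult_left_mono) auto
      then show "\<bar>a n * cos (2 * pi * real_of_int n * x) * cos (2 * pi * real_of_int k * x)\<bar> \<le> a n"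
        using a0[of n] by (simp add: abs_mult mult.assoc)
    qed (auto intro!: continuous_intros)
    moreover have "integral {0..1} (\<lambda>x. a n * cos (2 * pi * real_of_int n * x) * cos (2 * pi * real_of_int k * x))
        = (if n = k then a k / 2 else 0) + (if n = - k then a k / 2 else 0)" for n
    proof -
      have "a n * cos (2 * pi * real_of_int n * x) * cos (2 * pi * real_of_int k * x)
          = a n / 2 * cos (2 * pi * real_of_int (n - k) * x) + a n / 2 * cos (2 * pi * real_of_int (n + k) * x)" for x
      proof -
        have "2 * pi * real_of_int (n - k) * x = 2 * pi * real_of_int n * x - 2 * pi * real_of_int k * x"
          "2 * pi * real_of_int (n + k) * x = 2 * pi * real_of_int n * x + 2 * pi * real_of_int k * x"
          by (simp_all add: algebra_simps)
        then show ?thesis by (simp only: cos_add cos_diff) (simp add: field_simps)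
      qed
      then have "integral {0..1} (\<lambda>x. a n * cos (2 * pi * real_of_int n * x) * cos (2 * pi * real_of_int k * x))
          = integral {0..1} (\<lambda>x. a n / 2 * cos (2 * pi * real_of_int (n - k) * x) + a n / 2 * cos (2 * pi * real_of_int (n + k) * x))"
        by presburger
      also have "\<dots> = integral {0..1} (\<lambda>x. a n / 2 * cos (2 * pi * real_of_int (n - k) * x))
          + integral {0..1} (\<lambda>x. a n / 2 * cos (2 * pi * real_of_int (n + k) * x))"
        by (intro integral_add integrable_continuous_interval continuous_intros)
      also have "\<dots> = (if n = k then a k / 2 else 0) + (if n = - k then a k / 2 else 0)"
        by (simp only: integral_mult_right integral_cos_int) (auto simp: a_even add_eq_0_iff2)
      finally show ?thesis .
    qed
    \<comment> \<open>For \<open>k = 0\<close> the two indices coincide and a single term carries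
      both halves, so the total is \<open>a k\<close> in every case.\<close>
    moreover have "((\<lambda>n. (if n = k then a k / 2 else 0) + (if n = - k then a k / 2 else 0)) has_sum (a k / 2 + a k / 2)) UNIV"
    proof (rule has_sum_add)
      show "((\<lambda>n. if n = k then a k / 2 else 0) has_sum a k / 2) UNIV"
        by (rule has_sum_finite_neutralI[of "{k}"]) auto
      show "((\<lambda>n. if n = - k then a k / 2 else 0) has_sum a k / 2) UNIV"
        by (rule has_sum_finite_neutralI[of "{- k}"]) auto
    qed
    ultimately have "integral {0..1} (\<lambda>x. \<Sum>\<^sub>\<infinity>n::int. a n * cos (2 * pi * real_of_int n * x) * cos (2 * pi * real_of_int k * x)) = a k"
      by (simp only: has_sum_unique) (metis (no_types, lifting) field_sum_of_halves has_sum_unique)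
    then show ?thesis unfolding g_def by (simp only: infsum_cmult_left')
  qed
  have "f x - g x = 0"
  proof (rule even_periodic_zero_if_cos_coeffs_zero[OF _ _ _ x])
    show "continuous_on {0..1} (\<lambda>x. f x - g x)" by (intro continuous_intros f_cont g_cont)
    show "f (1 - x) - g (1 - x) = f x - g x" for x by (simp add: f_sym g_sym)
    fix k :: int
    have "integral {0..1} (\<lambda>x. f x * cos (2 * pi * real_of_int k * x) - g x * cos (2 * pi * real_of_int k * x))
        = a k - a k"
      unfolding f_coeff[symmetric, of k]
      by (subst integral_diff) (auto intro!: integrable_continuous_interval continuous_intros f_cont g_cont simp: f_coeff g_coeff)
    then show "integral {0..1} (\<lambda>x. (f x - g x) * cos (2 * pi * real_of_int k * x)) = 0"
      by (simp add: left_diff_distrib)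
  qed
  then show ?thesis by (simp add: f_def g_def c_def a_def)
qed

lemma poisson_gauss:
  assumes t: "0 < t"
  shows "(\<Sum>\<^sub>\<infinity>n::int. exp (- (pi * t) * (real_of_int n + x)^2))
    = (\<Sum>\<^sub>\<infinity>k::int. exp (- (pi / t) * (real_of_int k)^2) * cos (2 * pi * real_of_int k * x)) / sqrt t"
proof -
  have x: "x = frac x + real_of_int \<lfloor>x\<rfloor>" by (simp add: frac_def)
  have "(\<Sum>\<^sub>\<infinity>n::int. exp (- (pi * t) * (real_of_int n + x)^2)) = (\<Sum>\<^sub>\<infinity>n::int. exp (- (pi * t) * (real_of_int n + frac x)^2))"
    by (rule infsum_reindex_bij_witness[of UNIV "\<lambda>n. n - \<lfloor>x\<rfloor>" "\<lambda>n. n + \<lfloor>x\<rfloor>"]) (auto simp: frac_def algebra_simps)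
  also have "\<dots> = (\<Sum>\<^sub>\<infinity>k::int. exp (- (pi / t) * (real_of_int k)^2) * cos (2 * pi * real_of_int k * frac x) / sqrt t)"
    using frac_lt_1[of x] by (intro poisson_gauss_unit t) (auto intro: less_imp_le)
  also have "\<dots> = (\<Sum>\<^sub>\<infinity>k::int. exp (- (pi / t) * (real_of_int k)^2) * cos (2 * pi * real_of_int k * x)) / sqrt t"
  proof -
    have "cos (2 * pi * real_of_int k * frac x) = cos (2 * pi * real_of_int k * x)" for k
      using cos_int_shift[of k "frac x" "\<lfloor>x\<rfloor>"] by (simp add: frac_def)
    then show ?thesis by (simp only: divide_inverse infsum_cmult_left')
  qed
  finally show ?thesis .
qed

section \<open>Theta functions of binary forms\<close>

definition qform :: "real \<Rightarrow> real \<Rightarrow> real \<Rightarrow> int \<times> int \<Rightarrow> real" where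
  "qform p c q = (\<lambda>(m, n). p * (real_of_int m)^2 + 2 * c * real_of_int m * real_of_int n + q * (real_of_int n)^2)"

definition theta :: "real \<Rightarrow> real \<Rightarrow> real \<Rightarrow> real \<Rightarrow> real" where
  "theta p c q y = (\<Sum>\<^sub>\<infinity>v. exp (- (pi * y) * qform p c q v))"

lemma qform_complete_square:
  assumes "p \<noteq> 0"
  shows "qform p c q (m, n) = p * (real_of_int m + c / p * real_of_int n)^2 + (p * q - c^2) / p * (real_of_int n)^2"
  using assms by (simp add: qform_def power2_eq_square field_simps)

lemma qform_ge:
  assumes "0 < p" "c^2 < p * q"
  obtains k where "0 < k" "\<And>m n. k * ((real_of_int m)^2 + (real_of_int n)^2) \<le> qform p c q (m, n)"
proof -
  have q: "0 < q" using assms zero_le_power2[of c] zero_less_mult_pos[of p q] by linarith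
  \<comment> \<open>Determinant over trace bounds the smaller eigenvalue from below; with this
    choice \<open>(p - k) * (q - k) - c^2\<close> is exactly \<open>k^2\<close>.\<close>
  define k where "k = (p * q - c^2) / (p + q)"
  have k: "0 < k" using assms q by (simp add: k_def)
  have kp: "k < p"
  proof -
    have "p * q - c^2 < p * (p + q)" using assms zero_le_power2[of c] by (simp add: distrib_left add_pos_nonneg power2_eq_square) (smt (verit) mult_pos_pos zero_le_square)
    then show ?thesis using assms q by (simp add: k_def pos_divide_less_eq mult.commute)
  qed
  have kk: "c^2 \<le> (p - k) * (q - k)"
  proof -
    have "(p - k) * (q - k) = p * q - k * (p + q) + k^2" by (simp add: algebra_simps power2_eq_square)
    also have "k * (p + q) = p * q - c^2" using assms q by (simp add: k_def)
    finally show ?thesis by simp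
  qed
  have "k * (x^2 + y^2) \<le> p * x^2 + 2 * c * x * y + q * y^2" for x y :: real
  proof -
    have "0 \<le> ((p - k) * x + c * y)^2 + ((p - k) * (q - k) - c^2) * y^2"
      using kk by (intro add_nonneg_nonneg mult_nonneg_nonneg) auto
    also have "\<dots> = (p - k) * (p * x^2 + 2 * c * x * y + q * y^2 - k * (x^2 + y^2))"
      by (simp add: power2_eq_square algebra_simps)
    finally show ?thesis using kp by (simp add: zero_le_mult_iff)
  qed
  then show ?thesis using k that by (simp add: qform_def)
qed

lemma summable_on_exp_sum_sq:
  fixes k :: real
  assumes "0 < k"
  shows "(\<lambda>(m::int, n::int). exp (- k * ((real_of_int m)^2 + (real_of_int n)^2))) summable_on UNIV"
proof -
  have 1: "(\<lambda>m::int. exp (- k * (real_of_int m)^2)) summable_on UNIV"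
    using summable_on_gauss_int[OF assms, of 0] by simp
  then have a: "Infinite_Set_Sum.abs_summable_on (\<lambda>m::int. exp (- k * (real_of_int m)^2)) UNIV"
    by (subst (asm) summable_on_iff_abs_summable_on_real) (simp only: abs_summable_equivalent)
  have "Infinite_Set_Sum.abs_summable_on (\<lambda>(m::int, n::int). exp (- k * (real_of_int m)^2) * exp (- k * (real_of_int n)^2)) (UNIV \<times> UNIV)"
    by (rule abs_summable_on_product[OF _ _ a a]) auto
  then have "(\<lambda>(m::int, n::int). exp (- k * (real_of_int m)^2) * exp (- k * (real_of_int n)^2)) summable_on UNIV"
    by (subst summable_on_iff_abs_summable_on_real) (simp only: abs_summable_equivalent UNIV_Times_UNIV)
  then show ?thesis by (simp add: exp_add[symmetric] distrib_left)
qed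

lemma summable_on_exp_qform:
  assumes "0 < p" "c^2 < p * q" "0 < t"
  shows "(\<lambda>v. exp (- t * qform p c q v)) summable_on UNIV"
proof -
  obtain k where k: "0 < k" "\<And>m n. k * ((real_of_int m)^2 + (real_of_int n)^2) \<le> qform p c q (m, n)"
    using qform_ge[OF assms(1,2)] by blast
  show ?thesis
  proof (rule summable_on_comparison_test[OF summable_on_exp_sum_sq[of "t * k"]])
    show "0 < t * k" using k assms by simp
    fix v :: "int \<times> int"
    show "exp (- t * qform p c q v) \<le> (case v of (m, n) \<Rightarrow> exp (- (t * k) * ((real_of_int m)^2 + (real_of_int n)^2)))"
      using k(2) assms(3) by (auto simp: mult.assoc split: prod.split)
  qed auto
qed

lemma infsum_iterated:
  fixes f :: "'a \<times> 'b \<Rightarrow> real"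
  assumes "f summable_on UNIV"
  shows "infsum f UNIV = (\<Sum>\<^sub>\<infinity>n. \<Sum>\<^sub>\<infinity>m. f (m, n))"
proof -
  have "(f \<circ> prod.swap) summable_on UNIV"
    by (subst summable_on_reindex[symmetric]) (use assms in auto)
  then have s: "(\<lambda>(n, m). f (m, n)) summable_on UNIV \<times> UNIV"
    by (simp add: o_def case_prod_unfold prod.swap_def)
  have "infsum f UNIV = infsum (\<lambda>(n, m). f (m, n)) (UNIV \<times> UNIV)"
    by (rule infsum_reindex_bij_witness[of _ prod.swap prod.swap]) auto
  also have "\<dots> = (\<Sum>\<^sub>\<infinity>n. \<Sum>\<^sub>\<infinity>m. f (m, n))"
    by (rule infsum_Sigma'_banach[OF s, symmetric])
  finally show ?thesis .
qed

text \<open>Poisson summation in the first variable alone, with the square completed, turns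
  \<open>theta\<close> at \<open>y\<close> into the double sum of \<open>T n k\<close>. The same
  step at \<open>1 / y\<close> yields that double sum with the two indices exchanged, because the
  phase \<open>2 * pi * k * x * n\<close> is symmetric in them. So the equation reduces to swapping
  an absolutely convergent sum.\<close>

lemma theta_functional_equation:
  assumes p: "0 < p" and det: "p * q - c^2 = 1" and y: "0 < y"
  shows "theta p c q (1 / y) = y * theta p c q y"
proof -
  define x where "x = c / p"
  have form: "qform p c q (m, n) = p * (real_of_int m + x * real_of_int n)^2 + 1 / p * (real_of_int n)^2" for m n
    using qform_complete_square[of p c q m n] p det by (simp add: x_def)
  have pos: "c^2 < p * q" using det by simp
  define E where "E k n = exp (- (pi / (y * p)) * (real_of_int k)^2) * exp (- (pi * (y / p)) * (real_of_int n)^2)" for k n :: int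
  have E_sum: "(\<lambda>(n, k). E k n) summable_on UNIV"
  proof -
    define \<kappa> where "\<kappa> = min (pi / (y * p)) (pi * (y / p))"
    show ?thesis
    proof (rule summable_on_comparison_test[OF summable_on_exp_sum_sq[of \<kappa>]])
      show "0 < \<kappa>" using p y by (simp add: \<kappa>_def)
      fix v :: "int \<times> int"
      show "(case v of (n, k) \<Rightarrow> E k n) \<le> (case v of (n, k) \<Rightarrow> exp (- \<kappa> * ((real_of_int n)^2 + (real_of_int k)^2)))"
      proof (cases v)
        case (Pair n k)
        have "\<kappa> * (real_of_int k)^2 \<le> pi / (y * p) * (real_of_int k)^2" "\<kappa> * (real_of_int n)^2 \<le> pi * (y / p) * (real_of_int n)^2"
          by (intro mult_right_mono; simp add: \<kappa>_def)+
        then have "- (pi / (y * p)) * (real_of_int k)^2 + - (pi * (y / p)) * (real_of_int n)^2 \<le> - \<kappa> * ((real_of_int n)^2 + (real_of_int k)^2)"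
          by (simp add: distrib_left)
        then show ?thesis unfolding Pair E_def exp_add[symmetric] by simp
      qed
    qed (auto simp: E_def)
  qed
  define T where "T n k = E k n * cos (2 * pi * real_of_int k * (x * real_of_int n))" for n k :: int
  have T_sum: "(\<lambda>(n, k). T n k) summable_on UNIV"
  proof (rule summable_on_iff_abs_summable_on_real[THEN iffD2])
    show "(\<lambda>v. norm (case v of (n, k) \<Rightarrow> T n k)) summable_on UNIV"
      by (rule Infinite_Sum.abs_summable_on_comparison_test'[OF E_sum])
        (auto simp: T_def abs_mult E_def intro!: mult_left_le)
  qed
  have "theta p c q y = (\<Sum>\<^sub>\<infinity>n. \<Sum>\<^sub>\<infinity>m. exp (- (pi * y) * qform p c q (m, n)))"
    unfolding theta_def using p pos y by (intro infsum_iterated summable_on_exp_qform) auto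
  also have "\<dots> = (\<Sum>\<^sub>\<infinity>n. \<Sum>\<^sub>\<infinity>k. T n k) / sqrt (y * p)"
  proof -
    have "(\<Sum>\<^sub>\<infinity>m. exp (- (pi * y) * qform p c q (m, n))) = (\<Sum>\<^sub>\<infinity>k. T n k) / sqrt (y * p)" for n
    proof -
      have "(\<Sum>\<^sub>\<infinity>m. exp (- (pi * y) * qform p c q (m, n)))
          = (\<Sum>\<^sub>\<infinity>m. exp (- (pi * (y / p)) * (real_of_int n)^2) * exp (- (pi * (y * p)) * (real_of_int m + x * real_of_int n)^2))"
        by (simp add: form exp_add[symmetric] algebra_simps)
      also have "\<dots> = exp (- (pi * (y / p)) * (real_of_int n)^2) * ((\<Sum>\<^sub>\<infinity>k. exp (- (pi / (y * p)) * (real_of_int k)^2) * cos (2 * pi * real_of_int k * (x * real_of_int n))) / sqrt (y * p))"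
        using p y by (simp only: infsum_cmult_right' poisson_gauss mult_pos_pos)
      also have "\<dots> = (\<Sum>\<^sub>\<infinity>k. T n k) / sqrt (y * p)"
        unfolding T_def E_def times_divide_eq_right infsum_cmult_right'[symmetric]
        by (simp only: mult_ac)
      finally show ?thesis .
    qed
    then show ?thesis by (simp only: divide_inverse infsum_cmult_left')
  qed
  also have "(\<Sum>\<^sub>\<infinity>n. \<Sum>\<^sub>\<infinity>k. T n k) = (\<Sum>\<^sub>\<infinity>k. \<Sum>\<^sub>\<infinity>n. T n k)"
    by (rule infsum_swap_banach) (use T_sum in simp)
  also have "\<dots> = (\<Sum>\<^sub>\<infinity>k. \<Sum>\<^sub>\<infinity>n. exp (- (pi * (1 / y)) * qform p c q (n, k))) * sqrt (p / y)"
  proof -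
    have "(\<Sum>\<^sub>\<infinity>n. T n k) = (\<Sum>\<^sub>\<infinity>n. exp (- (pi * (1 / y)) * qform p c q (n, k))) * sqrt (p / y)" for k
    proof -
      have t: "0 < p / y" using p y by simp
      have "(\<Sum>\<^sub>\<infinity>n. exp (- (pi * (1 / y)) * qform p c q (n, k)))
          = (\<Sum>\<^sub>\<infinity>n. exp (- (pi / (y * p)) * (real_of_int k)^2) * exp (- (pi * (p / y)) * (real_of_int n + x * real_of_int k)^2))"
      proof -
        have "- (pi * (1 / y)) * (p * z^2 + 1 / p * (real_of_int k)^2) = - (pi / (y * p)) * (real_of_int k)^2 + - (pi * (p / y)) * z^2" for z
          using p y by (simp add: field_simps)
        then show ?thesis by (simp only: form exp_add)
      qed
      also have "\<dots> = exp (- (pi / (y * p)) * (real_of_int k)^2) * ((\<Sum>\<^sub>\<infinity>n. exp (- (pi / (p / y)) * (real_of_int n)^2) * cos (2 * pi * real_of_int n * (x * real_of_int k))) / sqrt (p / y))"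
        by (simp only: infsum_cmult_right' poisson_gauss[OF t])
      finally have eq: "(\<Sum>\<^sub>\<infinity>n. exp (- (pi * (1 / y)) * qform p c q (n, k))) = \<dots>" .
      have "(\<Sum>\<^sub>\<infinity>n. exp (- (pi * (1 / y)) * qform p c q (n, k))) * sqrt (p / y) = exp (- (pi / (y * p)) * (real_of_int k)^2) * (\<Sum>\<^sub>\<infinity>n. exp (- (pi * (y / p)) * (real_of_int n)^2) * cos (2 * pi * real_of_int k * (x * real_of_int n)))"
      proof -
        have c1: "cos (2 * pi * real_of_int n * (x * real_of_int k)) = cos (2 * pi * real_of_int k * (x * real_of_int n))" for n
          by (rule arg_cong[of _ _ cos]) (simp add: ac_simps)
        have c2: "pi / (p / y) = pi * (y / p)" by simp
        have "(\<Sum>\<^sub>\<infinity>n. exp (- (pi / (p / y)) * (real_of_int n)^2) * cos (2 * pi * real_of_int n * (x * real_of_int k)))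
            = (\<Sum>\<^sub>\<infinity>n. exp (- (pi * (y / p)) * (real_of_int n)^2) * cos (2 * pi * real_of_int k * (x * real_of_int n)))"
        proof (rule infsum_cong)
          show "exp (- (pi / (p / y)) * (real_of_int n)^2) * cos (2 * pi * real_of_int n * (x * real_of_int k))
            = exp (- (pi * (y / p)) * (real_of_int n)^2) * cos (2 * pi * real_of_int k * (x * real_of_int n))" for n
            by (simp only: c1[of n] c2)
        qed
        moreover have "A * (B / sqrt (p / y)) * sqrt (p / y) = A * B" for A B using p y by simp
        ultimately show ?thesis unfolding eq by presburger
      qed
      also have "\<dots> = (\<Sum>\<^sub>\<infinity>n. T n k)"
        unfolding T_def E_def infsum_cmult_right'[symmetric] by (simp only: mult_ac)
      finally show ?thesis by simp
    qed
    then show ?thesis by (simp only: infsum_cmult_left')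
  qed
  also have "(\<Sum>\<^sub>\<infinity>k. \<Sum>\<^sub>\<infinity>n. exp (- (pi * (1 / y)) * qform p c q (n, k))) = theta p c q (1 / y)"
    unfolding theta_def using p pos y by (intro infsum_iterated[symmetric] summable_on_exp_qform) auto
  finally have "theta p c q y = theta p c q (1 / y) * (sqrt (p / y) / sqrt (y * p))" by simp
  also have "sqrt (p / y) / sqrt (y * p) = 1 / y"
    using p y by (simp add: real_sqrt_divide real_sqrt_mult)
  finally show ?thesis using y by simp
qed

section \<open>The hexagonal norm form, its first shell and its rotation\<close>

definition hexnorm :: "int \<times> int \<Rightarrow> int" where
  "hexnorm = (\<lambda>(m, n). m^2 + m * n + n^2)"

text \<open>The square of the minimal length of \<open>A2\<close>.\<close>

definition hex :: real where "hex = 2 / sqrt 3"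

lemma hex_pos: "0 < hex" and hex_sq: "hex^2 = 4/3" by (simp_all add: hex_def power_divide)

lemma qform_hex: "qform hex (hex / 2) hex v = hex * real_of_int (hexnorm v)"
  by (cases v) (simp add: qform_def hexnorm_def algebra_simps)

text \<open>The six minimal vectors of \<open>hexnorm\<close>. A form with coefficients
  \<open>P\<close>, \<open>C\<close>, \<open>Q\<close> takes on them the values \<open>P\<close>,
  \<open>Q\<close> and \<open>R\<close>, each twice.\<close>

definition shell :: "(int \<times> int) set" where
  "shell = {(1, 0), (-1, 0), (0, 1), (0, -1), (1, -1), (-1, 1)}"

lemma hexnorm_double: "2 * hexnorm (m, n) = m^2 + n^2 + (m + n)^2"
  by (simp add: hexnorm_def power2_eq_square algebra_simps)

lemma hexnorm_nonneg: "0 \<le> hexnorm v"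
proof (cases v)
  case (Pair m n)
  have "0 \<le> 2 * hexnorm (m, n)" unfolding hexnorm_double by simp
  then show ?thesis by (simp add: Pair)
qed

text \<open>Twice the norm is a sum of three squares; if it were at most 4, all three bases would be
  at most 2 in absolute value, and the finitely many cases are checked.\<close>

lemma hexnorm_ge_3:
  assumes "v \<noteq> (0, 0)" "v \<notin> shell"
  shows "3 \<le> hexnorm v"
proof (cases v)
  case (Pair m n)
  have big: "4 \<le> k^2" if "2 \<le> \<bar>k\<bar>" for k :: int
    using power_mono[of 2 "\<bar>k\<bar>" 2] that by simp
  have parts: "0 \<le> m^2" "0 \<le> n^2" "0 \<le> (m + n)^2" by simp_all
  show ?thesis
  proof (rule ccontr)
    assume "\<not> 3 \<le> hexnorm v"
    then have sum: "m^2 + n^2 + (m + n)^2 \<le> 4" using hexnorm_double[of m n] by (simp add: Pair)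
    have m: "\<bar>m\<bar> \<le> 2" "\<bar>n\<bar> \<le> 2" "\<bar>m + n\<bar> \<le> 2"
    proof -
      have "k^2 \<le> 4 \<Longrightarrow> \<bar>k\<bar> \<le> 2" for k :: int
        using power_mono_iff[of "\<bar>k\<bar>" 2 2] by simp
      moreover have "m^2 \<le> 4" "n^2 \<le> 4" "(m + n)^2 \<le> 4" using sum parts by linarith+
      ultimately show "\<bar>m\<bar> \<le> 2" "\<bar>n\<bar> \<le> 2" "\<bar>m + n\<bar> \<le> 2" by auto
    qed
    then have "m \<in> {-2, -1, 0, 1, 2}" "n \<in> {-2, -1, 0, 1, 2}" by auto
    then show False using sum assms(1) assms(2)[unfolded shell_def] unfolding Pair
      by (elim insertE emptyE) simp_all
  qed
qed

definition others :: "(int \<times> int) set" where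
  "others = UNIV - insert (0, 0) shell"

text \<open>A linear map of order three that preserves \<open>hexnorm\<close> and permutes
  \<open>shell\<close>, hence also \<open>others\<close>.\<close>

definition rot :: "int \<times> int \<Rightarrow> int \<times> int" where "rot = (\<lambda>(m, n). (n, - m - n))"

lemma rot3: "rot (rot (rot v)) = v" by (cases v) (simp add: rot_def)

lemma rot_others: "v \<in> others \<Longrightarrow> rot v \<in> others"
  by (cases v) (auto simp: rot_def others_def shell_def)

lemma infsum_rot: "infsum (\<lambda>v. f (rot v)) others = infsum f others"
  by (rule infsum_reindex_bij_witness[of _ "\<lambda>v. rot (rot v)" rot]) (auto simp: rot3 rot_others)

lemma summable_rot: "f summable_on others \<Longrightarrow> (\<lambda>v. f (rot v)) summable_on others"
  by (rule summable_on_reindex_bij_witness[of _ "\<lambda>v. rot (rot v)" rot, THEN iffD2]) (auto simp: rot3 rot_others)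

lemma qform_rot_sum:
  "qform p c q v + qform p c q (rot v) + qform p c q (rot (rot v))
    = 2 * (p + q - c) * real_of_int (hexnorm v)"
  by (cases v) (simp add: qform_def rot_def hexnorm_def power2_eq_square algebra_simps)

text \<open>Averaging over the rotation of order three turns the form into a multiple of the hexagonal one;
  convexity of the exponential does the rest.\<close>

lemma sum_others_ge:
  assumes f: "(\<lambda>v. exp (- t * qform p c q v)) summable_on others"
    and h: "(\<lambda>v. exp (- t * real_of_int (hexnorm v))) summable_on others"
    and d: "(\<lambda>v. real_of_int (hexnorm v) * exp (- t * real_of_int (hexnorm v))) summable_on others"
  shows "infsum (\<lambda>v. exp (- t * real_of_int (hexnorm v))) others
      - t * (2 * (p + q - c) - 3) / 3 * infsum (\<lambda>v. real_of_int (hexnorm v) * exp (- t * real_of_int (hexnorm v))) others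
    \<le> infsum (\<lambda>v. exp (- t * qform p c q v)) others"
proof -
  let ?f = "\<lambda>v. exp (- t * qform p c q v)"
  let ?h = "\<lambda>v. exp (- t * real_of_int (hexnorm v))"
  let ?d = "\<lambda>v. real_of_int (hexnorm v) * exp (- t * real_of_int (hexnorm v))"
  let ?\<tau> = "2 * (p + q - c) - 3"
  have f1: "(\<lambda>v. ?f (rot v)) summable_on others" by (rule summable_rot[OF f])
  have f2: "(\<lambda>v. ?f (rot (rot v))) summable_on others" by (rule summable_rot[OF f1])
  have "3 * infsum ?h others - t * ?\<tau> * infsum ?d others = infsum (\<lambda>v. 3 * ?h v + - (t * ?\<tau>) * ?d v) others"
    by (subst infsum_add[OF summable_on_cmult_right[OF h] summable_on_cmult_right[OF d]])
      (simp only: infsum_cmult_right', simp)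
  also have "\<dots> \<le> infsum (\<lambda>v. ?f v + ?f (rot v) + ?f (rot (rot v))) others"
  proof (rule infsum_mono)
    show "(\<lambda>v. 3 * ?h v + - (t * ?\<tau>) * ?d v) summable_on others"
      by (intro summable_on_add summable_on_cmult_right h d)
    show "(\<lambda>v. ?f v + ?f (rot v) + ?f (rot (rot v))) summable_on others"
      by (intro summable_on_add f f1 f2)
    fix v
    define N where "N = real_of_int (hexnorm v)"
    have e: "exp (- t * N) * (1 - t * (x - N)) \<le> exp (- t * x)" for x
    proof -
      have "1 - t * (x - N) \<le> exp (- t * (x - N))" using exp_ge_add_one_self[of "- t * (x - N)"] by simp
      then have "exp (- t * N) * (1 - t * (x - N)) \<le> exp (- t * N) * exp (- t * (x - N))" by simp
      also have "\<dots> = exp (- t * x)" by (simp add: exp_add[symmetric] algebra_simps)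
      finally show ?thesis .
    qed
    have "exp (- t * N) * (3 - t * (qform p c q v + qform p c q (rot v) + qform p c q (rot (rot v)) - 3 * N))
        \<le> ?f v + ?f (rot v) + ?f (rot (rot v))"
      using e[of "qform p c q v"] e[of "qform p c q (rot v)"] e[of "qform p c q (rot (rot v))"]
      by (simp add: algebra_simps)
    then show "3 * ?h v + - (t * ?\<tau>) * ?d v \<le> ?f v + ?f (rot v) + ?f (rot (rot v))"
      unfolding qform_rot_sum N_def by (simp add: algebra_simps)
  qed
  also have "\<dots> = infsum ?f others + infsum (\<lambda>v. ?f (rot v)) others + infsum (\<lambda>v. ?f (rot (rot v))) others"
    by (simp only: infsum_add summable_on_add f f1 f2)
  also have "\<dots> = 3 * infsum ?f others"
    using infsum_rot[of "\<lambda>v. ?f (rot v)"] infsum_rot[of ?f] by simp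
  finally show ?thesis by simp
qed

section \<open>Numerical bounds for the farther shells\<close>

lemma infsum_exp_int_le:
  shows "(\<lambda>m::int. exp (- (1/4) * (real_of_int m)^2)) summable_on UNIV"
    and "(\<Sum>\<^sub>\<infinity>m::int. exp (- (1/4) * (real_of_int m)^2)) \<le> 41/10"
proof -
  let ?f = "\<lambda>m::int. exp (- (1/4) * (real_of_int m)^2)"
  show s: "?f summable_on UNIV" using summable_on_gauss_int[of "1/4" 0] by simp
  have sub: "?f summable_on A" for A by (rule summable_on_subset_banach[OF s]) simp
  define r where "r = exp (- (3/4) :: real)"
  have r: "0 < r" "r < 1" "r \<le> 12/25"
  proof -
    have "25/12 \<le> exp (3/4 :: real)" using exp_taylor_ge_nonneg[of "3/4"] by (simp add: eval_nat_numeral)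
    then show "r \<le> 12/25" by (simp add: r_def exp_minus field_simps)
  qed (auto simp: r_def)
  define g where "g k = exp (1/2) * r ^ k" for k :: nat
  have "exp (1/2 :: real) \<le> 5/3"
  proof -
    have "3/5 \<le> exp (- (1/2) :: real)" using exp_taylor_ge[of "1/2"] by (simp add: eval_nat_numeral)
    then show ?thesis by (simp add: exp_minus field_simps)
  qed
  have fg: "?f (int k) \<le> g k" if "1 \<le> k" for k
  proof -
    \<comment> \<open>For integers \<open>k^2 \<ge> 3 * k - 2\<close>, with equality at 1 and 2;
      this replaces the Gaussian by a geometric series of ratio
      \<open>exp (- (3/4))\<close>.\<close>
    have "0 \<le> (real k - 1) * (real k - 2)" using that by (cases "k = 1") auto
    then have "- (1/4) * (real k)^2 \<le> 1/2 + real k * (- (3/4))" by (simp add: power2_eq_square field_simps)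
    then show ?thesis unfolding g_def r_def exp_of_nat_mult[symmetric] exp_add[symmetric] by simp
  qed
  have gs: "(\<lambda>k. g (Suc k)) sums (exp (1/2) * r / (1 - r))"
    using sums_mult[OF geometric_sums[of r], of "exp (1/2) * r"] r by (simp add: g_def mult_ac)
  have "(\<lambda>k. g (Suc k)) summable_on UNIV"
    using gs by (subst summable_on_UNIV_nonneg_real_iff) (auto simp: g_def r_def sums_iff)
  then have gi: "(\<lambda>k. g (Suc k)) summable_on UNIV" "(\<Sum>\<^sub>\<infinity>k. g (Suc k)) = exp (1/2) * r / (1 - r)"
    using gs by (auto simp: g_def r_def intro!: infsumI has_sum_infsum sums_nonneg_imp_has_sum)
  have bound: "exp (1/2) * r / (1 - r) \<le> 3/2 + 1/26"
  proof -
    have "exp (1/2) * r / (1 - r) \<le> 5/3 * (12/25) / (1 - 12/25)"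
      using r \<open>exp (1/2) \<le> 5/3\<close> by (intro frac_le mult_mono) auto
    then show ?thesis by simp
  qed
  have pos: "infsum ?f (range (\<lambda>k. int (Suc k))) \<le> 3/2 + 1/26"
  proof -
    have "infsum ?f (range (\<lambda>k. int (Suc k))) = infsum (\<lambda>k. ?f (int (Suc k))) UNIV"
      by (subst infsum_reindex) (auto simp: inj_on_def o_def)
    also have "\<dots> \<le> infsum (\<lambda>k. g (Suc k)) UNIV"
    proof (rule infsum_mono)
      have "?f summable_on (range (\<lambda>k. int (Suc k)))" by (rule summable_on_subset_banach[OF s]) auto
      then show "(\<lambda>k. ?f (int (Suc k))) summable_on UNIV"
        by (subst (asm) summable_on_reindex) (auto simp: inj_on_def o_def)
      show "?f (int (Suc k)) \<le> g (Suc k)" for k by (rule fg) simp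
    qed (use gi in auto)
    finally show ?thesis using gi(2) bound by linarith
  qed
  have neg: "infsum ?f (range (\<lambda>k. - int (Suc k))) = infsum ?f (range (\<lambda>k. int (Suc k)))"
    by (rule infsum_reindex_bij_witness[of _ uminus uminus]) auto
  have "UNIV = insert 0 (range (\<lambda>k. int (Suc k)) \<union> range (\<lambda>k. - int (Suc k)))"
  proof -
    have "m \<in> insert 0 (range (\<lambda>k. int (Suc k)) \<union> range (\<lambda>k. - int (Suc k)))" for m
    proof (cases m "0::int" rule: linorder_cases)
      case less
      then have "m = - int (Suc (nat (- m - 1)))" by simp
      then show ?thesis by blast
    next
      case greater
      then have "m = int (Suc (nat (m - 1)))" by simp
      then show ?thesis by blast
    qed simp
    then show ?thesis by blast
  qed
  then have "infsum ?f UNIV = infsum ?f (insert 0 (range (\<lambda>k. int (Suc k)) \<union> range (\<lambda>k. - int (Suc k))))" by simp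
  also have "\<dots> = ?f 0 + infsum ?f (range (\<lambda>k. int (Suc k)) \<union> range (\<lambda>k. - int (Suc k)))"
    by (rule infsum_insert[OF sub]) auto
  also have "infsum ?f (range (\<lambda>k. int (Suc k)) \<union> range (\<lambda>k. - int (Suc k)))
      = infsum ?f (range (\<lambda>k. int (Suc k))) + infsum ?f (range (\<lambda>k. - int (Suc k)))"
    by (rule infsum_Un_disjoint[OF sub sub]) auto
  finally show "infsum ?f UNIV \<le> 41/10" using pos neg by simp
qed

lemma qform_scale: "qform (k * p) (k * c) (k * q) v = k * qform p c q v"
  by (cases v) (simp add: qform_def algebra_simps)

lemma arctan_ge_cubic:
  fixes x :: real
  assumes "0 \<le> x"
  shows "x - x^3 / 3 \<le> arctan x"
proof -
  have "\<exists>d. ((\<lambda>x. arctan x - (x - x^3 / 3)) has_real_derivative d) (at u) \<and> 0 \<le> d" for u :: real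
  proof (intro exI conjI)
    have pos: "0 < 1 + u^2" by (simp add: add_pos_nonneg)
    then have "inverse (1 + u^2) - (1 - u^2) = u^4 / (1 + u^2)" by (simp add: field_simps eval_nat_numeral)
    with pos show "0 \<le> inverse (1 + u^2) - (1 - u^2)" by simp
    show "((\<lambda>x. arctan x - (x - x^3 / 3)) has_real_derivative inverse (1 + u^2) - (1 - u^2)) (at u)"
      by (auto intro!: derivative_eq_intros)
  qed
  from DERIV_nonneg_imp_nondecreasing[OF assms this] show ?thesis by simp
qed

text \<open>Machin's formula, with the cubic lower bound for the arctangent of 1/5 and the linear
  upper bound for that of 1/239.\<close>

lemma pi_ge_313: "313/100 \<le> pi"
proof -
  have "(1/5 :: real) - (1/5)^3 / 3 \<le> arctan (1/5)" by (rule arctan_ge_cubic) simp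
  moreover have "arctan (1/239) \<le> 1/239" by (rule arctan_le_self) simp
  ultimately show ?thesis using machin by (simp add: eval_nat_numeral)
qed

lemma pi_hex_ge: "18/5 \<le> pi * hex"
proof -
  have "(3.13 :: real) \<le> pi" using pi_ge_313 by simp
  moreover have "(1.153 :: real)\<^sup>2 \<le> hex\<^sup>2" unfolding hex_sq by (simp add: power2_eq_square)
  then have "(1.153 :: real) \<le> hex" using hex_pos power2_le_imp_le by fastforce
  ultimately have "3.13 * 1.153 \<le> pi * hex" by (intro mult_mono) auto
  then show ?thesis by simp
qed

lemma exp_neg_57_10: "exp (- (57/10)) \<le> (1/281 :: real)"
proof -
  have "257/100 \<le> exp (19/20 :: real)"
    using exp_taylor_ge_nonneg[of "19/20"] by (simp add: eval_nat_numeral)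
  then have "(257/100)^6 \<le> exp (19/20 :: real)^6" by (intro power_mono) auto
  also have "\<dots> = exp (57/10)" by (simp add: exp_of_nat_mult[symmetric])
  finally have "281 \<le> exp (57/10 :: real)" by (simp add: eval_nat_numeral)
  then show ?thesis by (simp add: exp_minus field_simps)
qed

text \<open>This weighted sum is the coefficient of the loss in \<open>sum_others_ge\<close>. The
  weight is absorbed by \<open>N \<le> 3 * exp ((N - 3) / 3)\<close>, tangent at the smallest value
  \<open>N = 3\<close>, and a part \<open>N / 2\<close> of the exponent is kept to dominate by a
  product of two Gaussians. The outcome \<open>3 / 281 * (41/10)^2\<close> is just below
  18/100.\<close>

lemma others_sum:
  fixes t :: real
  assumes t: "18/5 \<le> t"
  shows "(\<lambda>v. real_of_int (hexnorm v) * exp (- t * real_of_int (hexnorm v))) summable_on others"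
    and "infsum (\<lambda>v. real_of_int (hexnorm v) * exp (- t * real_of_int (hexnorm v))) others \<le> 18/100 * exp (- t)"
proof -
  let ?d = "\<lambda>v. real_of_int (hexnorm v) * exp (- t * real_of_int (hexnorm v))"
  let ?g = "\<lambda>v. exp (- (1/4) * (real_of_int (fst v))^2) * exp (- (1/4) * (real_of_int (snd v))^2)"
  let ?\<kappa> = "exp (- t) * (3 * exp (- (57/10)))"
  have gs: "?g summable_on UNIV"
    using summable_on_exp_sum_sq[of "1/4"] by (simp add: case_prod_unfold exp_add[symmetric] algebra_simps)
  have dg: "?d v \<le> ?\<kappa> * ?g v" if v: "v \<in> others" for v
  proof -
    define N where "N = real_of_int (hexnorm v)"
    have N: "3 \<le> N" using hexnorm_ge_3[of v] v by (auto simp: others_def N_def)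
    have "2 * N = (real_of_int (fst v))^2 + (real_of_int (snd v))^2 + (real_of_int (fst v) + real_of_int (snd v))^2"
      using hexnorm_double[of "fst v" "snd v"] by (simp add: N_def flip: of_int_add of_int_power of_int_mult)
    then have N2: "(real_of_int (fst v))^2 + (real_of_int (snd v))^2 \<le> 2 * N" by simp
    have "N \<le> 3 * e" if "1 + (N - 3) / 3 \<le> e" for e using that by (simp add: field_simps)
    from this[OF exp_ge_add_one_self] have "N \<le> 3 * exp ((N - 3) / 3)" .
    then have "N * exp (- t * N) \<le> 3 * exp ((N - 3) / 3) * exp (- t * N)" by (intro mult_right_mono) auto
    also have "\<dots> = 3 * exp ((N - 3) / 3 - t * N)" by (simp add: exp_add[symmetric] exp_diff exp_minus field_simps)
    \<comment> \<open>The constant 57/10 is the largest possible: equality holds at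
      \<open>N = 3\<close>, \<open>t = 18/5\<close>.\<close>
    also have "\<dots> \<le> 3 * exp (- t - 57/10 - N / 2)"
    proof -
      have "18/5 * (N - 1) \<le> t * (N - 1)" using t N by (intro mult_right_mono) auto
      then have "18/5 * N - 18/5 \<le> t * N - t" by (simp only: right_diff_distrib mult_1_right)
      then have "(N - 3) / 3 - t * N \<le> - t - 57/10 - N / 2" using N unfolding diff_divide_distrib by linarith
      then show ?thesis by simp
    qed
    also have "\<dots> \<le> 3 * exp (- t - 57/10 - ((real_of_int (fst v))^2 + (real_of_int (snd v))^2) / 4)"
      using N2 by simp
    also have "\<dots> = ?\<kappa> * ?g v" by (simp add: exp_add[symmetric] mult_ac) (simp add: algebra_simps)
    finally show ?thesis by (simp add: N_def)
  qed
  have d0: "0 \<le> ?d v" for v using hexnorm_nonneg[of v] by simp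
  have \<kappa>gs: "(\<lambda>v. ?\<kappa> * ?g v) summable_on A" for A
    by (rule summable_on_cmult_right) (rule summable_on_subset_banach[OF gs], simp)
  show ds: "?d summable_on others"
    by (rule summable_on_comparison_test[OF \<kappa>gs]) (use dg d0 in auto)
  have "infsum ?d others \<le> infsum (\<lambda>v. ?\<kappa> * ?g v) UNIV"
    by (rule infsum_mono_neutral[OF ds \<kappa>gs]) (use dg in auto)
  also have "\<dots> = ?\<kappa> * infsum ?g UNIV" by (rule infsum_cmult_right')
  also have "infsum ?g UNIV = (\<Sum>\<^sub>\<infinity>m::int. exp (- (1/4) * (real_of_int m)^2)) * (\<Sum>\<^sub>\<infinity>m::int. exp (- (1/4) * (real_of_int m)^2))"
    by (subst infsum_iterated[OF gs]) (simp only: fst_conv snd_conv infsum_cmult_left' infsum_cmult_right')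
  also have "?\<kappa> * \<dots> \<le> ?\<kappa> * (41/10 * (41/10))"
    using infsum_exp_int_le by (intro mult_left_mono mult_mono infsum_nonneg) auto
  also have "\<dots> \<le> 18/100 * exp (- t)"
  proof -
    have "3 * exp (- (57/10)) * (41/10 * (41/10)) \<le> (18/100 :: real)" using exp_neg_57_10 by simp
    then have "exp (- t) * (3 * exp (- (57/10)) * (41/10 * (41/10))) \<le> exp (- t) * (18/100)"
      by (intro mult_left_mono) auto
    then show ?thesis by (simp add: mult_ac)
  qed
  finally show "infsum ?d others \<le> 18/100 * exp (- t)" .
qed

lemma infsum_shell_split:
  fixes f :: "int \<times> int \<Rightarrow> real"
  assumes f: "f summable_on UNIV" and even: "\<And>m n. f (- m, - n) = f (m, n)"
  shows "infsum f UNIV = f (0, 0) + 2 * (f (1, 0) + f (0, 1) + f (1, -1)) + infsum f others"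
proof -
  have sub: "f summable_on A" for A by (rule summable_on_subset_banach[OF f]) simp
  have "UNIV = insert (0, 0) shell \<union> others" by (auto simp: others_def)
  then have "infsum f UNIV = infsum f (insert (0, 0) shell \<union> others)" by simp
  also have "\<dots> = infsum f (insert (0, 0) shell) + infsum f others"
    by (rule infsum_Un_disjoint[OF sub sub]) (auto simp: others_def)
  also have "infsum f (insert (0, 0) shell) = sum f (insert (0, 0) shell)"
    by (rule infsum_finite) (simp add: shell_def)
  also have "\<dots> = f (0, 0) + 2 * (f (1, 0) + f (0, 1) + f (1, -1))"
    using even[of 1 0] even[of 0 1] even[of 1 "-1"] by (simp add: shell_def)
  finally show ?thesis .
qed

context reduced_form begin

text \<open>The constant terms agree, so the gain \<open>2 * exp (- t) * (S t - 3)\<close> of the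
  first shell is weighed against the farther shells. For small \<open>P\<close> the gain is bounded
  below outright; otherwise gain and loss are both multiples of
  \<open>exp (- t) * t * tau\<close>.\<close>

lemma theta_hex_le:
  assumes y: "1 \<le> y"
  shows "theta hex (hex / 2) hex y \<le> theta (hex * P) (hex * C) (hex * Q) y"
    and "tau \<noteq> 0 \<Longrightarrow> theta hex (hex / 2) hex y < theta (hex * P) (hex * C) (hex * Q) y"
proof -
  define t where "t = pi * y * hex"
  have t: "18/5 \<le> t"
  proof -
    have "pi * hex * 1 \<le> pi * hex * y" using y hex_pos by (intro mult_left_mono) auto
    with pi_hex_ge have "18/5 \<le> pi * hex * y" by linarith
    also have "\<dots> = t" by (simp add: t_def)
    finally show ?thesis .
  qed
  then have t0: "0 < t" by simp
  let ?f = "\<lambda>v. exp (- t * qform P C Q v)"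
  let ?h = "\<lambda>v. exp (- t * real_of_int (hexnorm v))"
  let ?d = "\<lambda>v. real_of_int (hexnorm v) * exp (- t * real_of_int (hexnorm v))"
  have fs: "?f summable_on UNIV"
    using disc P_pos t0 by (intro summable_on_exp_qform) auto
  have hs: "?h summable_on UNIV"
  proof -
    have "(\<lambda>v. exp (- (t / hex) * qform hex (hex / 2) hex v)) summable_on UNIV"
      using t0 hex_pos by (intro summable_on_exp_qform) (auto simp: power2_eq_square)
    then show ?thesis using hex_pos by (simp add: qform_hex)
  qed
  have sub: "g summable_on UNIV \<Longrightarrow> g summable_on A" for g :: "int \<times> int \<Rightarrow> real" and A
    by (rule summable_on_subset_banach) auto
  have "theta (hex * P) (hex * C) (hex * Q) y = infsum ?f UNIV"
    by (simp add: theta_def qform_scale t_def mult.assoc)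
  also have "\<dots> = ?f (0, 0) + 2 * (?f (1, 0) + ?f (0, 1) + ?f (1, -1)) + infsum ?f others"
    by (rule infsum_shell_split[OF fs]) (simp add: qform_def)
  also have "\<dots> = 1 + 2 * exp (- t) * S t + infsum ?f others"
  proof -
    have e: "exp (- t * x) = exp (- t) * exp (- t * (x - 1))" for x
      unfolding exp_add[symmetric] by (simp add: algebra_simps)
    have q: "qform P C Q (0, 0) = 0" "qform P C Q (1, 0) = P" "qform P C Q (0, 1) = Q" "qform P C Q (1, -1) = R"
      by (simp_all add: qform_def R_def)
    show ?thesis unfolding q S_def e[of P] e[of Q] e[of R] by (simp add: distrib_left mult.assoc)
  qed
  finally have F: "theta (hex * P) (hex * C) (hex * Q) y = 1 + 2 * exp (- t) * S t + infsum ?f others" .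
  have "theta hex (hex / 2) hex y = infsum ?h UNIV"
    by (simp add: theta_def qform_hex t_def mult_ac)
  also have "\<dots> = ?h (0, 0) + 2 * (?h (1, 0) + ?h (0, 1) + ?h (1, -1)) + infsum ?h others"
    by (rule infsum_shell_split[OF hs]) (simp add: hexnorm_def)
  also have "\<dots> = 1 + 2 * exp (- t) * 3 + infsum ?h others" by (simp add: hexnorm_def)
  finally have H: "theta hex (hex / 2) hex y = 1 + 2 * exp (- t) * 3 + infsum ?h others" .
  have D: "infsum ?d others \<le> 18/100 * exp (- t)" by (rule others_sum(2)[OF t])
  have diff: "theta hex (hex / 2) hex y \<le> theta (hex * P) (hex * C) (hex * Q) y
      \<and> (tau \<noteq> 0 \<longrightarrow> theta hex (hex / 2) hex y < theta (hex * P) (hex * C) (hex * Q) y)"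
  proof (cases "P < 7/10")
    case True
    \<comment> \<open>The gain \<open>2/10 * exp (- t)\<close> outweighs the entire hexagonal sum
      over \<open>others\<close>, which is at most \<open>18/100 * exp (- t)\<close>; of the other
      form only nonnegativity is used.\<close>
    have "t / (18/5) * (1/10) \<le> t / (18/5) * (S (18/5) - 3)"
      using S_small_P[OF True] t0 by (intro mult_left_mono) auto
    also have "\<dots> \<le> S t - 3" by (rule S_bernoulli[OF t])
    finally have "1/10 \<le> S t - 3" using t by simp
    then have "exp (- t) * (1/10) \<le> exp (- t) * (S t - 3)" by (intro mult_left_mono) auto
    moreover have "infsum ?h others \<le> infsum ?d others"
    proof (rule infsum_mono[OF sub[OF hs] others_sum(1)[OF t]])
      fix v assume "v \<in> others"
      then have "1 \<le> real_of_int (hexnorm v)" using hexnorm_ge_3[of v] by (auto simp: others_def)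
      then show "?h v \<le> ?d v" by simp
    qed
    moreover have "0 \<le> infsum ?f others" by (rule infsum_nonneg) simp
    moreover have "0 < exp (- t)" by simp
    ultimately have "theta hex (hex / 2) hex y < theta (hex * P) (hex * C) (hex * Q) y"
      using D unfolding F H right_diff_distrib by linarith
    then show ?thesis by simp
  next
    case False
    have "t / (18/5) * (11/100 * tau) \<le> t / (18/5) * (S (18/5) - 3)"
      using S_large_P False t0 by (intro mult_left_mono) auto
    also have "\<dots> \<le> S t - 3" by (rule S_bernoulli[OF t])
    finally have "exp (- t) * (t / (18/5) * (11/100 * tau)) \<le> exp (- t) * (S t - 3)" by (intro mult_left_mono) auto
    moreover define u where "u = exp (- t) * t * tau"
    ultimately have 1: "11/360 * u \<le> exp (- t) * S t - exp (- t) * 3" by (simp add: right_diff_distrib mult_ac)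
    have tau: "2 * (P + Q - C) - 3 = tau" by (simp add: tau_def R_def)
    have 2: "infsum ?h others - t * tau / 3 * infsum ?d others \<le> infsum ?f others"
      using sum_others_ge[OF sub[OF fs] sub[OF hs] others_sum(1)[OF t]] unfolding tau .
    have "t * tau / 3 * infsum ?d others \<le> t * tau / 3 * (18/100 * exp (- t))"
      using D t0 tau_nonneg by (intro mult_left_mono) auto
    also have "\<dots> = 6/100 * u" by (simp add: u_def)
    finally have 3: "t * tau / 3 * infsum ?d others \<le> 6/100 * u" .
    have 4: "0 \<le> u" "tau \<noteq> 0 \<Longrightarrow> 0 < u"
      using t0 tau_nonneg by (auto simp: u_def)
    \<comment> \<open>The first shell enters twice, so the gain is \<open>22/360 * u\<close>, about
      0.0611 times \<open>u\<close>, against a loss of at most \<open>6/100 * u\<close>.\<close>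
    have gen: "1 + 2 * e * 3 + h \<le> 1 + 2 * e * s + f \<and> (0 < u \<longrightarrow> 1 + 2 * e * 3 + h < 1 + 2 * e * s + f)"
      if "11/360 * u \<le> e * s - e * 3" "h - k \<le> f" "k \<le> 6/100 * u" "0 \<le> u" for e h s f k :: real
    proof -
      have "2 * e * 3 = 2 * (e * 3)" "2 * e * s = 2 * (e * s)" by simp_all
      with that show ?thesis by linarith
    qed
    from gen[OF 1 2 3 4(1)] 4(2) show ?thesis unfolding F H by blast
  qed
  show "theta hex (hex / 2) hex y \<le> theta (hex * P) (hex * C) (hex * Q) y" using diff by blast
  show "tau \<noteq> 0 \<Longrightarrow> theta hex (hex / 2) hex y < theta (hex * P) (hex * C) (hex * Q) y" using diff by blast
qed

end

section \<open>Zeta functions of binary forms\<close>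

definition zform :: "real \<Rightarrow> real \<Rightarrow> real \<Rightarrow> real \<Rightarrow> real" where
  "zform p c q s = (\<Sum>\<^sub>\<infinity>v\<in>UNIV - {(0, 0)}. qform p c q v powr (- s / 2))"

lemma qform_pos:
  assumes "0 < p" "c^2 < p * q" "v \<noteq> (0, 0)"
  shows "0 < qform p c q v"
proof (cases v)
  case (Pair m n)
  obtain k where k: "0 < k" "\<And>m n. k * ((real_of_int m)^2 + (real_of_int n)^2) \<le> qform p c q (m, n)"
    using qform_ge[OF assms(1,2)] by blast
  have "0 < (real_of_int m)^2 + (real_of_int n)^2"
    using assms(3) Pair by (auto simp: sum_power2_gt_zero_iff)
  then have "0 < k * ((real_of_int m)^2 + (real_of_int n)^2)" using k(1) by simp
  with k(2)[of m n] show ?thesis by (simp add: Pair)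
qed

text \<open>Away from the origin \<open>(1 + \<bar>m\<bar>) * (1 + \<bar>n\<bar>)\<close> is at most
  \<open>5 * (m^2 + n^2)\<close>, so a product of two convergent one-dimensional series
  dominates.\<close>

lemma summable_on_qform_powr:
  assumes pc: "0 < p" "c^2 < p * q" and s: "2 < s"
  shows "(\<lambda>v. qform p c q v powr (- s / 2)) summable_on (UNIV - {(0, 0)})"
proof -
  obtain k where k: "0 < k" "\<And>m n. k * ((real_of_int m)^2 + (real_of_int n)^2) \<le> qform p c q (m, n)"
    using qform_ge[OF pc] by blast
  let ?g = "\<lambda>m::int. (1 + \<bar>real_of_int m\<bar>) powr (- s / 2)"
  have "?g summable_on UNIV" using summable_on_int_powr[of "s / 2"] s by simp
  then have a: "Infinite_Set_Sum.abs_summable_on ?g UNIV"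
    by (subst (asm) summable_on_iff_abs_summable_on_real) (simp only: abs_summable_equivalent)
  have "Infinite_Set_Sum.abs_summable_on (\<lambda>(m::int, n::int). ?g m * ?g n) (UNIV \<times> UNIV)"
    by (rule abs_summable_on_product[OF _ _ a a]) auto
  then have "(\<lambda>(m::int, n::int). ?g m * ?g n) summable_on UNIV"
    by (subst summable_on_iff_abs_summable_on_real) (simp only: abs_summable_equivalent UNIV_Times_UNIV)
  then have "(\<lambda>v. (k / 5) powr (- s / 2) * (case v of (m, n) \<Rightarrow> ?g m * ?g n)) summable_on (UNIV - {(0, 0)})"
    by (intro summable_on_cmult_right) (rule summable_on_subset_banach, auto)
  then show ?thesis
  proof (rule summable_on_comparison_test)
    fix v :: "int \<times> int" assume v: "v \<in> UNIV - {(0, 0)}"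
    obtain m n where mn: "v = (m, n)" by (cases v)
    define x y where "x = \<bar>real_of_int m\<bar>" and "y = \<bar>real_of_int n\<bar>"
    have "1 \<le> \<bar>m\<bar> + \<bar>n\<bar>" using v by (auto simp: mn)
    then have xy: "0 \<le> x" "0 \<le> y" "1 \<le> x + y" by (simp_all add: x_def y_def)
    have "x \<le> x^2" "y \<le> y^2" using abs_le_square_int[of m] abs_le_square_int[of n] by (simp_all add: x_def y_def)
    moreover have "2 * (x * y) \<le> x^2 + y^2" using sum_squares_bound[of x y] by simp
    ultimately have "(1 + x) * (1 + y) \<le> 5 * (x^2 + y^2)"
      using xy by (simp add: algebra_simps)
    then have "k / 5 * ((1 + x) * (1 + y)) \<le> k / 5 * (5 * (x^2 + y^2))" using k(1) by (intro mult_left_mono) auto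
    also have "\<dots> = k * (x^2 + y^2)" by simp
    also have "\<dots> \<le> qform p c q v" using k(2)[of m n] by (simp add: mn x_def y_def)
    finally have le: "k / 5 * ((1 + x) * (1 + y)) \<le> qform p c q v" .
    have "qform p c q v powr (- s / 2) \<le> (k / 5 * ((1 + x) * (1 + y))) powr (- s / 2)"
      using s k(1) xy by (intro powr_mono2' le) auto
    also have "\<dots> = (k / 5) powr (- s / 2) * ((1 + x) powr (- s / 2) * (1 + y) powr (- s / 2))"
    proof -
      have pm: "(z * w) powr e = z powr e * w powr e" if "0 \<le> z" "0 \<le> w" for z w e :: real
        using that by (simp add: powr_mult)
      have "0 \<le> k / 5" "0 \<le> 1 + x" "0 \<le> 1 + y" "0 \<le> (1 + x) * (1 + y)" using k(1) xy by auto
      then show ?thesis by (simp only: pm)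
    qed
    finally show "qform p c q v powr (- s / 2) \<le> (k / 5) powr (- s / 2) * (case v of (m, n) \<Rightarrow> ?g m * ?g n)"
      by (simp add: mn x_def y_def)
  qed simp
qed

section \<open>Mellin transforms of theta functions\<close>

lemma nn_integral_Gamma_exp:
  assumes \<sigma>: "0 < \<sigma>" and \<kappa>: "0 < \<kappa>"
  shows "(\<integral>\<^sup>+u. ennreal (exp (- \<kappa> * exp u) * exp (u * \<sigma>)) \<partial>lborel) = ennreal (Gamma \<sigma> * \<kappa> powr (- \<sigma>))"
proof -
  define f where "f t = t powr (\<sigma> - 1) / exp t" for t :: real
  have "(f has_integral Gamma \<sigma>) {0..}" unfolding f_def by (rule Gamma_integral_real[OF \<sigma>])
  then have "(f has_integral Gamma \<sigma>) {0<..}"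
    by (subst (asm) has_integral_spike_set_eq[of _ "{0<..}"]) (auto intro: negligible_subset[of "{0}"])
  moreover then have "f absolutely_integrable_on {0<..}"
    by (intro nonnegative_absolutely_integrable_1) (auto simp: f_def integrable_on_def)
  ultimately have "f absolutely_integrable_on {0<..} \<and> integral {0<..} f = Gamma \<sigma>"
    by (auto simp: integral_unique)
  moreover have "range (\<lambda>u. \<kappa> * exp u) = {0<..}"
  proof -
    have "x \<in> range (\<lambda>u. \<kappa> * exp u)" if "0 < x" for x
      using that \<kappa> by (intro range_eqI[of _ _ "ln (x / \<kappa>)"]) simp
    then show ?thesis using \<kappa> by auto
  qed
  ultimately have "(\<lambda>u. \<bar>\<kappa> * exp u\<bar> *\<^sub>R f (\<kappa> * exp u)) absolutely_integrable_on UNIV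
      \<and> integral UNIV (\<lambda>u. \<bar>\<kappa> * exp u\<bar> *\<^sub>R f (\<kappa> * exp u)) = Gamma \<sigma>"
    using \<kappa> by (subst has_absolute_integral_change_of_variables_real)
      (auto intro!: derivative_eq_intros simp: inj_on_def)
  moreover have "\<bar>\<kappa> * exp u\<bar> *\<^sub>R f (\<kappa> * exp u) = \<kappa> powr \<sigma> * (exp (- \<kappa> * exp u) * exp (u * \<sigma>))" for u
  proof -
    have "\<kappa> * exp u * (\<kappa> * exp u) powr (\<sigma> - 1) = (\<kappa> * exp u) powr \<sigma>"
      using \<kappa> by (simp add: powr_mult_base)
    also have "\<dots> = \<kappa> powr \<sigma> * exp (u * \<sigma>)" using \<kappa> by (simp add: powr_mult exp_powr_real)
    finally show ?thesis using \<kappa> by (simp add: f_def exp_minus field_simps)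
  qed
  ultimately have abs: "(\<lambda>u. \<kappa> powr \<sigma> * (exp (- \<kappa> * exp u) * exp (u * \<sigma>))) absolutely_integrable_on UNIV"
    and int: "integral UNIV (\<lambda>u. \<kappa> powr \<sigma> * (exp (- \<kappa> * exp u) * exp (u * \<sigma>))) = Gamma \<sigma>"
    by (simp_all only:)
  have "((\<lambda>u. \<kappa> powr \<sigma> * (exp (- \<kappa> * exp u) * exp (u * \<sigma>))) has_integral Gamma \<sigma>) UNIV"
    using integrable_integral[OF set_lebesgue_integral_eq_integral(1)[OF abs]] unfolding int .
  then have scaled: "((\<lambda>u. \<kappa> powr (- \<sigma>) * (\<kappa> powr \<sigma> * (exp (- \<kappa> * exp u) * exp (u * \<sigma>)))) has_integral \<kappa> powr (- \<sigma>) * Gamma \<sigma>) UNIV"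
    by (rule has_integral_mult_right)
  have "((\<lambda>u. exp (- \<kappa> * exp u) * exp (u * \<sigma>)) has_integral Gamma \<sigma> * \<kappa> powr (- \<sigma>)) UNIV"
  proof -
    have "\<kappa> powr (- \<sigma>) * (\<kappa> powr \<sigma> * X) = X" for X using \<kappa> by (simp add: powr_minus)
    then show ?thesis using scaled by (simp only: mult.commute[of "Gamma \<sigma>"])
  qed
  from nn_integral_has_integral_lebesgue[OF _ this] show ?thesis by simp
qed

lemma nn_integral_count_space_infsum:
  fixes f :: "'a \<Rightarrow> real"
  assumes "f summable_on A" "\<And>x. 0 \<le> f x"
  shows "(\<integral>\<^sup>+x. ennreal (f x) \<partial>count_space A) = ennreal (infsum f A)"
proof -
  have "Infinite_Set_Sum.abs_summable_on f A"
    using assms(1) by (subst (asm) summable_on_iff_abs_summable_on_real) (simp only: abs_summable_equivalent)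
  then show ?thesis using assms by (simp add: nn_integral_conv_infsetsum infsetsum_infsum)
qed

text \<open>The constant term of \<open>theta\<close> is left out because its Mellin integral
  diverges. The logarithmic variable \<open>u\<close> runs over the whole line and turns inversion
  of \<open>y\<close> into the reflection of \<open>u\<close>.\<close>

definition theta0 :: "real \<Rightarrow> real \<Rightarrow> real \<Rightarrow> real \<Rightarrow> real" where
  "theta0 p c q u = (\<Sum>\<^sub>\<infinity>v\<in>UNIV - {(0, 0)}. exp (- (pi * exp u) * qform p c q v))"

lemma theta_eq_theta0:
  assumes "0 < p" "c^2 < p * q"
  shows "theta p c q (exp u) = 1 + theta0 p c q u"
proof -
  have s: "(\<lambda>v. exp (- (pi * exp u) * qform p c q v)) summable_on A" for A
    by (rule summable_on_subset_banach[OF summable_on_exp_qform[OF assms]]) auto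
  have "theta p c q (exp u) = infsum (\<lambda>v. exp (- (pi * exp u) * qform p c q v)) (insert (0, 0) (UNIV - {(0, 0)}))"
    by (simp add: theta_def insert_absorb)
  also have "\<dots> = 1 + theta0 p c q u"
    unfolding theta0_def by (subst infsum_insert[OF s]) (auto simp: qform_def)
  finally show ?thesis .
qed

text \<open>Tonelli for nonnegative functions, with the sum read as an integral over counting
  measure. It gives integrability together with the value, each summand being a Gamma
  integral.\<close>

lemma mellin_theta:
  assumes pc: "0 < p" "c^2 < p * q" and s: "2 < s"
  shows "integrable lborel (\<lambda>u. theta0 p c q u * exp (u * (s / 2)))"
    and "(\<integral>u. theta0 p c q u * exp (u * (s / 2)) \<partial>lborel) = Gamma (s / 2) * pi powr (- s / 2) * zform p c q s"
proof -
  let ?A = "UNIV - {(0, 0)} :: (int \<times> int) set"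
  let ?f = "\<lambda>v u. exp (- (pi * exp u) * qform p c q v)"
  have fs: "(\<lambda>v. ?f v u) summable_on ?A" for u
    by (rule summable_on_subset_banach[OF summable_on_exp_qform[OF pc]]) auto
  have nonneg: "0 \<le> theta0 p c q u" for u unfolding theta0_def by (rule infsum_nonneg) simp
  \<comment> \<open>Monotonicity in \<open>u\<close> yields measurability of the infinite
    sum.\<close>
  have "mono (\<lambda>u. - theta0 p c q u)"
  proof (rule monoI)
    fix u u' :: real assume "u \<le> u'"
    have "theta0 p c q u' \<le> theta0 p c q u"
      unfolding theta0_def
    proof (rule infsum_mono[OF fs fs])
      fix v assume "v \<in> ?A"
      then have "0 < qform p c q v" by (intro qform_pos[OF pc]) auto
      then have "pi * exp u * qform p c q v \<le> pi * exp u' * qform p c q v"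
        using \<open>u \<le> u'\<close> by (intro mult_right_mono mult_left_mono) auto
      then show "?f v u' \<le> ?f v u" by simp
    qed
    then show "- theta0 p c q u \<le> - theta0 p c q u'" by simp
  qed
  from borel_measurable_mono[OF this] have "(\<lambda>u. - (- theta0 p c q u)) \<in> borel_measurable borel"
    by (rule borel_measurable_uminus)
  then have meas[measurable]: "theta0 p c q \<in> borel_measurable borel" by simp
  have "(\<integral>\<^sup>+u. ennreal (theta0 p c q u * exp (u * (s / 2))) \<partial>lborel)
      = (\<integral>\<^sup>+u. (\<integral>\<^sup>+v. ennreal (?f v u * exp (u * (s / 2))) \<partial>count_space ?A) \<partial>lborel)"
  proof (rule nn_integral_cong)
    fix u :: real
    have "theta0 p c q u * exp (u * (s / 2)) = infsum (\<lambda>v. ?f v u * exp (u * (s / 2))) ?A"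
      by (simp only: theta0_def infsum_cmult_left')
    then show "ennreal (theta0 p c q u * exp (u * (s / 2))) = (\<integral>\<^sup>+v. ennreal (?f v u * exp (u * (s / 2))) \<partial>count_space ?A)"
      by (simp only:) (rule nn_integral_count_space_infsum[symmetric], auto intro!: summable_on_cmult_left fs[simplified] simp del: minus_mult_left)
  qed
  also have "\<dots> = (\<integral>\<^sup>+v. (\<integral>\<^sup>+u. ennreal (?f v u * exp (u * (s / 2))) \<partial>lborel) \<partial>count_space ?A)"
    by (rule nn_integral_count_space_nn_integral) auto
  also have "\<dots> = (\<integral>\<^sup>+v. ennreal (Gamma (s / 2) * pi powr (- s / 2) * qform p c q v powr (- s / 2)) \<partial>count_space ?A)"
  proof (rule nn_integral_cong)
    fix v assume "v \<in> space (count_space ?A)"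
    then have q: "0 < qform p c q v" by (intro qform_pos[OF pc]) auto
    have "(\<integral>\<^sup>+u. ennreal (?f v u * exp (u * (s / 2))) \<partial>lborel) = (\<integral>\<^sup>+u. ennreal (exp (- (pi * qform p c q v) * exp u) * exp (u * (s / 2))) \<partial>lborel)"
      by (simp add: mult_ac)
    also have "\<dots> = ennreal (Gamma (s / 2) * (pi * qform p c q v) powr (- (s / 2)))"
      by (rule nn_integral_Gamma_exp) (use s q in auto)
    finally show "(\<integral>\<^sup>+u. ennreal (?f v u * exp (u * (s / 2))) \<partial>lborel) = ennreal (Gamma (s / 2) * pi powr (- s / 2) * qform p c q v powr (- s / 2))"
      using q by (simp add: powr_mult mult.assoc)
  qed
  also have "\<dots> = ennreal (infsum (\<lambda>v. Gamma (s / 2) * pi powr (- s / 2) * qform p c q v powr (- s / 2)) ?A)"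
    using s by (intro nn_integral_count_space_infsum summable_on_cmult_right summable_on_qform_powr[OF pc]) (auto intro!: mult_nonneg_nonneg less_imp_le[OF Gamma_real_pos])
  also have "infsum (\<lambda>v. Gamma (s / 2) * pi powr (- s / 2) * qform p c q v powr (- s / 2)) ?A = Gamma (s / 2) * pi powr (- s / 2) * zform p c q s"
    by (simp only: zform_def infsum_cmult_right')
  finally have eq: "(\<integral>\<^sup>+u. ennreal (theta0 p c q u * exp (u * (s / 2))) \<partial>lborel) = ennreal (Gamma (s / 2) * pi powr (- s / 2) * zform p c q s)" .
  have z: "0 \<le> Gamma (s / 2) * pi powr (- s / 2) * zform p c q s"
    using s by (auto simp: zform_def intro!: mult_nonneg_nonneg infsum_nonneg less_imp_le[OF Gamma_real_pos])
  show "integrable lborel (\<lambda>u. theta0 p c q u * exp (u * (s / 2)))"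
    by (rule integrableI_nonneg) (use nonneg eq in auto)
  show "(\<integral>u. theta0 p c q u * exp (u * (s / 2)) \<partial>lborel) = Gamma (s / 2) * pi powr (- s / 2) * zform p c q s"
    by (rule integral_eq_nn_integral[THEN trans]) (use nonneg eq z in auto)
qed

lemma zform_scale:
  assumes "0 < k" "0 < p" "c^2 < p * q"
  shows "zform (k * p) (k * c) (k * q) t = k powr (- t / 2) * zform p c q t"
proof -
  have "zform (k * p) (k * c) (k * q) t = infsum (\<lambda>v. k powr (- t / 2) * qform p c q v powr (- t / 2)) (UNIV - {(0, 0)})"
    unfolding zform_def
  proof (rule infsum_cong)
    fix v :: "int \<times> int" assume "v \<in> UNIV - {(0, 0)}"
    then have "0 < qform p c q v" by (intro qform_pos assms) auto
    then show "qform (k * p) (k * c) (k * q) v powr (- t / 2) = k powr (- t / 2) * qform p c q v powr (- t / 2)"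
      using assms(1) by (simp add: qform_scale powr_mult)
  qed
  then show ?thesis by (simp only: zform_def infsum_cmult_right')
qed

lemma hex_form: "0 < hex" "(hex / 2)^2 < hex * hex" "hex * hex - (hex / 2)^2 = 1"
  using hex_pos hex_sq by (auto simp: power2_eq_square)

text \<open>The archimedean factor that completes the Epstein zeta function.\<close>

definition gfac :: "real \<Rightarrow> real" where "gfac t = Gamma (t / 2) * pi powr (- t / 2)"

lemma gfac_pos: "0 < t \<Longrightarrow> 0 < gfac t"
  by (simp add: gfac_def Gamma_real_pos)

text \<open>The functional equation turns the Mellin integral of the difference of two theta functions
  into one against the kernel \<open>exp (u t / 2) + exp (u (1 - t / 2))\<close>, which increases in \<open>t\<close>.\<close>

lemma (in reduced_form) zform_compare:
  fixes s \<alpha> :: real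
  assumes s: "2 < s" and s\<alpha>: "s < \<alpha>"
  defines "\<Delta> t \<equiv> zform (hex * P) (hex * C) (hex * Q) t - zform hex (hex / 2) hex t"
  shows "0 \<le> \<Delta> s" and "gfac s * \<Delta> s \<le> gfac \<alpha> * \<Delta> \<alpha>" and "tau \<noteq> 0 \<Longrightarrow> 0 < \<Delta> s"
proof -
  have f: "0 < hex * P" "hex * P * (hex * Q) - (hex * C)^2 = 1"
  proof -
    have "hex * P * (hex * Q) - (hex * C)^2 = hex^2 * (P * Q - C^2)" by (simp add: power2_eq_square algebra_simps)
    then show "hex * P * (hex * Q) - (hex * C)^2 = 1" using disc by (simp add: hex_sq)
  qed (use hex_pos P_pos in simp)
  then have f': "(hex * C)^2 < hex * P * (hex * Q)" by simp
  define D where "D u = theta0 (hex * P) (hex * C) (hex * Q) u - theta0 hex (hex / 2) hex u" for u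
  have D_theta: "D u = theta (hex * P) (hex * C) (hex * Q) (exp u) - theta hex (hex / 2) hex (exp u)" for u
    by (simp add: D_def theta_eq_theta0[OF f(1) f'] theta_eq_theta0[OF hex_form(1,2)])
  \<comment> \<open>The constant terms cancel in the difference of the two theta functions, so the
    functional equation of \<open>D\<close> has no extra terms.\<close>
  have D_refl: "D (- u) = exp u * D u" for u
    using theta_functional_equation[OF f, of "exp u"] theta_functional_equation[OF hex_form(1,3), of "exp u"]
    by (simp add: D_theta exp_minus inverse_eq_divide right_diff_distrib)
  have Dpos: "0 \<le> D u" "tau \<noteq> 0 \<Longrightarrow> 0 < D u" for u
  proof -
    have *: "0 \<le> D u \<and> (tau \<noteq> 0 \<longrightarrow> 0 < D u)" if "0 \<le> u" for u
      using theta_hex_le[of "exp u"] that by (auto simp: D_theta)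
    have "0 \<le> D u \<and> (tau \<noteq> 0 \<longrightarrow> 0 < D u)"
    proof (cases "0 \<le> u")
      case False
      then show ?thesis using *[of "- u"] D_refl[of u] by (simp add: zero_le_mult_iff zero_less_mult_iff)
    qed (rule *)
    then show "0 \<le> D u" "tau \<noteq> 0 \<Longrightarrow> 0 < D u" by auto
  qed
  have I: "integrable lborel (\<lambda>u. D u * exp (u * (t / 2)))"
    "(\<integral>u. D u * exp (u * (t / 2)) \<partial>lborel) = gfac t * \<Delta> t" if t: "2 < t" for t
    unfolding D_def left_diff_distrib
    using mellin_theta[OF f(1) f' t] mellin_theta[OF hex_form(1,2) t]
    by (simp_all add: \<Delta>_def gfac_def right_diff_distrib)
  have I': "integrable lborel (\<lambda>u. D u * exp (u * (1 - t / 2)))"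
    "(\<integral>u. D u * exp (u * (1 - t / 2)) \<partial>lborel) = gfac t * \<Delta> t" if t: "2 < t" for t
  proof -
    have eq: "D (0 + - 1 * u) * exp ((0 + - 1 * u) * (t / 2)) = D u * exp (u * (1 - t / 2))" for u
      by (simp add: D_refl exp_add[symmetric] algebra_simps)
    show "integrable lborel (\<lambda>u. D u * exp (u * (1 - t / 2)))"
      using lborel_integrable_real_affine[OF I(1)[OF t], of "- 1" 0] unfolding eq by simp
    show "(\<integral>u. D u * exp (u * (1 - t / 2)) \<partial>lborel) = gfac t * \<Delta> t"
      using lborel_integral_real_affine[of "- 1" "\<lambda>u. D u * exp (u * (t / 2))" 0] I(2)[OF t]
      unfolding eq by simp
  qed
  have \<alpha>: "2 < \<alpha>" using s s\<alpha> by simp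
  have int: "0 \<le> (\<integral>u. D u * exp (u * (s / 2)) \<partial>lborel)"
    by (rule integral_nonneg_AE) (use Dpos in auto)
  have gs: "0 < gfac s" using s by (intro gfac_pos) simp
  show "0 \<le> \<Delta> s" using int gs unfolding I(2)[OF s] by (simp add: zero_le_mult_iff)
  show "0 < \<Delta> s" if "tau \<noteq> 0"
  proof (rule ccontr)
    assume "\<not> 0 < \<Delta> s"
    with \<open>0 \<le> \<Delta> s\<close> have "\<Delta> s = 0" by simp
    then have "(\<integral>u. D u * exp (u * (s / 2)) \<partial>lborel) = 0" unfolding I(2)[OF s] by simp
    then have "AE u in lborel. D u * exp (u * (s / 2)) = 0"
      by (subst (asm) integral_nonneg_eq_0_iff_AE[OF I(1)[OF s]]) (use Dpos in auto)
    then have "AE u in (lborel :: real measure). False"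
      by (rule AE_mp) (use Dpos(2)[OF that] in \<open>auto intro!: AE_I2 simp: less_le\<close>)
    then show False by (subst (asm) AE_iff_measurable[of UNIV]) auto
  qed
  have "2 * (gfac s * \<Delta> s) = (\<integral>u. D u * exp (u * (s / 2)) + D u * exp (u * (1 - s / 2)) \<partial>lborel)"
    using Bochner_Integration.integral_add[OF I(1)[OF s] I'(1)[OF s]] unfolding I(2)[OF s] I'(2)[OF s] by linarith
  also have "\<dots> \<le> (\<integral>u. D u * exp (u * (\<alpha> / 2)) + D u * exp (u * (1 - \<alpha> / 2)) \<partial>lborel)"
  proof (rule integral_mono)
    show "integrable lborel (\<lambda>u. D u * exp (u * (s / 2)) + D u * exp (u * (1 - s / 2)))"
      by (intro Bochner_Integration.integrable_add I I' s)
    show "integrable lborel (\<lambda>u. D u * exp (u * (\<alpha> / 2)) + D u * exp (u * (1 - \<alpha> / 2)))"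
      by (intro Bochner_Integration.integrable_add I I' \<alpha>)
    fix u
    define a b where "a = s / 2" and "b = \<alpha> / 2"
    have ab: "1 < a" "a < b" using s s\<alpha> by (simp_all add: a_def b_def)
    \<comment> \<open>The increase of the symmetrized kernel factors. As \<open>a < b\<close> and
      \<open>a + b > 1\<close>, both factors are nonnegative for nonnegative \<open>u\<close> and
      nonpositive for negative \<open>u\<close>.\<close>
    have "(exp (u * b) - exp (u * a)) * (1 - exp (u * (1 - a - b)))
        = exp (u * b) + exp (u * (1 - b)) - exp (u * a) - exp (u * (1 - a))"
      by (simp add: algebra_simps exp_add[symmetric] exp_diff field_simps)
    moreover have "0 \<le> (exp (u * b) - exp (u * a)) * (1 - exp (u * (1 - a - b)))"
    proof (cases "0 \<le> u")
      case True
      then have "u * a \<le> u * b" "u * (1 - a - b) \<le> 0" using ab by (auto intro!: mult_left_mono mult_nonneg_nonpos)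
      then show ?thesis by (intro mult_nonneg_nonneg) auto
    next
      case False
      then have "u * b \<le> u * a" "0 \<le> u * (1 - a - b)" using ab by (auto intro!: mult_left_mono_neg mult_nonpos_nonpos)
      then show ?thesis by (intro mult_nonpos_nonpos) auto
    qed
    ultimately have "exp (u * a) + exp (u * (1 - a)) \<le> exp (u * b) + exp (u * (1 - b))" by linarith
    then have "D u * (exp (u * a) + exp (u * (1 - a))) \<le> D u * (exp (u * b) + exp (u * (1 - b)))"
      by (intro mult_left_mono Dpos)
    then show "D u * exp (u * (s / 2)) + D u * exp (u * (1 - s / 2)) \<le> D u * exp (u * (\<alpha> / 2)) + D u * exp (u * (1 - \<alpha> / 2))"
      by (simp add: a_def b_def distrib_left)
  qed
  also have "\<dots> = 2 * (gfac \<alpha> * \<Delta> \<alpha>)"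
    using Bochner_Integration.integral_add[OF I(1)[OF \<alpha>] I'(1)[OF \<alpha>]] unfolding I(2)[OF \<alpha>] I'(2)[OF \<alpha>] by linarith
  finally show "gfac s * \<Delta> s \<le> gfac \<alpha> * \<Delta> \<alpha>" by simp
qed

section \<open>The planar energy and its hexagonal minimizers\<close>

lemma Hfun_gfac: "Hfun t = gfac t * t / 2" by (simp add: Hfun_def gfac_def)

text \<open>The energy of a form for the potential with weights \<open>s\<close> and \<alpha>, whose
  minimum lies at squared norm 1.\<close>

definition enform :: "real \<Rightarrow> real \<Rightarrow> real \<Rightarrow> real \<Rightarrow> real \<Rightarrow> real" where
  "enform \<alpha> s p c q = s * zform p c q \<alpha> - \<alpha> * zform p c q s"

text \<open>The hypothesis on \<open>Hfun\<close> says
  \<open>\<alpha> * gfac \<alpha> < s * gfac s\<close>. Together with the growth of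
  \<open>gfac t * \<Delta> t\<close> it gives
  \<open>\<alpha> * \<Delta> s \<le> s * \<Delta> \<alpha>\<close>. Scaling by \<open>k\<close>
  multiplies the two sides by different powers, and \<open>k \<le> 1\<close> puts the larger factor
  on the right-hand side.\<close>

lemma (in reduced_form) enform_hex_le:
  assumes s: "2 < s" and s\<alpha>: "s < \<alpha>" and H: "Hfun \<alpha> < Hfun s" and k: "0 < k" "k \<le> 1"
  shows "enform \<alpha> s (k * hex) (k * (hex / 2)) (k * hex) \<le> enform \<alpha> s (k * (hex * P)) (k * (hex * C)) (k * (hex * Q))"
    and "tau \<noteq> 0 \<Longrightarrow> enform \<alpha> s (k * hex) (k * (hex / 2)) (k * hex) < enform \<alpha> s (k * (hex * P)) (k * (hex * C)) (k * (hex * Q))"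
proof -
  define \<Delta> where "\<Delta> t = zform (hex * P) (hex * C) (hex * Q) t - zform hex (hex / 2) hex t" for t
  have cmp: "0 \<le> \<Delta> s" "gfac s * \<Delta> s \<le> gfac \<alpha> * \<Delta> \<alpha>" "tau \<noteq> 0 \<Longrightarrow> 0 < \<Delta> s"
    unfolding \<Delta>_def using zform_compare[OF s s\<alpha>] by auto
  have g: "0 < gfac s" "0 < gfac \<alpha>" using s s\<alpha> by (auto intro: gfac_pos)
  have g2: "\<alpha> * gfac \<alpha> < s * gfac s" using H by (simp add: Hfun_gfac mult.commute)
  have 1: "\<alpha> * gfac \<alpha> * \<Delta> s \<le> s * gfac s * \<Delta> s" using cmp(1) g2 by (intro mult_right_mono) auto
  have 2: "s * (gfac s * \<Delta> s) \<le> s * (gfac \<alpha> * \<Delta> \<alpha>)" using cmp(2) s by (intro mult_left_mono) auto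
  have "gfac \<alpha> * (\<alpha> * \<Delta> s) \<le> gfac \<alpha> * (s * \<Delta> \<alpha>)" using 1 2 by (simp add: mult_ac)
  then have le: "\<alpha> * \<Delta> s \<le> s * \<Delta> \<alpha>" using g by simp
  have less: "\<alpha> * \<Delta> s < s * \<Delta> \<alpha>" if "tau \<noteq> 0"
  proof -
    have "\<alpha> * gfac \<alpha> * \<Delta> s < s * gfac s * \<Delta> s" using cmp(3)[OF that] g2 by (intro mult_strict_right_mono) auto
    with 2 have "gfac \<alpha> * (\<alpha> * \<Delta> s) < gfac \<alpha> * (s * \<Delta> \<alpha>)" by (simp add: mult_ac)
    then show ?thesis using g by simp
  qed
  have f: "0 < hex * P" "(hex * C)^2 < hex * P * (hex * Q)"
  proof -
    have "hex * P * (hex * Q) - (hex * C)^2 = hex^2 * (P * Q - C^2)" by (simp add: power2_eq_square algebra_simps)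
    then show "(hex * C)^2 < hex * P * (hex * Q)" using disc by (simp add: hex_sq)
  qed (use hex_pos P_pos in simp)
  define x y where "x = k powr (- \<alpha> / 2)" and "y = k powr (- s / 2)"
  have xy: "0 < y" "y \<le> x"
    using k s\<alpha> powr_mono'[of "- \<alpha> / 2" "- s / 2" k] by (auto simp: x_def y_def)
  have diff: "enform \<alpha> s (k * (hex * P)) (k * (hex * C)) (k * (hex * Q)) - enform \<alpha> s (k * hex) (k * (hex / 2)) (k * hex)
      = x * (s * \<Delta> \<alpha>) - y * (\<alpha> * \<Delta> s)"
    unfolding enform_def zform_scale[OF k(1) f] zform_scale[OF k(1) hex_form(1,2)]
    by (simp add: \<Delta>_def x_def y_def algebra_simps)
  have "0 \<le> s * \<Delta> \<alpha>" using le cmp(1) s s\<alpha> by (meson less_trans mult_nonneg_nonneg order_trans less_imp_le zero_less_numeral)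
  then have ge: "y * (s * \<Delta> \<alpha>) \<le> x * (s * \<Delta> \<alpha>)" using xy by (intro mult_right_mono) auto
  moreover have "y * (\<alpha> * \<Delta> s) \<le> y * (s * \<Delta> \<alpha>)" using le xy by simp
  ultimately show "enform \<alpha> s (k * hex) (k * (hex / 2)) (k * hex) \<le> enform \<alpha> s (k * (hex * P)) (k * (hex * C)) (k * (hex * Q))"
    using diff by linarith
  show "enform \<alpha> s (k * hex) (k * (hex / 2)) (k * hex) < enform \<alpha> s (k * (hex * P)) (k * (hex * C)) (k * (hex * Q))"
    if "tau \<noteq> 0"
  proof -
    have "y * (\<alpha> * \<Delta> s) < y * (s * \<Delta> \<alpha>)" using less[OF that] xy by simp
    with ge diff show ?thesis by linarith
  qed
qed

text \<open>The variable is a squared norm, whence the halved exponents. The two terms of the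
  derivative have equal weight, so its sign is that of \<open>x - 1\<close>.\<close>

lemma phi_strict_mono:
  fixes s \<alpha> x y :: real
  assumes s: "0 < s" "s < \<alpha>" and xy: "1 \<le> x" "x < y"
  shows "s * x powr (- \<alpha> / 2) - \<alpha> * x powr (- s / 2) < s * y powr (- \<alpha> / 2) - \<alpha> * y powr (- s / 2)"
proof -
  define f where "f x = s * x powr (- \<alpha> / 2) - \<alpha> * x powr (- s / 2)" for x :: real
  define f' where "f' x = s * \<alpha> / 2 * (x powr (- s / 2 - 1) - x powr (- \<alpha> / 2 - 1))" for x :: real
  have "(f has_real_derivative f' u) (at u)" if "x \<le> u" for u
  proof -
    have "0 < u" using that xy by simp
    then show ?thesis unfolding f_def[abs_def] f'_def
      by (auto intro!: derivative_eq_intros simp: field_simps)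
  qed
  then obtain z where z: "x < z" "f y - f x = (y - x) * f' z"
    using MVT2[OF xy(2), of f f'] by blast
  have "z powr (- \<alpha> / 2 - 1) < z powr (- s / 2 - 1)"
    using z(1) xy s by (intro powr_less_mono) auto
  then have "0 < f' z" using s by (simp add: f'_def)
  with z(2) xy have "0 < f y - f x" by simp
  then show ?thesis by (simp add: f_def)
qed

lemma enform_infsum:
  assumes pc: "0 < p" "c^2 < p * q" and s: "2 < s" "s < \<alpha>"
  shows "((\<lambda>v. s * qform p c q v powr (- \<alpha> / 2) - \<alpha> * qform p c q v powr (- s / 2)) has_sum enform \<alpha> s p c q) (UNIV - {(0, 0)})"
proof -
  have "((\<lambda>v. s * qform p c q v powr (- \<alpha> / 2) + - (\<alpha> * qform p c q v powr (- s / 2))) has_sum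
      s * zform p c q \<alpha> + - (\<alpha> * zform p c q s)) (UNIV - {(0, 0)})"
    unfolding zform_def using s
    by (intro has_sum_add has_sum_cmult_right has_sum_uminusI has_sum_infsum summable_on_qform_powr[OF pc]) auto
  then show ?thesis by (simp add: enform_def)
qed

text \<open>A form of large determinant is contracted, keeping every value that changes above the
  minimum point 1 of the potential.\<close>

lemma enform_contract:
  assumes red: "0 \<le> c" "2 * c \<le> p" "p \<le> q" and p: "0 < p" and det: "1 < p * q - c^2"
    and s: "2 < s" "s < \<alpha>"
  obtains p' c' where "0 < p'" "0 \<le> c'" "2 * c' \<le> p'" "p' \<le> 1" "0 < p' - c'^2"
    "enform \<alpha> s p' c' 1 < enform \<alpha> s p c q"
proof -
  define x where "x = c / p"
  \<comment> \<open>The new form has coefficients \<open>p'\<close>, \<open>c'\<close>, 1. Keeping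
    the ratio \<open>c / p\<close> makes the difference of the two forms a combination of two
    squares with nonnegative coefficients, and the determinant becomes at most 1.\<close>
  define p' where "p' = min p 1"
  define c' where "c' = p' * x"
  have x: "0 \<le> x" "x \<le> 1/2" using red p by (simp_all add: x_def field_simps)
  have cx: "c = p * x" using p by (simp add: x_def)
  have p': "0 < p'" "p' \<le> 1" "p' \<le> p" using p by (simp_all add: p'_def)
  have x2: "x^2 \<le> 1/4" using power_mono[OF x(2,1), of 2] by (simp add: power_divide)
  have c'0: "0 \<le> c'" using p' x by (simp add: c'_def)
  have c'2: "2 * c' \<le> p'" using p' x mult_left_mono[of "2 * x" 1 p'] by (simp add: c'_def mult_ac)
  have c'sq: "c'^2 < p'"
  proof -
    have "c'^2 = p' * (p' * x^2)" by (simp add: c'_def power2_eq_square)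
    also have "\<dots> \<le> p' * (1 * (1/4))" using p' x2 by (intro mult_left_mono mult_mono) auto
    also have "\<dots> < p'" using p' by simp
    finally show ?thesis .
  qed
  have q: "1 < q"
  proof (rule ccontr)
    assume "\<not> 1 < q"
    then have "p * q \<le> 1 * 1" using red p by (intro mult_mono) auto
    then show False using det zero_le_power2[of c] by linarith
  qed
  have pcq: "c^2 < p * q" using det by simp
  have split: "qform p c q (m, n) = qform p' c' 1 (m, n) + (p - p') * (real_of_int m + x * real_of_int n)^2
      + (q - 1 - (p - p') * x^2) * (real_of_int n)^2" for m n
    by (simp add: qform_def cx c'_def power2_eq_square algebra_simps)
  have coef: "0 \<le> q - 1 - (p - p') * x^2"
  proof (cases "p \<le> 1")
    case True
    then show ?thesis using q by (simp add: p'_def)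
  next
    case False
    then have "(p - 1) * x^2 \<le> (p - 1) * 1" using x2 by (intro mult_left_mono) auto
    also have "(p - 1) * 1 \<le> q - 1" using red by simp
    finally have "0 \<le> q - 1 - (p - 1) * x^2" by (simp only: diff_ge_0_iff_ge)
    then show ?thesis using False by (simp add: p'_def)
  qed
  have le: "qform p' c' 1 v \<le> qform p c q v" for v
    using split[of "fst v" "snd v"] coef p' by (simp add: add_increasing2)
  \<comment> \<open>Only multiples of the first basis vector can have a value below 1, and only if
    \<open>p < 1\<close>, when \<open>p' = p\<close> leaves these values unchanged.\<close>
  have ge1: "1 \<le> qform p' c' 1 v \<or> qform p' c' 1 v = qform p c q v" if v: "v \<noteq> (0, 0)" for v
  proof -
    obtain m n where mn: "v = (m, n)" by (cases v)
    show ?thesis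
    proof (cases "n = 0")
      case True
      then have "m \<noteq> 0" using v mn by simp
      then have "1 \<le> \<bar>real_of_int m\<bar>" by linarith
      then have "1 \<le> (real_of_int m)^2" using abs_le_square_int[of m] by linarith
      then show ?thesis using True by (auto simp: mn qform_def p'_def min_def)
    next
      case n: False
      define M N where "M = \<bar>real_of_int m\<bar>" and "N = \<bar>real_of_int n\<bar>"
      have N: "1 \<le> N" using n by (simp add: N_def)
      have "- (M * N) \<le> 2 * x * (real_of_int m * real_of_int n)"
      proof -
        have "\<bar>2 * x * (real_of_int m * real_of_int n)\<bar> \<le> 1 * (M * N)"
          unfolding abs_mult M_def N_def using x by (intro mult_mono) auto
        then show ?thesis by linarith
      qed
      then have "p' * (M^2 - M * N) \<le> p' * (M^2 + 2 * x * (real_of_int m * real_of_int n))"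
        using p' by (intro mult_left_mono) auto
      moreover have "qform p' c' 1 v = p' * (M^2 + 2 * x * (real_of_int m * real_of_int n)) + N^2"
        by (simp add: mn qform_def c'_def M_def N_def algebra_simps)
      moreover have "1 \<le> p' * (M^2 - M * N) + N^2"
      proof (cases "m = 0")
        case True
        then show ?thesis using N by (simp add: M_def)
      next
        case False
        then have M: "1 \<le> M" by (simp add: M_def)
        show ?thesis
        proof (cases "0 \<le> M^2 - M * N")
          case True
          then show ?thesis using N p' by (simp add: add_increasing)
        next
          case neg: False
          \<comment> \<open>A negative bracket becomes smaller still with coefficient 1 in place of
            \<open>p'\<close>, and \<open>M^2 - M * N + N^2\<close> is at least
            \<open>M * N\<close>.\<close>
          have "1 * (M^2 - M * N) \<le> p' * (M^2 - M * N)"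
            using neg p' by (intro mult_right_mono_neg) auto
          moreover have "1 \<le> M * N" using mult_mono[OF M N] M by simp
          moreover have "0 \<le> (M - N)^2" by simp
          ultimately show ?thesis by (simp add: power2_diff)
        qed
      qed
      ultimately show ?thesis by linarith
    qed
  qed
  let ?f = "\<lambda>r. s * r powr (- \<alpha> / 2) - \<alpha> * r powr (- s / 2)"
  have sp: "0 < s" using s by simp
  have mono: "?f (qform p' c' 1 v) \<le> ?f (qform p c q v)" if "v \<noteq> (0, 0)" for v
  proof (cases "qform p' c' 1 v = qform p c q v")
    case False
    then show ?thesis using ge1[OF that] le[of v] phi_strict_mono[OF sp s(2), of "qform p' c' 1 v" "qform p c q v"] by simp
  qed simp
  have c'q: "c'^2 < p' * 1" using c'sq by simp
  have "enform \<alpha> s p' c' 1 < enform \<alpha> s p c q"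
  \<comment> \<open>The second basis vector supplies strictness: its value drops from
    \<open>q > 1\<close> to exactly 1.\<close>
  proof (rule has_sum_strict_mono[OF enform_infsum[OF p'(1) c'q s] enform_infsum[OF p pcq s], where x = "(0, 1)"])
    show "?f (qform p' c' 1 (0, 1)) < ?f (qform p c q (0, 1))"
      using phi_strict_mono[OF sp s(2), of 1 q] q by (simp add: qform_def)
  qed (use mono in auto)
  with p' c'0 c'2 c'sq that show ?thesis by simp
qed

lemma reduced_form_normalize:
  assumes red: "0 \<le> c" "2 * c \<le> p" "p \<le> q" and p: "0 < p" and det: "0 < p * q - c^2"
  defines "k \<equiv> sqrt (p * q - c^2)"
  shows "reduced_form (p / (k * hex)) (q / (k * hex)) (c / (k * hex))"
proof
  have k: "0 < k" "k^2 = p * q - c^2" using det by (simp_all add: k_def)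
  have kh: "0 < k * hex" using k hex_pos by simp
  show "0 \<le> c / (k * hex)" using red kh by simp
  show "2 * (c / (k * hex)) \<le> p / (k * hex)" "p / (k * hex) \<le> q / (k * hex)"
    using red kh by (simp_all add: divide_right_mono)
  have "p / (k * hex) * (q / (k * hex)) - (c / (k * hex))^2 = (p * q - c^2) / (k^2 * hex^2)"
    by (simp add: power2_eq_square diff_divide_distrib mult_ac)
  also have "\<dots> = 3/4"
  proof -
    have "D / (D * (4/3)) = 3/4" if "0 < D" for D :: real using that by simp
    from this[OF det] show ?thesis unfolding hex_sq k(2) .
  qed
  finally show "p / (k * hex) * (q / (k * hex)) - (c / (k * hex))^2 = 3/4" .
qed

lemma (in reduced_form) hexagonal_if_tau_0:
  assumes "tau = 0" shows "P = 1" "Q = 1" "C = 1/2"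
proof -
  have "(P - 1)^2 + (Q - 1)^2 + (R - 1)^2 = 0" using sum_sq assms by simp
  then have "P - 1 = 0" "Q - 1 = 0" "R - 1 = 0"
    by (auto simp: add_nonneg_eq_0_iff)
  then show "P = 1" "Q = 1" "C = 1/2" unfolding R_def by auto
qed

lemma enform_ge_hex_small_det:
  assumes red: "0 \<le> c" "2 * c \<le> p" "p \<le> q" and p: "0 < p" and det: "0 < p * q - c^2" "p * q - c^2 \<le> 1"
    and s: "2 < s" "s < \<alpha>" and H: "Hfun \<alpha> < Hfun s"
  obtains k where "0 < k" "enform \<alpha> s (k * hex) (k * (hex / 2)) (k * hex) \<le> enform \<alpha> s p c q"
    "enform \<alpha> s p c q \<le> enform \<alpha> s (k * hex) (k * (hex / 2)) (k * hex) \<Longrightarrow> p = k * hex \<and> c = k * (hex / 2) \<and> q = k * hex"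
proof -
  define k where "k = sqrt (p * q - c^2)"
  have k: "0 < k" "k \<le> 1" using det by (simp_all add: k_def)
  define P Q C where "P = p / (k * hex)" and "Q = q / (k * hex)" and "C = c / (k * hex)"
  interpret reduced_form P Q C
    unfolding P_def Q_def C_def k_def by (rule reduced_form_normalize) fact+
  have eqs: "p = k * (hex * P)" "c = k * (hex * C)" "q = k * (hex * Q)"
    using k hex_pos by (simp_all add: P_def Q_def C_def)
  show ?thesis
  proof (rule that[OF k(1)])
    show "enform \<alpha> s (k * hex) (k * (hex / 2)) (k * hex) \<le> enform \<alpha> s p c q"
      unfolding eqs by (rule enform_hex_le(1)[OF s H k])
    assume "enform \<alpha> s p c q \<le> enform \<alpha> s (k * hex) (k * (hex / 2)) (k * hex)"
    then have "tau = 0" using enform_hex_le(2)[OF s H k] unfolding eqs by linarith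
    from hexagonal_if_tau_0[OF this] show "p = k * hex \<and> c = k * (hex / 2) \<and> q = k * hex"
      unfolding eqs by simp
  qed
qed

text \<open>The scale \<open>k\<close> may depend on the form. For determinant above 1 it is taken
  from the contracted form; the energy inequality is then strict, so the equality clause holds
  vacuously.\<close>

lemma enform_ge_hex:
  assumes red: "0 \<le> c" "2 * c \<le> p" "p \<le> q" and p: "0 < p" and det: "0 < p * q - c^2"
    and s: "2 < s" "s < \<alpha>" and H: "Hfun \<alpha> < Hfun s"
  obtains k where "0 < k" "enform \<alpha> s (k * hex) (k * (hex / 2)) (k * hex) \<le> enform \<alpha> s p c q"
    "enform \<alpha> s p c q \<le> enform \<alpha> s (k * hex) (k * (hex / 2)) (k * hex) \<Longrightarrow> p = k * hex \<and> c = k * (hex / 2) \<and> q = k * hex"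
proof (cases "p * q - c^2 \<le> 1")
  case True
  then show ?thesis using enform_ge_hex_small_det[OF red p det _ s H] that by blast
next
  case False
  then have "1 < p * q - c^2" by simp
  from enform_contract[OF red p this s] obtain p' c' where
    *: "0 < p'" "0 \<le> c'" "2 * c' \<le> p'" "p' \<le> 1" "0 < p' - c'^2" "enform \<alpha> s p' c' 1 < enform \<alpha> s p c q"
    by blast
  have "p' * 1 - c'^2 \<le> 1" using *(4) zero_le_power2[of c'] by linarith
  then obtain k where k: "0 < k" "enform \<alpha> s (k * hex) (k * (hex / 2)) (k * hex) \<le> enform \<alpha> s p' c' 1"
    using enform_ge_hex_small_det[OF *(2,3,4,1) _ _ s H] *(5) by auto
  show ?thesis by (rule that[OF k(1)]) (use k(2) *(6) in auto)
qed

section \<open>Planar lattices\<close>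

definition lattice_of :: "real^2 \<Rightarrow> real^2 \<Rightarrow> (real^2) set" where
  "lattice_of u w = range (\<lambda>(m::int, n::int). of_int m *\<^sub>R u + of_int n *\<^sub>R w)"

lemma cols_mult:
  fixes B :: "real^2^2"
  shows "B *v x = x $ 1 *\<^sub>R column 1 B + x $ 2 *\<^sub>R column 2 B"
  by (simp add: vec_eq_iff matrix_vector_mult_def column_def sum_2 mult.commute)

lemma range_matrix_eq_lattice_of:
  fixes B :: "real^2^2"
  shows "range (\<lambda>k::2 \<Rightarrow> int. B *v (\<chi> i. real_of_int (k i))) = lattice_of (column 1 B) (column 2 B)"
proof
  show "range (\<lambda>k::2 \<Rightarrow> int. B *v (\<chi> i. real_of_int (k i))) \<subseteq> lattice_of (column 1 B) (column 2 B)"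
  proof clarify
    fix k :: "2 \<Rightarrow> int"
    show "B *v (\<chi> i. real_of_int (k i)) \<in> lattice_of (column 1 B) (column 2 B)"
      unfolding lattice_of_def by (rule range_eqI[of _ _ "(k 1, k 2)"]) (simp add: cols_mult)
  qed
  show "lattice_of (column 1 B) (column 2 B) \<subseteq> range (\<lambda>k::2 \<Rightarrow> int. B *v (\<chi> i. real_of_int (k i)))"
    unfolding lattice_of_def
  proof clarify
    fix m n :: int
    show "of_int m *\<^sub>R column 1 B + of_int n *\<^sub>R column 2 B \<in> range (\<lambda>k::2 \<Rightarrow> int. B *v (\<chi> i. real_of_int (k i)))"
      by (rule range_eqI[of _ _ "\<lambda>i. if i = 1 then m else n"]) (simp add: cols_mult)
  qed
qed

definition mat_of :: "real^2 \<Rightarrow> real^2 \<Rightarrow> real^2^2" where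
  "mat_of u w = (\<chi> i j. if j = 1 then u $ i else w $ i)"

lemma column_mat_of [simp]: "column 1 (mat_of u w) = u" "column 2 (mat_of u w) = w"
  by (simp_all add: column_def mat_of_def vec_eq_iff)

lemma det_mat_of: "det (mat_of u w) = u $ 1 * w $ 2 - u $ 2 * w $ 1"
  by (simp add: det_2 mat_of_def mult.commute)

lemma gram_det: "det (mat_of u w)^2 = (u \<bullet> u) * (w \<bullet> w) - (u \<bullet> w)^2"
  by (simp add: det_mat_of inner_vec_def sum_2 power2_eq_square algebra_simps)

lemma lattice_iff_lattice_of:
  "lattice L \<longleftrightarrow> (\<exists>u w. det (mat_of u w) \<noteq> 0 \<and> L = lattice_of u w)"
proof
  assume "lattice L"
  then obtain B :: "real^2^2" where B: "invertible B" "L = range (\<lambda>k::2 \<Rightarrow> int. B *v (\<chi> i. real_of_int (k i)))"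
    by (auto simp: lattice_def)
  have "mat_of (column 1 B) (column 2 B) = B"
    by (auto simp: mat_of_def column_def vec_eq_iff forall_2)
  then show "\<exists>u w. det (mat_of u w) \<noteq> 0 \<and> L = lattice_of u w"
    using B by (intro exI[of _ "column 1 B"] exI[of _ "column 2 B"]) (simp add: range_matrix_eq_lattice_of invertible_det_nz)
next
  assume "\<exists>u w. det (mat_of u w) \<noteq> 0 \<and> L = lattice_of u w"
  then obtain u w where "det (mat_of u w) \<noteq> 0" "L = lattice_of u w" by blast
  then show "lattice L" unfolding lattice_def
    using range_matrix_eq_lattice_of[of "mat_of u w"] by (intro exI[of _ "mat_of u w"]) (simp add: invertible_det_nz)
qed

lemma norm_sq_comb:
  fixes u w :: "'a::real_inner"
  shows "(norm (of_int m *\<^sub>R u + of_int n *\<^sub>R w))^2 = qform (u \<bullet> u) (u \<bullet> w) (w \<bullet> w) (m, n)"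
  unfolding power2_norm_eq_inner
  by (simp add: qform_def inner_add_left inner_add_right inner_commute power2_eq_square algebra_simps)

lemma gram_pos:
  assumes "det (mat_of u w) \<noteq> 0"
  shows "0 < u \<bullet> u" "(u \<bullet> w)^2 < (u \<bullet> u) * (w \<bullet> w)"
proof -
  have "0 < det (mat_of u w)^2" using assms by simp
  then show "(u \<bullet> w)^2 < (u \<bullet> u) * (w \<bullet> w)" unfolding gram_det by simp
  have "u \<noteq> 0" using assms by (auto simp: det_mat_of)
  then show "0 < u \<bullet> u" by simp
qed

lemma zeta_lattice_of:
  assumes det: "det (mat_of u w) \<noteq> 0"
  shows "zeta (lattice_of u w) s = zform (u \<bullet> u) (u \<bullet> w) (w \<bullet> w) s"
proof -
  let ?g = "\<lambda>(m::int, n::int). of_int m *\<^sub>R u + of_int n *\<^sub>R w"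
  have nsq: "(norm (?g v))^2 = qform (u \<bullet> u) (u \<bullet> w) (w \<bullet> w) v" for v
    by (cases v) (simp add: norm_sq_comb)
  have g0: "?g v = 0 \<longleftrightarrow> v = (0, 0)" for v
    using qform_pos[OF gram_pos[OF det], of v] nsq[of v] by (cases "v = (0, 0)") auto
  have inj: "inj ?g"
  proof (rule injI)
    fix v v' assume eq: "?g v = ?g v'"
    have "?g (fst v - fst v', snd v - snd v') = ?g v - ?g v'"
      by (simp add: case_prod_unfold algebra_simps)
    then have "?g (fst v - fst v', snd v - snd v') = 0" unfolding eq by (simp only: diff_self)
    then have "(fst v - fst v', snd v - snd v') = (0, 0)" by (rule g0[THEN iffD1])
    then show "v = v'" by (simp add: prod_eq_iff)
  qed
  have gen: "range g - {0} = g ` (UNIV - {z})" if "\<And>v. g v = 0 \<longleftrightarrow> v = z" for g :: "int \<times> int \<Rightarrow> real^2" and z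
    using that by auto
  have "lattice_of u w - {0} = ?g ` (UNIV - {(0, 0)})"
    unfolding lattice_of_def by (rule gen) (rule g0)
  then have "zeta (lattice_of u w) s = infsum ((\<lambda>q. norm q powr (- s)) \<circ> ?g) (UNIV - {(0, 0)})"
    unfolding zeta_def using inj by (simp only: infsum_reindex inj_on_subset[OF inj subset_UNIV])
  also have "\<dots> = zform (u \<bullet> u) (u \<bullet> w) (w \<bullet> w) s"
    unfolding zform_def
  proof (rule infsum_cong)
    fix v :: "int \<times> int" assume "v \<in> UNIV - {(0, 0)}"
    then have "0 < norm (?g v)" using g0 by simp
    then have "((norm (?g v))^2) powr (- s / 2) = norm (?g v) powr (- s)"
      by (simp add: powr_powr flip: powr_numeral)
    then show "((\<lambda>q. norm q powr (- s)) \<circ> ?g) v = qform (u \<bullet> u) (u \<bullet> w) (w \<bullet> w) v powr (- s / 2)"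
      unfolding nsq by simp
  qed
  finally show ?thesis .
qed

lemma lattice_of_change:
  "lattice_of u (w + u) = lattice_of u w" "lattice_of (u + w) w = lattice_of u w"
  "lattice_of w u = lattice_of u w" "lattice_of u (- w) = lattice_of u w"
  "lattice_of u (w - u) = lattice_of u w" "lattice_of (u - w) w = lattice_of u w"
proof -
  have sub: "lattice_of (of_int a *\<^sub>R u + of_int b *\<^sub>R w) (of_int c *\<^sub>R u + of_int d *\<^sub>R w) \<subseteq> lattice_of u w" for a b c d u w
    unfolding lattice_of_def
  proof clarify
    fix m n
    show "of_int m *\<^sub>R (of_int a *\<^sub>R u + of_int b *\<^sub>R w) + of_int n *\<^sub>R (of_int c *\<^sub>R u + of_int d *\<^sub>R w)
        \<in> range (\<lambda>(m::int, n::int). of_int m *\<^sub>R u + of_int n *\<^sub>R w)"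
      by (rule range_eqI[of _ _ "(m * a + n * c, m * b + n * d)"]) (simp add: algebra_simps)
  qed
  show "lattice_of u (w + u) = lattice_of u w"
    using sub[of 1 u 0 w 1 1] sub[of 1 u 0 "w + u" "-1" 1] by (simp add: add.commute)
  show "lattice_of (u + w) w = lattice_of u w"
    using sub[of 1 u 1 w 0 1] sub[of 1 "u + w" "-1" w 0 1] by simp
  show "lattice_of u (w - u) = lattice_of u w"
    using sub[of 1 u 0 w "-1" 1] sub[of 1 u 0 "w - u" 1 1] by simp
  show "lattice_of (u - w) w = lattice_of u w"
    using sub[of 1 u "-1" w 0 1] sub[of 1 "u - w" 1 w 0 1] by simp
  show "lattice_of w u = lattice_of u w"
    using sub[of 0 u 1 w 1 0] sub[of 0 w 1 u 1 0] by simp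
  show "lattice_of u (- w) = lattice_of u w"
    using sub[of 1 u 0 w 0 "-1"] sub[of 1 u 0 "- w" 0 "-1"] by simp
qed

lemma finite_form_le:
  assumes "0 < p" "c^2 < p * q"
  shows "finite {v. qform p c q v \<le> K}"
proof -
  obtain k where k: "0 < k" "\<And>m n. k * ((real_of_int m)^2 + (real_of_int n)^2) \<le> qform p c q (m, n)"
    using qform_ge[OF assms] by blast
  define N where "N = \<lceil>K / k\<rceil>"
  have "{v. qform p c q v \<le> K} \<subseteq> {- N..N} \<times> {- N..N}"
  proof clarify
    fix m n assume "qform p c q (m, n) \<le> K"
    with k(2)[of m n] have "k * ((real_of_int m)^2 + (real_of_int n)^2) \<le> K" by linarith
    then have "(real_of_int m)^2 + (real_of_int n)^2 \<le> K / k" using k(1) by (simp add: field_simps)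
    moreover have "K / k \<le> real_of_int N" by (simp add: N_def)
    ultimately have "\<bar>real_of_int m\<bar> \<le> real_of_int N" "\<bar>real_of_int n\<bar> \<le> real_of_int N"
      using abs_le_square_int[of m] abs_le_square_int[of n] zero_le_power2[of "real_of_int m"] zero_le_power2[of "real_of_int n"]
      by linarith+
    then show "m \<in> {- N..N} \<and> n \<in> {- N..N}" by auto
  qed
  then show ?thesis by (rule finite_subset) simp
qed

text \<open>Lagrange-Gauss reduction without the algorithm: among the bases of \<open>L\<close> one
  with minimal \<open>u \<bullet> u + w \<bullet> w\<close> exists, since only finitely many lattice
  vectors have bounded length. Minimality gives reducedness, up to the sign of \<open>w\<close> and
  the order of the two vectors.\<close>

lemma lattice_reduced_basis:
  assumes "lattice L"
  obtains u w where "det (mat_of u w) \<noteq> 0" "L = lattice_of u w"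
    "0 \<le> u \<bullet> w" "2 * (u \<bullet> w) \<le> u \<bullet> u" "u \<bullet> u \<le> w \<bullet> w"
proof -
  define bases where "bases = {(u, w). det (mat_of u w) \<noteq> 0 \<and> L = lattice_of u w}"
  define f :: "(real^2) \<times> (real^2) \<Rightarrow> real" where "f = (\<lambda>(u, w). u \<bullet> u + w \<bullet> w)"
  obtain u0 w0 where b0: "det (mat_of u0 w0) \<noteq> 0" "L = lattice_of u0 w0"
    using assms unfolding lattice_iff_lattice_of by blast
  let ?K = "f (u0, w0)"
  let ?g = "\<lambda>(m::int, n::int). of_int m *\<^sub>R u0 + of_int n *\<^sub>R w0"
  have "L \<inter> {x. x \<bullet> x \<le> ?K} \<subseteq> ?g ` {v. qform (u0 \<bullet> u0) (u0 \<bullet> w0) (w0 \<bullet> w0) v \<le> ?K}"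
  proof
    fix x assume x: "x \<in> L \<inter> {x. x \<bullet> x \<le> ?K}"
    then obtain m n :: int where "x = of_int m *\<^sub>R u0 + of_int n *\<^sub>R w0"
      unfolding b0(2) lattice_of_def by auto
    then show "x \<in> ?g ` {v. qform (u0 \<bullet> u0) (u0 \<bullet> w0) (w0 \<bullet> w0) v \<le> ?K}"
      using x norm_sq_comb[of m u0 n w0] by (intro image_eqI[of _ _ "(m, n)"]) (simp_all add: power2_norm_eq_inner)
  qed
  then have fin: "finite (L \<inter> {x. x \<bullet> x \<le> ?K})"
    by (rule finite_subset) (intro finite_imageI finite_form_le gram_pos[OF b0(1)])
  have "u \<in> lattice_of u w" "w \<in> lattice_of u w" for u w :: "real^2"
    unfolding lattice_of_def by (rule range_eqI[of _ _ "(1, 0)"], simp) (rule range_eqI[of _ _ "(0, 1)"], simp)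
  then have "{b \<in> bases. f b \<le> ?K} \<subseteq> (L \<inter> {x. x \<bullet> x \<le> ?K}) \<times> (L \<inter> {x. x \<bullet> x \<le> ?K})"
    by (auto simp: bases_def f_def) (smt (verit) inner_ge_zero)+
  then have "finite {b \<in> bases. f b \<le> ?K}" by (rule finite_subset) (intro finite_cartesian_product fin)
  moreover have "(u0, w0) \<in> {b \<in> bases. f b \<le> ?K}" using b0 by (simp add: bases_def)
  ultimately obtain b where b: "is_arg_min f (\<lambda>b. b \<in> {b \<in> bases. f b \<le> ?K}) b"
    using ex_is_arg_min_if_finite by blast
  obtain u w where uw: "b = (u, w)" by (cases b)
  have bas: "det (mat_of u w) \<noteq> 0" "L = lattice_of u w" using b by (auto simp: is_arg_min_def bases_def uw)
  have min: "f (u, w) \<le> f b'" if "b' \<in> bases" for b'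
    using b that unfolding is_arg_min_def uw by (cases b'; cases "f b' \<le> ?K") (auto simp: not_less)
  have minimal: "u \<bullet> u + w \<bullet> w \<le> u' \<bullet> u' + w' \<bullet> w'"
    if "det (mat_of u' w') = det (mat_of u w)" "lattice_of u' w' = lattice_of u w" for u' w'
    using min[of "(u', w')"] that bas by (simp add: bases_def f_def)
  \<comment> \<open>Adding one basis vector to the other, or subtracting it, preserves lattice and
    determinant. Expanding the four inequalities bounds twice the absolute inner product by both
    squared lengths.\<close>
  have "u \<bullet> u + w \<bullet> w \<le> u \<bullet> u + (w + u) \<bullet> (w + u)" "u \<bullet> u + w \<bullet> w \<le> u \<bullet> u + (w - u) \<bullet> (w - u)"
    "u \<bullet> u + w \<bullet> w \<le> (u + w) \<bullet> (u + w) + w \<bullet> w" "u \<bullet> u + w \<bullet> w \<le> (u - w) \<bullet> (u - w) + w \<bullet> w"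
    by (rule minimal; (simp only: lattice_of_change(1,2,5,6) | simp add: det_mat_of algebra_simps))+
  then have ineq: "2 * \<bar>u \<bullet> w\<bar> \<le> u \<bullet> u" "2 * \<bar>u \<bullet> w\<bar> \<le> w \<bullet> w"
    by (auto simp: inner_add_left inner_add_right inner_diff_left inner_diff_right inner_commute[of w u])
  define w' where "w' = (if 0 \<le> u \<bullet> w then w else - w)"
  have w': "det (mat_of u w') \<noteq> 0" "L = lattice_of u w'" "u \<bullet> w' = \<bar>u \<bullet> w\<bar>" "w' \<bullet> w' = w \<bullet> w"
    using bas by (auto simp: w'_def lattice_of_change det_mat_of)
  show ?thesis
  proof (cases "u \<bullet> u \<le> w \<bullet> w")
    case True
    show ?thesis by (rule that[of u w']) (use w' ineq True in auto)
  next
    case False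
    show ?thesis by (rule that[of w' u])
      (use w' ineq False in \<open>auto simp: lattice_of_change inner_commute[of w' u] det_mat_of mult.commute\<close>)
  qed
qed

text \<open>The linear map sending one basis to the other preserves norms, because norms in
  coordinates depend only on the Gram matrix.\<close>

lemma congruent_lat_if_gram_eq:
  assumes det: "det (mat_of u w) \<noteq> 0" and gram: "u' \<bullet> u' = u \<bullet> u" "u' \<bullet> w' = u \<bullet> w" "w' \<bullet> w' = w \<bullet> w"
  shows "congruent_lat (lattice_of u w) (lattice_of u' w')"
proof -
  let ?B = "mat_of u w" and ?B' = "mat_of u' w'"
  have nsq: "(norm (mat_of u w *v x))^2 = (x $ 1)^2 * (u \<bullet> u) + 2 * (x $ 1) * (x $ 2) * (u \<bullet> w) + (x $ 2)^2 * (w \<bullet> w)" for u w x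
    unfolding power2_norm_eq_inner cols_mult column_mat_of
    by (simp add: inner_add_left inner_add_right inner_commute[of w u] power2_eq_square algebra_simps)
  have n: "norm (?B' *v x) = norm (?B *v x)" for x
  proof -
    have "(norm (?B' *v x))^2 = (norm (?B *v x))^2" unfolding nsq gram ..
    then show ?thesis by simp
  qed
  obtain A where A: "A ** ?B = mat 1" "?B ** A = mat 1"
    using det by (auto simp: invertible_det_nz[symmetric] invertible_def)
  define f where "f x = ?B' *v (A *v x)" for x
  have fB: "f (?B *v x) = ?B' *v x" for x by (simp add: f_def matrix_vector_mul_assoc A)
  have "linear f" unfolding f_def matrix_vector_mul_assoc by (rule matrix_vector_mul_linear)
  moreover have "norm (f x) = norm x" for x
    using n[of "A *v x"] by (simp add: f_def matrix_vector_mul_assoc A)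
  ultimately have "orthogonal_transformation f" by (simp add: orthogonal_transformation)
  moreover have "f ` lattice_of u w = lattice_of u' w'"
    unfolding range_matrix_eq_lattice_of[of ?B, unfolded column_mat_of, symmetric]
      range_matrix_eq_lattice_of[of ?B', unfolded column_mat_of, symmetric] image_image fB ..
  ultimately show ?thesis unfolding congruent_lat_def by blast
qed

lemma scale_lattice_of: "scale_lat k (lattice_of u w) = lattice_of (k *\<^sub>R u) (k *\<^sub>R w)"
  unfolding scale_lat_def lattice_of_def image_image
  by (rule image_cong) (auto simp: scaleR_add_right mult.commute)

lemma hex_alt: "sqrt (2 / sqrt 3) * sqrt (2 / sqrt 3) = hex"
  by (simp add: hex_def)

lemma A2_basis:
  obtains u w where "A2 = lattice_of u w" "det (mat_of u w) = 1" "u \<bullet> u = hex" "u \<bullet> w = hex / 2" "w \<bullet> w = hex"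
proof -
  define r where "r = sqrt (2 / sqrt 3)"
  have r: "r * r = hex" unfolding r_def by (rule hex_alt)
  define u w :: "real^2" where "u = r *\<^sub>R vector [1, 0]" and "w = r *\<^sub>R vector [1/2, sqrt 3 / 2]"
  have comp: "u $ 1 = r" "u $ 2 = 0" "w $ 1 = r / 2" "w $ 2 = r * (sqrt 3 / 2)"
    by (simp_all add: u_def w_def vector_2)
  have "A2 = lattice_of u w"
    unfolding A2_def lattice_of_def u_def w_def r_def
    by (rule image_cong) (auto simp: scaleR_add_right mult.commute)
  moreover have "det (mat_of u w) = r * r * (sqrt 3 / 2)" by (simp add: det_mat_of comp)
  then have "det (mat_of u w) = 1" unfolding r by (simp add: hex_def)
  moreover have "u \<bullet> u = r * r" "u \<bullet> w = r * r / 2" "w \<bullet> w = r * r"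
    by (simp_all add: inner_vec_def sum_2 comp field_simps)
  ultimately show ?thesis using that r by simp
qed

section \<open>The two energies\<close>

lemma Ef_phi:
  fixes L :: "(real^'n) set"
  assumes "lattice L" "real CARD('n) < s" "s < \<alpha>"
  shows "Ef (phi a b \<alpha> s) L = a * zeta L \<alpha> - b * zeta L s"
proof -
  have "infsum (\<lambda>q. a * norm q powr (- \<alpha>) + (- b) * norm q powr (- s)) (L - {0})
      = infsum (\<lambda>q. a * norm q powr (- \<alpha>)) (L - {0}) + infsum (\<lambda>q. (- b) * norm q powr (- s)) (L - {0})"
    using assms by (intro infsum_add summable_on_cmult_right summable_on_lattice_norm_powr) auto
  then show ?thesis by (simp add: Ef_def phi_def zeta_def infsum_cmult_right' infsum_uminus)
qed

lemma lattice_energy_phi: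
  assumes "real CARD('n) < s" "s < \<alpha>" "0 < a" "0 < b"
  shows "lattice_energy (\<lambda>_. 0) (\<lambda>_. 0) \<alpha> s b a (Ef (phi a b \<alpha> s) :: (real^'n) set \<Rightarrow> real)"
proof -
  have "0 < s" using assms(1) by (meson less_trans of_nat_0_less_iff zero_less_card_finite)
  then interpret energy_profile "\<lambda>_. 0" "\<lambda>_. 0" "\<alpha> / s" b
    using assms by (intro energy_profile_zero) auto
  show ?thesis by unfold_locales (use assms in \<open>auto simp: Ef_phi\<close>)
qed

text \<open>At \<open>r = \<mu> powr (- s) * Z\<close>, with \<mu> the closed formula, the power
  \<open>r powr (\<alpha> / s - 1)\<close> is \<open>Z powr (\<alpha> / s - 1) / k\<close>, and the
  derivative of the profile vanishes. The formula is thus the minimizer \<open>lam\<close> for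
  \<open>F = 0\<close>.\<close>

lemma lamphi_eq:
  fixes L :: "(real^'n) set"
  assumes L: "lattice L" and s: "real CARD('n) < s" "s < \<alpha>" and ab: "0 < a" "0 < b"
  shows "lamphi a b \<alpha> s L = lattice_energy.lam (\<lambda>_. 0) \<alpha> s b a L"
proof -
  interpret lattice_energy "\<lambda>_. 0" "\<lambda>_. 0" \<alpha> s b a "Ef (phi a b \<alpha> s) :: (real^'n) set \<Rightarrow> real"
    by (rule lattice_energy_phi) fact+
  define Z Y where "Z = zeta L s" and "Y = zeta L \<alpha>"
  have pos: "0 < Z" "0 < Y" "0 < s" "0 < \<alpha>" using zeta_s_pos[OF L] zeta_alpha_pos[OF L] s_pos s_less by (auto simp: Z_def Y_def)
  define k where "k = \<alpha> * a * Y / (s * b * Z)"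
  have k: "0 < k" using pos ab by (simp add: k_def)
  define \<mu> where "\<mu> = k powr (1 / (\<alpha> - s))"
  define r where "r = \<mu> powr (- s) * Z"
  have \<mu>: "0 < \<mu>" and r: "0 < r" using k pos by (simp_all add: \<mu>_def r_def)
  have "r powr (\<alpha> / s - 1) = \<mu> powr (- (\<alpha> - s)) * Z powr (\<alpha> / s - 1)"
  proof -
    have "- s * (\<alpha> / s - 1) = - (\<alpha> - s)" using pos by (simp add: field_simps)
    then show ?thesis using pos \<mu> by (simp only: r_def powr_mult powr_powr)
  qed
  also have "\<mu> powr (- (\<alpha> - s)) = 1 / k"
  proof -
    have "1 / (\<alpha> - s) * - (\<alpha> - s) = - 1" using s by (simp add: field_simps)
    then show ?thesis using k by (simp only: \<mu>_def powr_powr) (simp add: powr_minus_divide)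
  qed
  finally have rp: "r powr (\<alpha> / s - 1) = Z powr (\<alpha> / s - 1) / k" by simp
  have "coef L = a * (Y / Z powr (\<alpha> / s))"
    using pos by (simp add: coef_def estar_def powr_divide powr_powr Z_def[symmetric] Y_def[symmetric])
  then have "G' (coef L) r = a * (Y / Z powr (\<alpha> / s)) * (\<alpha> / s) * (Z powr (\<alpha> / s - 1) / k) - b"
    by (simp add: G'_def rp)
  also have "Z powr (\<alpha> / s - 1) = Z powr (\<alpha> / s) / Z" using pos by (simp add: powr_diff)
  also have "a * (Y / Z powr (\<alpha> / s)) * (\<alpha> / s) * (Z powr (\<alpha> / s) / Z / k) - b = 0"
    using pos ab by (simp add: k_def)
  finally have "rmin (coef L) = r" by (intro rmin_eqI coef_pos L r)
  then have "\<mu> = lam L" by (intro lam_eqI L \<mu>) (simp add: r_def Z_def)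
  then show ?thesis by (simp add: \<mu>_def k_def lamphi_def Z_def Y_def)
qed

lemma lattice1_A2: "lattice1 A2"
proof -
  obtain u w where uw: "A2 = lattice_of u w" "det (mat_of u w) = 1" using A2_basis by metis
  then show ?thesis unfolding lattice1_def
    using range_matrix_eq_lattice_of[of "mat_of u w"] by (intro exI[of _ "mat_of u w"]) (simp add: invertible_det_nz)
qed

text \<open>Since \<open>estar\<close> is independent of the weights, one potential suffices: the
  one with weights \<open>s\<close> and \<alpha>. Each lattice is beaten by some multiple of
  \<open>A2\<close>, hence by the optimal multiple, and \<open>unique_min_iff\<close> carries this
  back to covolume one.\<close>

lemma unique_min_lat_estar_A2:
  assumes s: "2 < s" "s < \<alpha>" and H: "Hfun \<alpha> < Hfun s"
  shows "unique_min_lat lattice1 (estar \<alpha> s) A2"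
proof -
  interpret lattice_energy "\<lambda>_. 0" "\<lambda>_. 0" \<alpha> s \<alpha> s "Ef (phi s \<alpha> \<alpha> s) :: (real^2) set \<Rightarrow> real"
    using s by (intro lattice_energy_phi) auto
  let ?E = "Ef (phi s \<alpha> \<alpha> s) :: (real^2) set \<Rightarrow> real"
  have E_form: "?E (lattice_of u w) = enform \<alpha> s (u \<bullet> u) (u \<bullet> w) (w \<bullet> w)" if "det (mat_of u w) \<noteq> 0" for u w
  proof -
    have "lattice (lattice_of u w)" using that by (auto simp: lattice_iff_lattice_of)
    then show ?thesis by (simp add: E_eq zeta_lattice_of that enform_def)
  qed
  have A2: "lattice A2" using lattice1_A2 by (rule lattice1_imp_lattice)
  have key: "\<exists>c>0. ?E (scale_lat c A2) \<le> ?E M \<and> (?E M \<le> ?E (scale_lat c A2) \<longrightarrow> congruent_lat (scale_lat c A2) M)"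
    if M: "lattice M" for M :: "(real^2) set"
  proof -
    obtain u w where uw: "det (mat_of u w) \<noteq> 0" "M = lattice_of u w"
      "0 \<le> u \<bullet> w" "2 * (u \<bullet> w) \<le> u \<bullet> u" "u \<bullet> u \<le> w \<bullet> w"
      using lattice_reduced_basis[OF M] by blast
    obtain u0 w0 where A: "A2 = lattice_of u0 w0" "det (mat_of u0 w0) = 1" "u0 \<bullet> u0 = hex" "u0 \<bullet> w0 = hex / 2" "w0 \<bullet> w0 = hex"
      using A2_basis by metis
    have pos: "0 < u \<bullet> u" "0 < (u \<bullet> u) * (w \<bullet> w) - (u \<bullet> w)^2" using gram_pos[OF uw(1)] by auto
    obtain k where k: "0 < k" "enform \<alpha> s (k * hex) (k * (hex / 2)) (k * hex) \<le> enform \<alpha> s (u \<bullet> u) (u \<bullet> w) (w \<bullet> w)"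
      "enform \<alpha> s (u \<bullet> u) (u \<bullet> w) (w \<bullet> w) \<le> enform \<alpha> s (k * hex) (k * (hex / 2)) (k * hex) \<Longrightarrow>
        u \<bullet> u = k * hex \<and> u \<bullet> w = k * (hex / 2) \<and> w \<bullet> w = k * hex"
      using enform_ge_hex[OF uw(3-5) pos s H] by metis
    define r where "r = sqrt k"
    have r: "0 < r" "r * r = k" using k(1) by (simp_all add: r_def)
    have gram: "(r *\<^sub>R u0) \<bullet> (r *\<^sub>R u0) = k * hex" "(r *\<^sub>R u0) \<bullet> (r *\<^sub>R w0) = k * (hex / 2)" "(r *\<^sub>R w0) \<bullet> (r *\<^sub>R w0) = k * hex"
      using A r by (simp_all add: mult.assoc[symmetric])
    have sc: "scale_lat r A2 = lattice_of (r *\<^sub>R u0) (r *\<^sub>R w0)" by (simp add: A(1) scale_lattice_of)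
    have det: "det (mat_of (r *\<^sub>R u0) (r *\<^sub>R w0)) \<noteq> 0"
    proof -
      have "det (mat_of (r *\<^sub>R u0) (r *\<^sub>R w0)) = r * r * det (mat_of u0 w0)" by (simp add: det_mat_of algebra_simps)
      then show ?thesis using A(2) r(1) by simp
    qed
    have "?E (scale_lat r A2) = enform \<alpha> s (k * hex) (k * (hex / 2)) (k * hex)"
      unfolding sc E_form[OF det] gram ..
    then show ?thesis using k(2,3) r(1) E_form[OF uw(1)] congruent_lat_if_gram_eq[OF det, of u w]
      unfolding gram uw(2) sc by (intro exI[of _ r]) (auto simp: sc)
  qed
  have "unique_min_lat lattice ?E (scale_lat (lam A2) A2)"
    unfolding unique_min_lat_def
  proof (intro conjI allI impI)
    show "lattice (scale_lat (lam A2) A2)" using A2 lam_pos[OF A2] by (simp add: lattice_scale_lat)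
    fix M :: "(real^2) set"
    show "?E (scale_lat (lam A2) A2) \<le> ?E M" if M: "lattice M"
      using key[OF M] E_lam_le[OF A2] by (meson order_trans)
    show "congruent_lat (scale_lat (lam A2) A2) M" if "lattice M \<and> ?E M \<le> ?E (scale_lat (lam A2) A2)"
    proof -
      from that key[of M] obtain c where c: "0 < c" "?E (scale_lat c A2) \<le> ?E M"
        "?E M \<le> ?E (scale_lat c A2) \<Longrightarrow> congruent_lat (scale_lat c A2) M" by blast
      \<comment> \<open>A multiple of \<open>A2\<close> that does no worse than the optimal one is
        the optimal one, which turns the congruence with scale \<open>c\<close> into the required
        one.\<close>
      have "?E (scale_lat c A2) \<le> ?E (scale_lat (lam A2) A2)" using c(2) that by simp
      then have "c = lam A2" using E_lam_less[OF A2 c(1)] by force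
      then show ?thesis using c that by simp
    qed
  qed
  then show ?thesis unfolding unique_min_iff[OF lattice1_A2] .
qed

lemma lattice_energy_calE:
  fixes F :: "real \<Rightarrow> real"
  assumes "real CARD('n) < s" "s < \<alpha>" "0 < a" "0 < b"
    and "\<And>r. 0 < r \<Longrightarrow> F differentiable (at r)"
    and "\<And>r. 0 < r \<Longrightarrow> deriv F differentiable (at r)"
    and "convex_on {0<..} F"
    and "(\<lambda>r. r powr (1 - \<alpha> / s) * deriv F r) ` {r. r > 0 \<and> deriv F r < 0} = {..<0}"
  shows "lattice_energy F (deriv F) \<alpha> s b a (calE F a b \<alpha> s :: (real^'n) set \<Rightarrow> real)"
proof -
  have "0 < s" using assms(1) by (meson less_trans of_nat_0_less_iff zero_less_card_finite)
  then interpret energy_profile F "deriv F" "\<alpha> / s" b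
    using assms by (intro energy_profile_convex) auto
  show ?thesis by unfold_locales (use assms in \<open>auto simp: calE_def\<close>)
qed

lemma (in lattice_energy) lamE_eq:
  assumes "lattice L" and "E = calE \<F> a' b' \<alpha>' s'"
  shows "lamE \<F> a' b' \<alpha>' s' L = lam L"
  unfolding lamE_def using unique_min_pos_lam[OF assms(1)]
  by (intro the_equality) (auto simp: assms(2) intro: unique_min_pos_eq)

theorem theorem5p2:
  fixes F :: "real \<Rightarrow> real" and a b \<alpha> s :: real
  assumes ds: "real CARD('n) < s" and s\<alpha>: "s < \<alpha>" and a: "a > 0" and b: "b > 0"
    and F_diff: "\<forall>r>0. F differentiable (at r)"
    and F'_diff: "\<forall>r>0. deriv F differentiable (at r)"
    and F''_cont: "continuous_on {0<..} (deriv (deriv F))"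
    and F_convex: "convex_on {0<..} F"
    and g_mono: "strict_mono_on {r. r > 0 \<and> deriv F r < 0} (\<lambda>r. r powr (1 - \<alpha> / s) * deriv F r)"
    and g_image: "(\<lambda>r. r powr (1 - \<alpha> / s) * deriv F r) ` {r. r > 0 \<and> deriv F r < 0} = {..<0}"
    and hg_decr: "\<forall>x y. x < y \<and> y < 0 \<longrightarrow>
        (let gi = the_inv_into {r. r > 0 \<and> deriv F r < 0} (\<lambda>r. r powr (1 - \<alpha> / s) * deriv F r);
             h = (\<lambda>r. F r - s / \<alpha> * r * deriv F r)
         in h (gi y) < h (gi x))"
  shows
    "(\<forall>L::(real^'n) set. lattice1 L \<longrightarrow>
        unique_min_pos (\<lambda>\<mu>. calE F a b \<alpha> s (scale_lat \<mu> L)) (lamE F a b \<alpha> s L))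
   \<and> (\<forall>L::(real^'n) set. lattice1 L \<longrightarrow>
        unique_min_pos (\<lambda>\<mu>. Ef (phi a b \<alpha> s) (scale_lat \<mu> L)) (lamphi a b \<alpha> s L))
   \<and> (\<forall>Ld::(real^'n) set. lattice1 Ld \<longrightarrow>
        ((unique_min_lat lattice1 (estar \<alpha> s) Ld \<longleftrightarrow>
            unique_min_lat lattice (calE F a b \<alpha> s) (scale_lat (lamE F a b \<alpha> s Ld) Ld))
       \<and> (unique_min_lat lattice1 (estar \<alpha> s) Ld \<longleftrightarrow>
            unique_min_lat lattice (Ef (phi a b \<alpha> s)) (scale_lat (lamphi a b \<alpha> s Ld) Ld))))
   \<and> (2 < s \<and> Hfun \<alpha> < Hfun s \<longrightarrow>
        unique_min_lat lattice (calE F a b \<alpha> s) (scale_lat (lamE F a b \<alpha> s A2) A2))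
   \<and> (\<forall>Ld::(real^'n) set.
        unique_min_lat lattice1 (\<lambda>L. zeta L s) Ld \<and> is_min_lat lattice1 (estar \<alpha> s) Ld \<longrightarrow>
        unique_min_lat lattice1 (lamE F a b \<alpha> s) Ld)"
proof -
  interpret calE: lattice_energy F "deriv F" \<alpha> s b a "calE F a b \<alpha> s :: (real^'n) set \<Rightarrow> real"
    using assms by (intro lattice_energy_calE) auto
  interpret phi: lattice_energy "\<lambda>_. 0" "\<lambda>_. 0" \<alpha> s b a "Ef (phi a b \<alpha> s) :: (real^'n) set \<Rightarrow> real"
    using assms by (intro lattice_energy_phi)
  have lamE: "lamE F a b \<alpha> s L = calE.lam L" if "lattice1 L" for L :: "(real^'n) set"
    using lattice1_imp_lattice[OF that] by (rule calE.lamE_eq) simp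
  have lamphi: "lamphi a b \<alpha> s L = phi.lam L" if "lattice1 L" for L :: "(real^'n) set"
    using lattice1_imp_lattice[OF that] ds s\<alpha> a b by (rule lamphi_eq)
  have "unique_min_lat lattice (calE F a b \<alpha> s) (scale_lat (lamE F a b \<alpha> s A2) A2)"
    if "2 < s" "Hfun \<alpha> < Hfun s"
  proof -
    \<comment> \<open>The type \<open>'n\<close> is arbitrary while \<open>A2\<close> lives in
      \<open>real^2\<close>, so the energy is instantiated once more in dimension two; the
      assumption \<open>2 < s\<close> supplies the convergence there.\<close>
    interpret calE2: lattice_energy F "deriv F" \<alpha> s b a "calE F a b \<alpha> s :: (real^2) set \<Rightarrow> real"
      using assms that(1) by (intro lattice_energy_calE) auto
    have "unique_min_lat lattice1 (estar \<alpha> s) A2"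
      using that s\<alpha> by (intro unique_min_lat_estar_A2)
    moreover from this have A2: "lattice1 A2" by (simp add: unique_min_lat_def)
    ultimately show ?thesis
      using calE2.unique_min_iff[OF A2] calE2.lamE_eq[OF lattice1_imp_lattice[OF A2] refl] by simp
  qed
  moreover have "unique_min_lat lattice1 (lamE F a b \<alpha> s) L"
    if "unique_min_lat lattice1 (\<lambda>L. zeta L s) L" "is_min_lat lattice1 (estar \<alpha> s) L" for L :: "(real^'n) set"
    using calE.unique_min_lam[OF that] lamE by (auto simp: unique_min_lat_def)
  ultimately show ?thesis
    using calE.unique_min_pos_lam phi.unique_min_pos_lam calE.unique_min_iff phi.unique_min_iff
    by (auto simp: lamE lamphi lattice1_imp_lattice)
qed

end
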